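(* Let $\mathbb{K}$ be an algebraically closed field with $\operatorname{char}(\mathbb{K})\neq 2$. Let $G$ be a non-bipartite graph on $[n]$ obtained by adding a chord to an even cycle $C_n$, and let $R=\mathbb{K}[x_1,\dots,x_n,y_1,\dots,y_n]$. Then $\mathrm{v}(\mathcal{I}_G)\leq \operatorname{reg}(R/\mathcal{I}_G)$.
   Context: $C_n$ is the cycle on $n$ vertices; it is even if $n$ is even. A chord is an edge joining two vertices that are not adjacent in $C_n$. $R$ has the standard grading. The parity binomial edge ideal is $\mathcal{I}_G=(x_ix_j-y_iy_j:\{i,j\}\in E(G))\subseteq R$. For a graded ideal $I\subset R$, the $\mathrm{v}$-number is $\mathrm{v}(I)=\min\{d\ge 0:\exists f\in R_d \text{ and } \mathfrak p\in\mathrm{Ass}(I) \text{ with } I:f=\mathfrak p\}$, and $\operatorname{reg}(R/I)=\max\{j-i:\beta_{i,j}(R/I)\neq 0\}$ is the Castelnuovo–Mumford regularity. *)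

theory Defs
  imports
    "HOL-Library.Poly_Mapping"
    "HOL-Library.Extended_Real"
    "HOL-Computational_Algebra.Computational_Algebra"
    "Jordan_Normal_Form.Matrix_Kernel"
begin

section \<open>Ideals of a commutative ring\<close>

text \<open>
  Ideals are the submodules of the ring regarded as a module over itself, so
  \<open>self_module.subspace\<close> means ``is an ideal'' and \<open>self_module.span S\<close> is the ideal
  generated by \<open>S\<close>.
\<close>

global_interpretation self_module: Modules.module "(*) :: 'a :: comm_ring_1 \<Rightarrow> 'a \<Rightarrow> 'a"
  by standard (simp_all add: algebra_simps)

definition is_prime_ideal :: "'a :: comm_ring_1 set \<Rightarrow> bool" where
  "is_prime_ideal P \<longleftrightarrow> self_module.subspace P \<and> P \<noteq> UNIV \<and>
     (\<forall>a b. a * b \<in> P \<longrightarrow> a \<in> P \<or> b \<in> P)"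

definition colon :: "'a :: comm_ring_1 set \<Rightarrow> 'a \<Rightarrow> 'a set" where
  "colon I f = {g. g * f \<in> I}"

text \<open>
  \<open>Ass(I)\<close> denotes the associated primes of the module \<open>R/I\<close>, i.e. the prime ideals that are
  annihilators of elements of \<open>R/I\<close>; the annihilator of the class of \<open>g\<close> is \<open>I : g\<close>.
\<close>

definition Ass :: "'a :: comm_ring_1 set \<Rightarrow> 'a set set" where
  "Ass I = {P. is_prime_ideal P \<and> (\<exists>g. P = colon I g)}"


section \<open>Polynomial rings with the standard grading\<close>

text \<open>
  Polynomials over \<open>'k\<close> whose variables are the elements of the (finite) type \<open>'x\<close>.
\<close>

type_synonym ('x, 'k) mpoly = "('x \<Rightarrow>\<^sub>0 nat) \<Rightarrow>\<^sub>0 'k"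

definition indet :: "'x \<Rightarrow> ('x, 'k :: comm_ring_1) mpoly" where
  "indet x = Poly_Mapping.single (Poly_Mapping.single x 1) 1"

definition monom_deg :: "('x :: finite \<Rightarrow>\<^sub>0 nat) \<Rightarrow> nat" where
  "monom_deg m = (\<Sum>x\<in>UNIV. Poly_Mapping.lookup m x)"

text \<open>
  The graded component \<open>R\<^sub>d\<close>. It contains 0, and it is \<open>{0}\<close> for negative \<open>d\<close>.
\<close>

definition graded_part :: "int \<Rightarrow> ('x :: finite, 'k :: comm_ring_1) mpoly set" where
  "graded_part d = {f. \<forall>m\<in>Poly_Mapping.keys f. int (monom_deg m) = d}"

text \<open>
  The infimum of extended reals is a minimum whenever some \<open>d\<close> qualifies; it is \<open>\<infinity>\<close> otherwise.
\<close>

definition v_number :: "('x :: finite, 'k :: field) mpoly set \<Rightarrow> ereal" where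
  "v_number I = Inf {ereal (real d) | d :: nat.
     \<exists>f\<in>graded_part (int d). \<exists>P\<in>Ass I. colon I f = P}"


section \<open>Graded Betti numbers and regularity of \<open>R/I\<close>\<close>

text \<open>
  A minimal graded free resolution
  \<open>\<dots> \<rightarrow> F\<^sub>2 \<rightarrow> F\<^sub>1 \<rightarrow> F\<^sub>0 \<rightarrow> R/I \<rightarrow> 0\<close>. The list \<open>s i\<close> holds the degrees of the
  elements of a homogeneous basis of \<open>F\<^sub>i\<close>, that is,
  \<open>F\<^sub>i = \<Oplus>\<^sub>k R(-s i ! k)\<close>. The matrix \<open>D i\<close> represents the differential from
  \<open>F\<^bsub>i+1\<^esub>\<close> to \<open>F\<^sub>i\<close>, and the entries of \<open>e\<close> are representatives in \<open>R\<close> of the images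
  in \<open>R/I\<close> of the basis elements of \<open>F\<^sub>0\<close>. The clauses say, in order: the augmentation is
  graded of degree 0; it is surjective; the differentials are graded of degree 0; the sequence
  is exact at \<open>F\<^sub>0\<close>; it is exact at every \<open>F\<^bsub>i+1\<^esub>\<close>; and it is minimal, i.e. all entries of the
  differentials lie in the ideal generated by the variables.
\<close>

definition minimal_graded_free_resolution ::
  "('x :: finite, 'k :: field) mpoly set \<Rightarrow> (nat \<Rightarrow> int list) \<Rightarrow>
   ('x, 'k) mpoly vec \<Rightarrow> (nat \<Rightarrow> ('x, 'k) mpoly mat) \<Rightarrow> bool" where
  "minimal_graded_free_resolution I s e D \<longleftrightarrow>
     e \<in> carrier_vec (length (s 0)) \<and>
     (\<forall>i. D i \<in> carrier_mat (length (s i)) (length (s (Suc i)))) \<and>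
     (\<forall>k < length (s 0). e $ k \<in> graded_part (s 0 ! k)) \<and>
     (\<forall>f. \<exists>v \<in> carrier_vec (length (s 0)). f - e \<bullet> v \<in> I) \<and>
     (\<forall>i. \<forall>k < length (s i). \<forall>l < length (s (Suc i)).
        D i $$ (k, l) \<in> graded_part (s (Suc i) ! l - s i ! k)) \<and>
     {v \<in> carrier_vec (length (s 0)). e \<bullet> v \<in> I} =
       (\<lambda>w. D 0 *\<^sub>v w) ` carrier_vec (length (s 1)) \<and>
     (\<forall>i. mat_kernel (D i) =
        (\<lambda>w. D (Suc i) *\<^sub>v w) ` carrier_vec (length (s (Suc (Suc i))))) \<and>
     (\<forall>i. \<forall>k < length (s i). \<forall>l < length (s (Suc i)).
        D i $$ (k, l) \<in> self_module.span (range indet))"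

text \<open>
  The number of basis elements of degree \<open>j\<close> of \<open>F\<^sub>i\<close> in a minimal graded free resolution of
  \<open>R/I\<close>. For a graded ideal \<open>I\<close> such a resolution exists and is unique up to isomorphism,
  so the number does not depend on the choice.
\<close>

definition graded_betti :: "('x :: finite, 'k :: field) mpoly set \<Rightarrow> nat \<Rightarrow> int \<Rightarrow> nat" where
  "graded_betti I i j =
     count_list ((SOME s. \<exists>e D. minimal_graded_free_resolution I s e D) i) j"

text \<open>
  The regularity of \<open>R/I\<close>. For a graded ideal only finitely many Betti numbers are nonzero, so
  for \<open>I \<noteq> R\<close> the supremum is a maximum; for the zero module it is \<open>-\<infinity>\<close>.
\<close>

definition reg_quotient :: "('x :: finite, 'k :: field) mpoly set \<Rightarrow> ereal" where
  "reg_quotient I = Sup {ereal (real_of_int (j - int i)) | i j. graded_betti I i j \<noteq> 0}"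


section \<open>Graphs\<close>

text \<open>
  A graph is given by its set of edges, which are two-element sets of vertices. The vertex set is
  all of the type \<open>'v\<close>, so the role of \<open>[n]\<close> is played by a finite type with \<open>n\<close> elements.
\<close>

definition is_bipartite :: "'v set set \<Rightarrow> bool" where
  "is_bipartite E \<longleftrightarrow>
     (\<exists>A B. A \<union> B = UNIV \<and> A \<inter> B = {} \<and> (\<forall>e\<in>E. \<exists>a\<in>A. \<exists>b\<in>B. e = {a, b}))"

definition is_cycle_graph :: "nat \<Rightarrow> 'v set set \<Rightarrow> bool" where
  "is_cycle_graph n C \<longleftrightarrow> n \<ge> 3 \<and>
     (\<exists>c. bij_betw c {..<n} (UNIV :: 'v set) \<and> C = {{c i, c ((i + 1) mod n)} | i. i < n})"

definition is_chord :: "'v set set \<Rightarrow> 'v set \<Rightarrow> bool" where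
  "is_chord C e \<longleftrightarrow> (\<exists>u v. u \<noteq> v \<and> e = {u, v} \<and> e \<notin> C)"

text \<open>
  The variables of \<open>R\<close> are indexed by two copies of the vertex set: \<open>x\<^sub>i\<close> is the variable
  \<open>Inl i\<close> and \<open>y\<^sub>i\<close> is the variable \<open>Inr i\<close>.
\<close>

definition parity_binomial_edge_ideal ::
  "'v set set \<Rightarrow> ('v + 'v, 'k :: field) mpoly set" where
  "parity_binomial_edge_ideal E = self_module.span
     {indet (Inl i) * indet (Inl j) - indet (Inr i) * indet (Inr j) | i j. {i, j} \<in> E}"

end

theory Submission
  imports Defs
begin

text \<open>
  Both sides are compared with \<open>n - 2\<close>. Label the vertices along the cycle so that the chord joins \<open>0\<close>
  to an even \<open>k\<close> and swap \<open>x\<close> and \<open>y\<close> at the odd vertices: the edges of the cycle become \<open>2 \<times> 2\<close>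
  minors \<open>A\<^sub>iB\<^sub>j - B\<^sub>iA\<^sub>j\<close> and the chord becomes \<open>A\<^sub>0A\<^sub>k - B\<^sub>0B\<^sub>k\<close>.

  Deleting the vertex \<open>0\<close> leaves an induced path, whose \<open>r = n - 2\<close> minors lie in \<open>I\<close>, form a regular
  sequence modulo \<open>J\<^sub>0 = (A\<^sub>0, B\<^sub>0)\<close> and generate \<open>I\<close> modulo \<open>J\<^sub>0\<close>. Hence \<open>Ext\<^sup>r(R/I, R/J\<^sub>0)\<close> is nonzero in
  degree \<open>-2r\<close>, so every graded free resolution of \<open>R/I\<close> has in homological degree \<open>r\<close> a generator
  of degree at least \<open>2r\<close>, and \<open>reg(R/I) \<ge> r\<close>.

  The locus where the vertex \<open>0\<close> vanishes and all other vertices are proportional is irreducible. Its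
  prime \<open>P\<close> contains \<open>I\<close>, and \<open>f = (A\<^sub>1A\<^sub>k - B\<^sub>1B\<^sub>k) \<Prod> A\<^sub>l\<close>, the product being over the other \<open>l\<close> with
  \<open>2 \<le> l \<le> n - 2\<close>, lies outside \<open>P\<close> and satisfies \<open>f P \<subseteq> I\<close>. So \<open>I : f = P\<close>, and \<open>v(I) \<le> n - 2\<close>.
\<close>

text \<open>As a simplification rule this one undoes \<open>mult.assoc\<close>.\<close>

declare self_module.scale_scale [simp del]

text \<open>The obstacle on the regularity side is that \<open>graded_betti\<close> reads off a
  resolution picked by choice. Existence of a minimal graded free resolution is established so that
  the pick is genuine; uniqueness is avoided, because the degree bound holds for every such
  resolution. The bound is a dimension shift: each \<open>g k\<close> lies in I, so it acts as zero
  on the Ext modules of R/I while being regular on the coefficients. Lower Ext modules vanish, and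
  the class of the surjection onto R modulo the last path ideal climbs to homological degree r, its
  degree dropping by 2 at each step. A nonzero cochain of degree -2r with polynomial entries needs a
  generator of degree at least 2r.

  On the other side P is taken as the kernel of an evaluation into a domain, which makes primality
  immediate; what remains is to control this kernel, by exchanging A_i B_j for B_i A_j inside
  monomials.

  Non-bipartiteness enters only through the parity of k: an odd k would leave the parity colouring
  proper. For even k the odd cycle through 0, ..., k produces the factor of the witness that kills
  both variables at 0.\<close>

abbreviation lookup :: "('a \<Rightarrow>\<^sub>0 'b::zero) \<Rightarrow> 'a \<Rightarrow> 'b" where
  "lookup \<equiv> Poly_Mapping.lookup"
abbreviation keys :: "('a \<Rightarrow>\<^sub>0 'b::zero) \<Rightarrow> 'a set" where
  "keys \<equiv> Poly_Mapping.keys"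
abbreviation single :: "'a \<Rightarrow> 'b \<Rightarrow> ('a \<Rightarrow>\<^sub>0 'b::zero)" where
  "single \<equiv> Poly_Mapping.single"
abbreviation ideal :: "'a :: comm_ring_1 set \<Rightarrow> bool" where
  "ideal \<equiv> self_module.subspace"
abbreviation ideal_of :: "'a :: comm_ring_1 set \<Rightarrow> 'a set" where
  "ideal_of \<equiv> self_module.span"

lemmas ideal_zero = self_module.subspace_0
lemmas ideal_add = self_module.subspace_add
lemmas ideal_diff = self_module.subspace_diff
lemmas ideal_neg = self_module.subspace_neg
lemmas ideal_sum = self_module.subspace_sum

lemma ideal_mult: "ideal J \<Longrightarrow> x \<in> J \<Longrightarrow> c * x \<in> J"
  by (rule self_module.subspace_scale)

lemma ideal_mult': "ideal J \<Longrightarrow> x \<in> J \<Longrightarrow> x * c \<in> J" for x :: "'a :: comm_ring_1"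
  by (subst mult.commute) (rule ideal_mult)

lemma ideal_colon: "ideal J \<Longrightarrow> ideal (colon J f)"
  unfolding colon_def
proof (rule self_module.subspaceI)
  fix c x assume "ideal J" "x \<in> {g. g * f \<in> J}"
  then show "c * x \<in> {g. g * f \<in> J}" using ideal_mult[of J "x * f" c] by (simp add: mult.assoc)
qed (simp_all add: ideal_zero ideal_add distrib_right)

lemma ideal_diff_trans: "ideal J \<Longrightarrow> x - y \<in> J \<Longrightarrow> y - z \<in> J \<Longrightarrow> x - z \<in> J"
  using ideal_add[of J "x - y" "y - z"] by simp

section \<open>Coefficients and monomials\<close>

lemma lookup_sum_single:
  "finite A \<Longrightarrow> lookup (\<Sum>m\<in>A. single m (c m)) m = (if m \<in> A then c m else 0)"
  by (induction A rule: finite_induct) (auto simp: lookup_add lookup_single when_def)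

lemma sum_monomials: "(\<Sum>m\<in>keys f. single m (lookup f m)) = f"
  by (rule poly_mapping_eqI) (auto simp: lookup_sum_single in_keys_iff)

lemma poly_mapping_induct_monomials [case_names zero add single]:
  assumes "P 0" "\<And>f g. P f \<Longrightarrow> P g \<Longrightarrow> P (f + g)" "\<And>m c. P (single m c)"
  shows "P (f :: 'a \<Rightarrow>\<^sub>0 'b :: comm_monoid_add)"
proof -
  have "P (\<Sum>m\<in>A. single m (lookup f m))" if "finite A" for A
    using that by (induction A rule: finite_induct) (simp_all add: assms)
  from this[of "keys f"] show ?thesis by (simp add: sum_monomials)
qed

lemma lookup_single_mult:
  fixes f :: "('x \<Rightarrow>\<^sub>0 nat) \<Rightarrow>\<^sub>0 'k :: semiring_0"
  shows "lookup (single e c * f) (e + m) = c * lookup f m"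
  by (induction f rule: poly_mapping_induct_monomials)
    (auto simp: distrib_left lookup_add mult_single lookup_single when_def)

lemma lookup_single_mult_eq_0:
  fixes f :: "('x \<Rightarrow>\<^sub>0 nat) \<Rightarrow>\<^sub>0 'k :: semiring_0"
  assumes "lookup m x < lookup e x"
  shows "lookup (single e c * f) m = 0"
proof (induction f rule: poly_mapping_induct_monomials)
  case (single m' c')
  have "e + m' \<noteq> m" using assms by (auto simp: lookup_add)
  then show ?case by (simp add: mult_single lookup_single when_def)
qed (auto simp: algebra_simps lookup_add)

lemma indet_factor:
  fixes m :: "'x \<Rightarrow>\<^sub>0 nat"
  assumes "lookup m x > 0"
  obtains m' where "m = single x 1 + m'"
proof
  show "m = single x 1 + (m - single x 1)"
  proof (rule poly_mapping_eqI)
    fix y show "lookup m y = lookup (single x 1 + (m - single x 1)) y"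
      using assms by (cases "y = x") (simp_all add: lookup_add lookup_minus lookup_single)
  qed
qed

lemma lookup_indet_mult:
  fixes f :: "('x, 'k :: comm_ring_1) mpoly"
  shows "lookup (indet x * f) (single x 1 + m) = lookup f m"
  unfolding indet_def by (simp only: lookup_single_mult mult_1_left)

lemma lookup_indet_mult_eq_0:
  fixes f :: "('x, 'k :: comm_ring_1) mpoly"
  shows "lookup m x = 0 \<Longrightarrow> lookup (indet x * f) m = 0"
  unfolding indet_def by (rule lookup_single_mult_eq_0[of _ x]) simp

section \<open>Dividing by a variable\<close>

text \<open>Terms not divisible by \<open>x\<close> are dropped.\<close>

definition div_indet :: "'x \<Rightarrow> ('x, 'k :: comm_ring_1) mpoly \<Rightarrow> ('x, 'k) mpoly" where
  "div_indet x f = Poly_Mapping.map_key ((+) (single x 1)) f"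

lemma inj_add_monomial: "inj ((+) (m :: 'x \<Rightarrow>\<^sub>0 nat))"
  by (simp add: inj_def)

lemma lookup_div_indet: "lookup (div_indet x f) m = lookup f (single x 1 + m)"
  unfolding div_indet_def using inj_add_monomial[of "single x 1"]
  by (simp add: map_key.rep_eq)

lemma div_indet_add: "div_indet x (f + g) = div_indet x f + div_indet x g"
  by (rule poly_mapping_eqI) (simp add: lookup_div_indet lookup_add)

lemma div_indet_diff: "div_indet x (f - g) = div_indet x f - div_indet x g"
  by (rule poly_mapping_eqI) (simp add: lookup_div_indet lookup_minus)

lemma div_indet_0 [simp]: "div_indet x 0 = 0"
  by (rule poly_mapping_eqI) (simp add: lookup_div_indet)

lemma div_indet_indet_mult [simp]: "div_indet x (indet x * f) = f"
  by (rule poly_mapping_eqI) (simp add: lookup_div_indet lookup_indet_mult del: One_nat_def)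

text \<open>This says that no term of \<open>p\<close> involves \<open>x\<close> (take
  \<open>f = 1\<close> for one direction), in the form in which it is used: multiplication by
  \<open>p\<close> commutes with division by \<open>x\<close>. Closure under products and
  differences is then immediate.\<close>

definition free_of :: "'x \<Rightarrow> ('x, 'k :: comm_ring_1) mpoly \<Rightarrow> bool" where
  "free_of x p \<longleftrightarrow> (\<forall>f. div_indet x (p * f) = p * div_indet x f)"

lemma free_of_mult: "free_of x p \<Longrightarrow> free_of x q \<Longrightarrow> free_of x (p * q)"
  by (simp add: free_of_def mult.assoc)

lemma free_of_diff: "free_of x p \<Longrightarrow> free_of x q \<Longrightarrow> free_of x (p - q)"
  by (simp add: free_of_def algebra_simps div_indet_diff)

lemma free_of_indet:
  assumes "x \<noteq> y"
  shows "free_of x (indet y)"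
  unfolding free_of_def
proof (intro allI poly_mapping_eqI)
  fix f :: "('a, 'b) mpoly" and m
  show "lookup (div_indet x (indet y * f)) m = lookup (indet y * div_indet x f) m"
  proof (cases "lookup m y = 0")
    case True
    then show ?thesis using assms
      by (simp add: lookup_div_indet lookup_indet_mult_eq_0 lookup_add lookup_single)
  next
    case False
    then obtain m' where m: "m = single y 1 + m'" using indet_factor[of m y] by auto
    have "single x 1 + m = single y 1 + (single x 1 + m')" by (simp add: m ac_simps)
    then show ?thesis
      by (simp only: lookup_div_indet lookup_indet_mult m)
  qed
qed

text \<open>Division by \<open>x\<close> is linear over \<open>x\<close>-free polynomials, so it
  maps an ideal with \<open>x\<close>-free generators into itself.\<close>

lemma div_indet_ideal_of:
  assumes "\<And>p. p \<in> S \<Longrightarrow> free_of x p" "f \<in> ideal_of S"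
  shows "div_indet x f \<in> ideal_of S"
  using assms(2)
proof (induction f rule: self_module.span_induct_alt)
  case (step c p f)
  have "div_indet x (p * c) = p * div_indet x c" using assms(1)[OF step(1)] by (simp add: free_of_def)
  then have "div_indet x (c * p) = div_indet x c * p" by (simp add: mult.commute)
  then show ?case using step
    by (simp add: div_indet_add self_module.span_add self_module.span_base self_module.span_scale)
qed (simp add: self_module.span_zero)

text \<open>Each division kills a monomial or lowers its exponent at \<open>x\<close>. Asking for
  all \<open>n\<close> beyond \<open>N\<close> lets two bounds be merged by \<open>max\<close> when
  summands are added.\<close>

lemma div_indet_nilpotent: "\<exists>N. \<forall>n\<ge>N. (div_indet x ^^ n) f = 0"
proof (induction f rule: poly_mapping_induct_monomials)
  case zero
  have "(div_indet x ^^ n) 0 = 0" for n by (induction n) auto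
  then show ?case by blast
next
  case (add f g)
  then obtain N M where "\<forall>n\<ge>N. (div_indet x ^^ n) f = 0" "\<forall>n\<ge>M. (div_indet x ^^ n) g = 0"
    by blast
  moreover have "(div_indet x ^^ n) (f + g) = (div_indet x ^^ n) f + (div_indet x ^^ n) g" for n
    by (induction n) (auto simp: div_indet_add)
  ultimately show ?case by (intro exI[of _ "max N M"]) auto
next
  case (single m c)
  have *: "(div_indet x ^^ n) (single m c) = 0 \<or>
     (\<exists>m'. (div_indet x ^^ n) (single m c) = single m' c \<and> lookup m' x + n \<le> lookup m x)" for n
  proof (induction n)
    case (Suc n)
    have "div_indet x (single m' c) = 0 \<or>
     (\<exists>m''. div_indet x (single m' c) = single m'' c \<and> lookup m'' x + 1 \<le> lookup m' x)" for m'
    proof (cases "lookup m' x = 0")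
      case True
      have "single x 1 + m'' \<noteq> m'" for m''
        using True by (metis lookup_add lookup_single_eq add_is_0 one_neq_zero)
      then have "div_indet x (single m' c) = 0"
        by (intro poly_mapping_eqI) (auto simp: lookup_div_indet lookup_single when_def)
      then show ?thesis by simp
    next
      case False
      then obtain m'' where m: "m' = single x 1 + m''" using indet_factor[of m' x] by auto
      then have "div_indet x (single m' c) = single m'' c"
        by (intro poly_mapping_eqI) (auto simp: lookup_div_indet lookup_single when_def)
      then show ?thesis using m by (auto simp: lookup_add)
    qed
    then have step: "div_indet x (single m' c) = 0 \<or>
      (\<exists>m''. div_indet x (single m' c) = single m'' c \<and> lookup m'' x + Suc n \<le> lookup m x)"
      if "lookup m' x + n \<le> lookup m x" for m'
      using that by fastforce
    from Suc show ?case
    proof (elim disjE exE conjE)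
      fix m' assume "(div_indet x ^^ n) (single m c) = single m' c" "lookup m' x + n \<le> lookup m x"
      with step[of m'] show ?thesis by simp
    qed simp
  qed auto
  show ?case
  proof (intro exI allI impI)
    fix n assume "n \<ge> Suc (lookup m x)"
    with *[of n] show "(div_indet x ^^ n) (single m c) = 0" by auto
  qed
qed

section \<open>Homogeneous components\<close>

lemma monom_deg_add: "monom_deg (m + m') = monom_deg m + monom_deg m'"
  by (simp add: monom_deg_def lookup_add sum.distrib)

lemma monom_deg_single [simp]: "monom_deg (single x k) = k"
  by (simp add: monom_deg_def lookup_single when_def)

lemma monom_deg_0 [simp]: "monom_deg 0 = 0"
  by (simp add: monom_deg_def)

lemma monom_deg_eq_0_iff: "monom_deg m = 0 \<longleftrightarrow> m = 0"
  by (auto simp: monom_deg_def intro: poly_mapping_eqI)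

text \<open>Degrees are integers because the shifted degrees \<delta> - s k in twisted free modules
  can be negative; the component is then 0.\<close>

lift_definition hom_comp :: "int \<Rightarrow> ('x :: finite, 'k :: comm_ring_1) mpoly \<Rightarrow> ('x, 'k) mpoly"
  is "\<lambda>d f m. if int (monom_deg m) = d then f m else 0"
  by (rule finite_subset[rotated]) auto

lemma lookup_hom_comp: "lookup (hom_comp d f) m = (if int (monom_deg m) = d then lookup f m else 0)"
  by transfer simp

lemma graded_partD: "f \<in> graded_part d \<Longrightarrow> int (monom_deg m) \<noteq> d \<Longrightarrow> lookup f m = 0"
  by (auto simp: graded_part_def in_keys_iff)

lemma graded_partI: "(\<And>m. int (monom_deg m) \<noteq> d \<Longrightarrow> lookup f m = 0) \<Longrightarrow> f \<in> graded_part d"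
  by (auto simp: graded_part_def in_keys_iff)

lemma hom_comp_graded: "hom_comp d f \<in> graded_part d"
  by (rule graded_partI) (simp add: lookup_hom_comp)

lemma hom_comp_same: "f \<in> graded_part d \<Longrightarrow> hom_comp d f = f"
  by (rule poly_mapping_eqI) (auto simp: lookup_hom_comp graded_partD)

lemma hom_comp_other: "f \<in> graded_part d \<Longrightarrow> d \<noteq> e \<Longrightarrow> hom_comp e f = 0"
  by (rule poly_mapping_eqI) (auto simp: lookup_hom_comp graded_partD)

lemma hom_comp_add: "hom_comp d (f + g) = hom_comp d f + hom_comp d g"
  by (rule poly_mapping_eqI) (simp add: lookup_hom_comp lookup_add)

lemma hom_comp_diff: "hom_comp d (f - g) = hom_comp d f - hom_comp d g"
  by (rule poly_mapping_eqI) (simp add: lookup_hom_comp lookup_minus)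

lemma hom_comp_0 [simp]: "hom_comp d 0 = 0"
  by (rule poly_mapping_eqI) (simp add: lookup_hom_comp)

lemma hom_comp_sum: "hom_comp d (sum f A) = (\<Sum>a\<in>A. hom_comp d (f a))"
  by (induction A rule: infinite_finite_induct) (auto simp: hom_comp_add)

lemma graded_part_0 [simp]: "0 \<in> graded_part d"
  by (rule graded_partI) simp

lemma graded_part_add: "f \<in> graded_part d \<Longrightarrow> g \<in> graded_part d \<Longrightarrow> f + g \<in> graded_part d"
  by (rule graded_partI) (auto simp: lookup_add graded_partD)

lemma graded_part_diff: "f \<in> graded_part d \<Longrightarrow> g \<in> graded_part d \<Longrightarrow> f - g \<in> graded_part d"
  by (rule graded_partI) (auto simp: lookup_minus graded_partD)

lemma graded_part_sum: "(\<And>a. a \<in> A \<Longrightarrow> f a \<in> graded_part d) \<Longrightarrow> sum f A \<in> graded_part d"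
  by (induction A rule: infinite_finite_induct) (auto intro: graded_part_add)

lemma graded_part_mult:
  fixes f g :: "('x :: finite, 'k :: comm_ring_1) mpoly"
  assumes "f \<in> graded_part d" "g \<in> graded_part e"
  shows "f * g \<in> graded_part (d + e)"
proof -
  have "keys (f * g) \<subseteq> {a + b | a b. a \<in> keys f \<and> b \<in> keys g}" by (rule keys_mult)
  with assms show ?thesis by (fastforce simp: graded_part_def monom_deg_add)
qed

lemma graded_part_indet: "indet x \<in> graded_part 1"
  by (auto simp: graded_part_def indet_def)

lemma graded_part_one: "1 \<in> graded_part 0"
  by (auto simp: graded_part_def)

lemma graded_part_prod:
  fixes f :: "'i \<Rightarrow> ('x :: finite, 'k :: comm_ring_1) mpoly"
  assumes "finite A" "\<And>i. i \<in> A \<Longrightarrow> f i \<in> graded_part 1"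
  shows "prod f A \<in> graded_part (int (card A))"
  using assms
proof (induction A rule: finite_induct)
  case (insert i A)
  then show ?case using graded_part_mult[of "f i" 1 "prod f A" "int (card A)"] by (auto simp: algebra_simps)
qed (simp add: graded_part_one)

lemma sum_hom_comp:
  assumes "\<And>m. m \<in> keys f \<Longrightarrow> monom_deg m < N"
  shows "(\<Sum>d<N. hom_comp (int d) f) = f"
proof (rule poly_mapping_eqI)
  fix m
  show "lookup (\<Sum>d<N. hom_comp (int d) f) m = lookup f m"
    using assms[of m]
    by (cases "m \<in> keys f") (auto simp: lookup_sum lookup_hom_comp in_keys_iff)
qed

lemma monom_deg_bounded: "\<exists>N. \<forall>m\<in>keys f. monom_deg m < N"
proof
  show "\<forall>m\<in>keys f. monom_deg m < Suc (Max (monom_deg ` keys f))"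
    by (simp add: less_Suc_eq_le)
qed

lemma sum_hom_compE:
  obtains N where "f = (\<Sum>d<N. hom_comp (int d) f)"
proof -
  from monom_deg_bounded[of f] obtain N where "\<forall>m\<in>keys f. monom_deg m < N" by blast
  then show ?thesis using sum_hom_comp[of f N] that by metis
qed

text \<open>Expand \<open>f\<close> into its components: the product of \<open>g\<close> with the
  component of degree i is homogeneous of degree i + e, so only i = d - e contributes.\<close>

lemma hom_comp_mult_graded:
  fixes f g :: "('x :: finite, 'k :: comm_ring_1) mpoly"
  assumes g: "g \<in> graded_part e"
  shows "hom_comp d (f * g) = hom_comp (d - e) f * g"
proof -
  obtain N where N: "f = (\<Sum>i<N. hom_comp (int i) f)" by (rule sum_hom_compE)
  have hc: "hom_comp a (hom_comp (int i) f) = (if a = int i then hom_comp (int i) f else 0)" for a i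
    using hom_comp_same[OF hom_comp_graded] hom_comp_other[OF hom_comp_graded] by metis
  have "hom_comp d (hom_comp (int i) f * g) = hom_comp (d - e) (hom_comp (int i) f) * g" for i
  proof -
    have gr: "hom_comp (int i) f * g \<in> graded_part (int i + e)"
      by (rule graded_part_mult[OF hom_comp_graded g])
    show ?thesis
    proof (cases "d - e = int i")
      case True
      then have "d = int i + e" by simp
      then show ?thesis using hom_comp_same[OF gr] by (simp add: hc)
    next
      case False
      then have "int i + e \<noteq> d" by simp
      then show ?thesis using hom_comp_other[OF gr] False by (simp add: hc)
    qed
  qed
  then have "hom_comp d (\<Sum>i<N. hom_comp (int i) f * g)
      = hom_comp (d - e) (\<Sum>i<N. hom_comp (int i) f) * g"
    by (simp add: hom_comp_sum sum_distrib_right)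
  then show ?thesis using N by (simp add: sum_distrib_right[symmetric])
qed

definition graded_ideal :: "('x :: finite, 'k :: comm_ring_1) mpoly set \<Rightarrow> bool" where
  "graded_ideal J \<longleftrightarrow> ideal J \<and> (\<forall>f\<in>J. \<forall>d. hom_comp d f \<in> J)"

lemma graded_ideal_of:
  assumes "\<And>p. p \<in> S \<Longrightarrow> \<exists>d. p \<in> graded_part d"
  shows "graded_ideal (ideal_of S)"
  unfolding graded_ideal_def
proof (intro conjI ballI allI)
  fix f d assume "f \<in> ideal_of S"
  then show "hom_comp d f \<in> ideal_of S"
  proof (induction f rule: self_module.span_induct_alt)
    case (step c p f)
    obtain e where "p \<in> graded_part e" using assms step by blast
    then show ?case using step
      by (simp add: hom_comp_add hom_comp_mult_graded self_module.span_add self_module.span_base self_module.span_scale)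
  qed (simp add: self_module.span_zero)
qed auto

definition irrelevant_ideal :: "('x, 'k :: comm_ring_1) mpoly set" where
  "irrelevant_ideal = ideal_of (range indet)"

text \<open>Minimality becomes a condition on constant coefficients, and over a field a nonzero
  constant coefficient can be inverted.\<close>

lemma irrelevant_ideal_iff:
  fixes f :: "('x, 'k :: comm_ring_1) mpoly"
  shows "f \<in> irrelevant_ideal \<longleftrightarrow> lookup f 0 = 0"
proof
  assume "f \<in> irrelevant_ideal"
  then show "lookup f 0 = 0" unfolding irrelevant_ideal_def
  proof (induction f rule: self_module.span_induct_alt)
    case (step c p f)
    then obtain x where "p = indet x" by auto
    then have "lookup (c * p) 0 = 0"
      by (metis lookup_indet_mult_eq_0 lookup_zero mult.commute)
    then show ?case using step by (simp add: lookup_add)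
  qed simp
next
  assume *: "lookup f 0 = 0"
  have "single m (lookup f m) \<in> irrelevant_ideal" if "m \<in> keys f" for m
  proof -
    have "m \<noteq> 0" using * that by (auto simp: in_keys_iff)
    then obtain x where "lookup m x > 0"
      by (metis gr0I poly_mapping_eqI lookup_zero)
    then obtain m' where m: "m = single x 1 + m'" by (rule indet_factor)
    have "single m (lookup f m) = single m' (lookup f m) * indet x"
      by (simp add: indet_def mult_single m add.commute)
    then show ?thesis unfolding irrelevant_ideal_def
      by (simp add: self_module.span_base self_module.span_scale)
  qed
  then have "(\<Sum>m\<in>keys f. single m (lookup f m)) \<in> irrelevant_ideal"
    unfolding irrelevant_ideal_def by (intro self_module.span_sum)
  then show "f \<in> irrelevant_ideal" by (simp add: sum_monomials)
qed

section \<open>Noetherianity\<close>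

text \<open>A finite basis \<open>B0\<close> for the remaining coordinates serves every element
  whose coordinate at \<open>z\<close> is at least the maximum over \<open>B0\<close>. Below that
  maximum only finitely many values at \<open>z\<close> occur, and each slice has its own finite
  basis.\<close>

lemma dickson:
  fixes f :: "'a \<Rightarrow> 'x \<Rightarrow> nat"
  assumes "finite X"
  shows "\<exists>B\<subseteq>A. finite B \<and> (\<forall>a\<in>A. \<exists>b\<in>B. \<forall>x\<in>X. f b x \<le> f a x)"
  using assms
proof (induction X arbitrary: A rule: finite_induct)
  case empty
  show ?case
  proof (cases "A = {}")
    case False
    then obtain a where "a \<in> A" by blast
    then show ?thesis by (intro exI[of _ "{a}"]) auto
  qed auto
next
  case (insert z X)
  from insert.IH[of A] obtain B0 where B0: "B0 \<subseteq> A" "finite B0"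
    "\<And>a. a \<in> A \<Longrightarrow> \<exists>b\<in>B0. \<forall>x\<in>X. f b x \<le> f a x"
    by blast
  have "\<forall>j. \<exists>B. B \<subseteq> {a\<in>A. f a z = j} \<and> finite B \<and>
      (\<forall>a\<in>{a\<in>A. f a z = j}. \<exists>b\<in>B. \<forall>x\<in>X. f b x \<le> f a x)"
    using insert.IH by blast
  from choice[OF this] obtain Bj where *: "\<forall>j. Bj j \<subseteq> {a\<in>A. f a z = j} \<and> finite (Bj j) \<and>
      (\<forall>a\<in>{a\<in>A. f a z = j}. \<exists>b\<in>Bj j. \<forall>x\<in>X. f b x \<le> f a x)" ..
  have Bj: "Bj j \<subseteq> {a\<in>A. f a z = j}" "finite (Bj j)"
    "a \<in> A \<Longrightarrow> f a z = j \<Longrightarrow> \<exists>b\<in>Bj j. \<forall>x\<in>X. f b x \<le> f a x" for j a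
    using spec[OF *, of j] by simp_all
  define N where "N = Max (insert 0 ((\<lambda>b. f b z) ` B0))"
  have N: "f b z \<le> N" if "b \<in> B0" for b
    using that B0(2) by (auto simp: N_def)
  show ?case
  proof (intro exI[of _ "B0 \<union> (\<Union>j\<le>N. Bj j)"] conjI ballI)
    fix a assume a: "a \<in> A"
    show "\<exists>b\<in>B0 \<union> (\<Union>j\<le>N. Bj j). \<forall>x\<in>insert z X. f b x \<le> f a x"
    proof (cases "f a z \<le> N")
      case True
      obtain b where b: "b \<in> Bj (f a z)" "\<forall>x\<in>X. f b x \<le> f a x" using Bj(3)[OF a refl] by blast
      moreover from b have "f b z = f a z" using Bj(1) by blast
      ultimately show ?thesis using True by (intro bexI[of _ b]) auto
    next
      case False
      obtain b where b: "b \<in> B0" "\<forall>x\<in>X. f b x \<le> f a x" using B0(3)[OF a] by blast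
      then show ?thesis using False N[of b] by (intro bexI[of _ b]) auto
    qed
  next
    show "B0 \<union> (\<Union>j\<le>N. Bj j) \<subseteq> A" using B0(1) Bj(1) by blast
    show "finite (B0 \<union> (\<Union>j\<le>N. Bj j))" using B0(2) Bj(2) by simp
  qed
qed

text \<open>Sending a monomial to a product of prime powers turns the order of the natural numbers into
  a monomial order.\<close>

lemma ex_monomial_code:
  obtains code :: "('x :: finite \<Rightarrow>\<^sub>0 nat) \<Rightarrow> nat"
  where "inj code" "\<And>m m'. code (m + m') = code m * code m'"
proof -
  have "infinite {p :: nat. prime p}" by (rule primes_infinite)
  then obtain P where P: "finite P" "card P = card (UNIV :: 'x set)" "P \<subseteq> {p :: nat. prime p}"
    by (metis infinite_arbitrarily_large)
  obtain h :: "'x \<Rightarrow> nat" where h: "bij_betw h UNIV P"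
    using finite_same_card_bij[of "UNIV :: 'x set" P] P by auto
  then have h_prime: "prime (h x)" for x using P(3) by (auto simp: bij_betw_def)
  define code :: "('x \<Rightarrow>\<^sub>0 nat) \<Rightarrow> nat" where "code m = (\<Prod>x\<in>UNIV. h x ^ lookup m x)" for m
  \<comment> \<open>Unique factorization: the exponent at \<open>x\<close> is read off as the
    multiplicity of the prime \<open>h x\<close>, which gives injectivity.\<close>
  have mult: "multiplicity (h x) (code m) = lookup m x" for m x
  proof -
    have inv: "inv_into UNIV h (h y) = y" for y using h by (simp add: bij_betw_def)
    have "code m = (\<Prod>y\<in>UNIV. h y ^ lookup m (inv_into UNIV h (h y)))"
      by (simp add: code_def inv)
    also have "\<dots> = (\<Prod>q\<in>P. q ^ lookup m (inv_into UNIV h q))"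
      by (rule prod.reindex_bij_betw[OF h])
    also have "multiplicity (h x) \<dots> = lookup m (inv_into UNIV h (h x))"
      using P h h_prime by (subst multiplicity_prod_prime_powers) (auto simp: bij_betw_def)
    finally show ?thesis using h by (simp add: bij_betw_def)
  qed
  have "inj code"
  proof (rule injI, rule poly_mapping_eqI)
    fix m m' x assume "code m = code m'"
    then show "lookup m x = lookup m' x" using mult by metis
  qed
  moreover have "code (m + m') = code m * code m'" for m m'
    by (simp add: code_def lookup_add power_add prod.distrib)
  ultimately show ?thesis using that by blast
qed

text \<open>Groebner basis argument: Dickson's lemma picks finitely many leading monomials that
  divide all others, and division by the corresponding elements of \<open>J\<close> terminates since
  codes are natural numbers.\<close>

theorem hilbert_basis:
  fixes J :: "('x :: finite, 'k :: field) mpoly set"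
  assumes J: "ideal J"
  shows "\<exists>G. finite G \<and> G \<subseteq> J \<and> J \<subseteq> ideal_of G"
proof -
  obtain code :: "('x \<Rightarrow>\<^sub>0 nat) \<Rightarrow> nat"
    where code: "inj code" "\<And>m m'. code (m + m') = code m * code m'"
    using ex_monomial_code by blast
  define lead :: "('x, 'k) mpoly \<Rightarrow> ('x \<Rightarrow>\<^sub>0 nat) \<Rightarrow> bool" where
    "lead f m \<longleftrightarrow> lookup f m \<noteq> 0 \<and> (\<forall>m'\<in>keys f. code m' \<le> code m)" for f m
  define L where "L = {m. \<exists>f\<in>J. lead f m}"
  obtain B where B: "B \<subseteq> L" "finite B" "\<And>m. m \<in> L \<Longrightarrow> \<exists>b\<in>B. \<forall>x. lookup b x \<le> lookup m x"
    using dickson[of "UNIV :: 'x set" L lookup] by auto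
  from B(1) have "\<forall>b\<in>B. \<exists>f. f \<in> J \<and> lead f b" by (auto simp: L_def)
  from bchoice[OF this] obtain F where "\<forall>b\<in>B. F b \<in> J \<and> lead (F b) b" ..
  then have F: "\<And>b. b \<in> B \<Longrightarrow> F b \<in> J" "\<And>b. b \<in> B \<Longrightarrow> lead (F b) b" by simp_all
  \<comment> \<open>Induction on a strict bound for the codes; at bound 0 no monomial is left.
    Subtracting \<open>q * F b\<close> cancels the monomial of code \<open>N\<close> and creates
    none above it, because \<open>code\<close> is multiplicative.\<close>
  have span: "f \<in> ideal_of (F ` B)" if "f \<in> J" "\<forall>m\<in>keys f. code m < N" for f N
    using that
  proof (induction N arbitrary: f)
    case 0
    then have "keys f = {}" by auto
    then have "f = 0" by (simp only: keys_eq_empty)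
    then show ?case by (simp add: self_module.span_zero)
  next
    case (Suc N)
    show ?case
    proof (cases "\<exists>m\<in>keys f. code m = N")
      case False
      then have "\<forall>m\<in>keys f. code m < N" using Suc.prems(2) by (meson less_SucE)
      then show ?thesis using Suc.IH Suc.prems(1) by simp
    next
      case True
      then obtain m where m: "m \<in> keys f" "code m = N" by blast
      then have "lead f m" using Suc.prems(2) by (auto simp: lead_def in_keys_iff less_Suc_eq_le)
      then obtain b where b: "b \<in> B" "\<forall>x. lookup b x \<le> lookup m x"
        using B(3)[of m] Suc.prems(1) by (auto simp: L_def)
      define e where "e = m - b"
      have e: "m = e + b"
        using b(2) by (intro poly_mapping_eqI) (simp add: e_def lookup_add lookup_minus)
      have Fb: "lookup (F b) b \<noteq> 0" using F(2)[OF b(1)] by (simp add: lead_def)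
      define q where "q = single e (lookup f m / lookup (F b) b)"
      have "f - q * F b \<in> ideal_of (F ` B)"
      proof (rule Suc.IH)
        show "f - q * F b \<in> J"
          using Suc.prems(1) F(1)[OF b(1)] J by (intro ideal_diff ideal_mult)
        show "\<forall>m'\<in>keys (f - q * F b). code m' < N"
        proof
          fix m' assume m': "m' \<in> keys (f - q * F b)"
          have "lookup (f - q * F b) m = 0"
            using Fb by (simp add: lookup_minus q_def e lookup_single_mult)
          then have "m' \<noteq> m" using m' by (auto simp: in_keys_iff)
          then have neq: "code m' \<noteq> N" using m(2) code(1) by (auto simp: inj_def)
          have "m' \<in> keys f \<or> m' \<in> keys (q * F b)"
            using m' keys_diff[of f "q * F b"] by blast
          then have "code m' \<le> N"
          proof
            assume "m' \<in> keys f"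
            then show ?thesis using Suc.prems(2) by auto
          next
            assume "m' \<in> keys (q * F b)"
            then obtain a where a: "m' = e + a" "a \<in> keys (F b)"
              using keys_mult[of q "F b"] by (auto simp: q_def split: if_splits)
            then have "code a \<le> code b" using F(2)[OF b(1)] by (simp add: lead_def)
            then show ?thesis using m(2) mult_le_mono2 by (auto simp: a(1) e code(2))
          qed
          then show "code m' < N" using neq by simp
        qed
      qed
      moreover have "q * F b \<in> ideal_of (F ` B)"
        using b(1) by (intro self_module.span_scale self_module.span_base) auto
      ultimately have "(f - q * F b) + q * F b \<in> ideal_of (F ` B)" by (rule self_module.span_add)
      then show ?thesis by simp
    qed
  qed
  have "J \<subseteq> ideal_of (F ` B)"
  proof
    fix f assume "f \<in> J"
    then show "f \<in> ideal_of (F ` B)"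
      by (rule span[where N = "Suc (Max (code ` keys f))"]) (simp add: less_Suc_eq_le)
  qed
  then show ?thesis using B(2) F(1) by (intro exI[of _ "F ` B"]) auto
qed

section \<open>Finite generation of submodules of free modules\<close>

definition submodule :: "nat \<Rightarrow> (nat \<Rightarrow> 'a :: comm_ring_1) set \<Rightarrow> bool" where
  "submodule p M \<longleftrightarrow> (\<lambda>_. 0) \<in> M \<and> (\<forall>u\<in>M. \<forall>v\<in>M. (\<lambda>k. u k + v k) \<in> M) \<and>
     (\<forall>c. \<forall>v\<in>M. (\<lambda>k. c * v k) \<in> M) \<and> (\<forall>v\<in>M. \<forall>k\<ge>p. v k = 0)"

lemma submodule_0: "submodule p M \<Longrightarrow> (\<lambda>_. 0) \<in> M"
  by (simp add: submodule_def)

lemma submodule_add: "submodule p M \<Longrightarrow> u \<in> M \<Longrightarrow> v \<in> M \<Longrightarrow> (\<lambda>k. u k + v k) \<in> M"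
  by (simp add: submodule_def)

lemma submodule_scale: "submodule p M \<Longrightarrow> v \<in> M \<Longrightarrow> (\<lambda>k. c * v k) \<in> M"
  by (simp add: submodule_def)

lemma submodule_bound: "submodule p M \<Longrightarrow> v \<in> M \<Longrightarrow> k \<ge> p \<Longrightarrow> v k = 0"
  by (simp add: submodule_def)

lemma submodule_diff:
  assumes "submodule p M" "u \<in> M" "v \<in> M"
  shows "(\<lambda>k. u k - v k) \<in> M"
  using submodule_add[OF assms(1,2) submodule_scale[OF assms(1,3), of "- 1"]] by simp

lemma submodule_sum:
  assumes "submodule p M" "\<And>a. a \<in> A \<Longrightarrow> v a \<in> M"
  shows "(\<lambda>k. \<Sum>a\<in>A. v a k) \<in> M"
  using assms(2)
  by (induction A rule: infinite_finite_induct) (simp_all add: submodule_0[OF assms(1)] submodule_add[OF assms(1)])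

text \<open>Induction on the rank: the last coordinates form an ideal, finitely generated by
  Hilbert's theorem, and the vectors with last coordinate 0 form a submodule of smaller rank.
  Vectors are functions vanishing from \<open>p\<close> on, so the rank can drop without a change of
  type.\<close>

lemma submodule_finitely_generated:
  fixes M :: "(nat \<Rightarrow> ('x :: finite, 'k :: field) mpoly) set"
  assumes "submodule p M"
  shows "\<exists>G. finite G \<and> G \<subseteq> M \<and> (\<forall>N. submodule p N \<longrightarrow> G \<subseteq> N \<longrightarrow> M \<subseteq> N)"
  using assms
proof (induction p arbitrary: M)
  case 0
  then have "M \<subseteq> {\<lambda>_. 0}" by (auto simp: submodule_def)
  then show ?case by (intro exI[of _ "{}"]) (auto simp: submodule_def)
next
  case (Suc p)
  let ?last0 = "\<lambda>N. {v \<in> N. v p = 0}"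
  have last0: "submodule p (?last0 N)" if "submodule (Suc p) N" for N :: "(nat \<Rightarrow> ('x, 'k) mpoly) set"
  proof -
    have "v k = 0" if "v \<in> N" "v p = 0" "k \<ge> p" for v k
      using that submodule_bound[OF \<open>submodule (Suc p) N\<close>, of v k] by (cases "k = p") auto
    then show ?thesis using that by (simp add: submodule_def)
  qed
  define J where "J N = (\<lambda>v. v p) ` N" for N :: "(nat \<Rightarrow> ('x, 'k) mpoly) set"
  have J: "ideal (J N)" if N: "submodule (Suc p) N" for N
  proof (rule self_module.subspaceI)
    show "0 \<in> J N" unfolding J_def by (rule image_eqI[OF _ submodule_0[OF N]]) simp
  next
    fix x y assume "x \<in> J N" "y \<in> J N"
    then obtain u v where "u \<in> N" "v \<in> N" "x = u p" "y = v p" by (auto simp: J_def)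
    then show "x + y \<in> J N" unfolding J_def
      by (intro image_eqI[OF _ submodule_add[OF N, of u v]]) simp_all
  next
    fix c x assume "x \<in> J N"
    then obtain u where "u \<in> N" "x = u p" by (auto simp: J_def)
    then show "c * x \<in> J N" unfolding J_def
      by (intro image_eqI[OF _ submodule_scale[OF N, of u c]]) simp_all
  qed
  from Suc.IH[OF last0[OF Suc.prems]] obtain G' where G': "finite G'" "G' \<subseteq> ?last0 M"
    "\<And>N. submodule p N \<Longrightarrow> G' \<subseteq> N \<Longrightarrow> ?last0 M \<subseteq> N" by blast
  from hilbert_basis[OF J[OF Suc.prems]] obtain H where H: "finite H" "H \<subseteq> J M" "J M \<subseteq> ideal_of H"
    by blast
  from H(1,2) obtain V where V: "finite V" "V \<subseteq> M" "H = (\<lambda>v. v p) ` V"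
    unfolding J_def by (meson finite_subset_image)
  show ?case
  proof (intro exI[of _ "G' \<union> V"] conjI allI impI subsetI)
    fix N v assume N: "submodule (Suc p) N" "G' \<union> V \<subseteq> N" and v: "v \<in> M"
    \<comment> \<open>The last coordinate of \<open>v\<close> must be matched by some
      \<open>u\<close> in both modules: in \<open>N\<close> to conclude, and in \<open>M\<close> so
      that \<open>v - u\<close> falls under the induction hypothesis.\<close>
    have MN: "submodule (Suc p) (M \<inter> N)" using Suc.prems N(1) by (auto simp: submodule_def)
    have "H \<subseteq> J (M \<inter> N)" using V N by (auto simp: J_def)
    then have "ideal_of H \<subseteq> J (M \<inter> N)" using J[OF MN] by (rule self_module.span_minimal)
    then have "v p \<in> J (M \<inter> N)" using H(3) v by (auto simp: J_def)
    then obtain u where u: "u \<in> M" "u \<in> N" "u p = v p" by (auto simp: J_def)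
    have "(\<lambda>k. v k - u k) \<in> ?last0 M" using submodule_diff[OF Suc.prems v u(1)] u by simp
    moreover have "?last0 M \<subseteq> ?last0 N" using G'(2) N by (intro G'(3) last0) auto
    ultimately have "(\<lambda>k. v k - u k) \<in> N" by blast
    from submodule_add[OF N(1) this u(2)] show "v \<in> N" by simp
  qed (use G' V in auto)
qed

section \<open>Minimal graded free resolutions\<close>

text \<open>The ambient module is the direct sum of the R(-s k): in a homogeneous vector of degree
  \<delta> the coordinate k has degree \<delta> - s k.\<close>

definition graded_submodule ::
  "nat \<Rightarrow> (nat \<Rightarrow> int) \<Rightarrow> (nat \<Rightarrow> ('x :: finite, 'k :: field) mpoly) set \<Rightarrow> bool" where
  "graded_submodule p s M \<longleftrightarrow> submodule p M \<and> (\<forall>v\<in>M. \<forall>\<delta>. (\<lambda>k. hom_comp (\<delta> - s k) (v k)) \<in> M)"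

text \<open>Elements of \<open>G\<close> are pairs of a degree and a homogeneous vector of that degree.\<close>

definition hom_generators ::
  "(nat \<Rightarrow> int) \<Rightarrow> (nat \<Rightarrow> ('x :: finite, 'k :: field) mpoly) set \<Rightarrow>
   (int \<times> (nat \<Rightarrow> ('x, 'k) mpoly)) set \<Rightarrow> bool" where
  "hom_generators s M G \<longleftrightarrow> finite G \<and> (\<forall>g\<in>G. snd g \<in> M \<and> (\<forall>k. snd g k \<in> graded_part (fst g - s k))) \<and>
     (\<forall>v\<in>M. \<exists>w. \<forall>k. v k = (\<Sum>g\<in>G. w g * snd g k))"

lemma ex_hom_generators:
  fixes M :: "(nat \<Rightarrow> ('x :: finite, 'k :: field) mpoly) set"
  assumes "graded_submodule p s M"
  shows "\<exists>G. hom_generators s M G"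
proof -
  have M: "submodule p M" using assms by (simp add: graded_submodule_def)
  from submodule_finitely_generated[OF M] obtain V where V: "finite V" "V \<subseteq> M"
    "\<And>N. submodule p N \<Longrightarrow> V \<subseteq> N \<Longrightarrow> M \<subseteq> N" by blast
  \<comment> \<open>All total degrees occurring in \<open>V\<close>, a monomial in coordinate
    \<open>k\<close> being shifted by \<open>s k\<close>; every generator is the sum of its
    components over this finite set.\<close>
  define \<Delta> where "\<Delta> = (\<Union>v\<in>V. \<Union>k<p. (\<lambda>m. int (monom_deg m) + s k) ` keys (v k))"
  have fin: "finite \<Delta>" using V(1) by (auto simp: \<Delta>_def)
  define c :: "int \<Rightarrow> (nat \<Rightarrow> ('x, 'k) mpoly) \<Rightarrow> nat \<Rightarrow> ('x, 'k) mpoly"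
    where "c \<delta> v = (\<lambda>k. hom_comp (\<delta> - s k) (v k))" for \<delta> v
  define G where "G = (\<lambda>(\<delta>, v). (\<delta>, c \<delta> v)) ` (\<Delta> \<times> V)"
  have finG: "finite G" using fin V(1) by (simp add: G_def)
  have GM: "snd g \<in> M" if "g \<in> G" for g
    using that V(2) assms by (auto simp: G_def c_def graded_submodule_def)
  have sum_c: "(\<Sum>\<delta>\<in>\<Delta>. c \<delta> v k) = v k" if "v \<in> V" for v k
  proof (cases "k < p")
    case True
    show ?thesis
    proof (rule poly_mapping_eqI)
      fix m
      have "lookup (\<Sum>\<delta>\<in>\<Delta>. c \<delta> v k) m
          = (\<Sum>\<delta>\<in>\<Delta>. if \<delta> = int (monom_deg m) + s k then lookup (v k) m else 0)"
        by (auto simp: lookup_sum c_def lookup_hom_comp intro!: sum.cong)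
      also have "\<dots> = lookup (v k) m"
      proof (cases "m \<in> keys (v k)")
        case True
        then have "int (monom_deg m) + s k \<in> \<Delta>" using that \<open>k < p\<close> unfolding \<Delta>_def by blast
        then show ?thesis using fin by simp
      qed (simp add: in_keys_iff)
      finally show "lookup (\<Sum>\<delta>\<in>\<Delta>. c \<delta> v k) m = lookup (v k) m" .
    qed
  next
    case False
    then have "v k = 0" using that V(2) M by (auto simp: submodule_def)
    then show ?thesis by (simp add: c_def)
  qed
  \<comment> \<open>The span of \<open>G\<close>. As a submodule containing \<open>V\<close> it
    contains \<open>M\<close>, by the way generation is stated.\<close>
  define N where "N = {v. \<exists>w. \<forall>k. v k = (\<Sum>g\<in>G. w g * snd g k)}"
  have N: "submodule p N"
    unfolding submodule_def
  proof (intro conjI ballI allI impI)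
    show "(\<lambda>_. 0) \<in> N" unfolding N_def by (intro CollectI exI[of _ "\<lambda>_. 0"]) simp
  next
    fix u v assume "u \<in> N" "v \<in> N"
    then obtain a b where "\<forall>k. u k = (\<Sum>g\<in>G. a g * snd g k)" "\<forall>k. v k = (\<Sum>g\<in>G. b g * snd g k)"
      by (auto simp: N_def)
    then show "(\<lambda>k. u k + v k) \<in> N" unfolding N_def
      by (intro CollectI exI[of _ "\<lambda>g. a g + b g"]) (simp add: sum.distrib distrib_right)
  next
    fix e v assume "v \<in> N"
    then obtain a where "\<forall>k. v k = (\<Sum>g\<in>G. a g * snd g k)" by (auto simp: N_def)
    then show "(\<lambda>k. e * v k) \<in> N" unfolding N_def
      by (intro CollectI exI[of _ "\<lambda>g. e * a g"]) (simp add: sum_distrib_left mult.assoc)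
  next
    fix v k assume v: "v \<in> N" and k: "k \<ge> p"
    have "snd g k = 0" if "g \<in> G" for g using GM[OF that] M k by (simp add: submodule_def)
    moreover obtain w where "v k = (\<Sum>g\<in>G. w g * snd g k)" using v by (auto simp: N_def)
    ultimately show "v k = 0" by simp
  qed
  have GN: "snd g \<in> N" if "g \<in> G" for g
    unfolding N_def
  proof (intro CollectI exI[of _ "\<lambda>h. if h = g then 1 else 0"] allI)
    fix k
    have "(\<Sum>h\<in>G. (if h = g then 1 else 0) * snd h k) = (\<Sum>h\<in>G. if h = g then snd h k else 0)"
      by (intro sum.cong) auto
    then show "snd g k = (\<Sum>h\<in>G. (if h = g then 1 else 0) * snd h k)"
      using finG that by simp
  qed
  have "v \<in> N" if "v \<in> V" for v
  proof -
    have "(\<lambda>k. \<Sum>\<delta>\<in>\<Delta>. c \<delta> v k) \<in> N"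
    proof (rule submodule_sum[OF N])
      fix \<delta> assume "\<delta> \<in> \<Delta>"
      then have "(\<delta>, c \<delta> v) \<in> G" using that by (auto simp: G_def)
      then show "c \<delta> v \<in> N" using GN by fastforce
    qed
    then show ?thesis using sum_c[OF that] by simp
  qed
  then have "M \<subseteq> N" using V(3)[OF N] by blast
  moreover have "snd g k \<in> graded_part (fst g - s k)" if "g \<in> G" for g k
    using that by (auto simp: G_def c_def hom_comp_graded)
  ultimately have "hom_generators s M G"
    using finG GM unfolding hom_generators_def N_def by blast
  then show ?thesis by blast
qed

text \<open>Graded Nakayama: a syzygy with a nonzero constant term at \<open>g\<close> yields a
  homogeneous one with a unit there, so \<open>g\<close> could be dropped from the
  generators.\<close>

lemma minimal_hom_generators_syzygy:
  fixes M :: "(nat \<Rightarrow> ('x :: finite, 'k :: field) mpoly) set"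
  assumes G: "hom_generators s M G"
    and min: "\<And>G'. hom_generators s M G' \<Longrightarrow> card G \<le> card G'"
    and w: "\<And>k. (\<Sum>g\<in>G. w g * snd g k) = 0" and g: "g \<in> G"
  shows "w g \<in> irrelevant_ideal"
proof (rule ccontr)
  assume "w g \<notin> irrelevant_ideal"
  define c where "c = lookup (w g) 0"
  have c: "c \<noteq> 0" using \<open>w g \<notin> irrelevant_ideal\<close> by (simp add: irrelevant_ideal_iff c_def)
  \<comment> \<open>The part of the syzygy in the degree of \<open>g\<close>; its coefficient at
    \<open>g\<close> has degree 0 and is therefore the constant \<open>c\<close>.\<close>
  define r where "r h = hom_comp (fst g - fst h) (w h)" for h
  have fin: "finite G" and hom: "\<And>h k. h \<in> G \<Longrightarrow> snd h k \<in> graded_part (fst h - s k)"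
    using G by (auto simp: hom_generators_def)
  have r0: "(\<Sum>h\<in>G. r h * snd h k) = 0" for k
  proof -
    have "hom_comp (fst g - s k) (w h * snd h k) = r h * snd h k" if "h \<in> G" for h
      using hom_comp_mult_graded[OF hom[OF that, of k], of "fst g - s k" "w h"] by (simp add: r_def)
    then have "(\<Sum>h\<in>G. r h * snd h k) = hom_comp (fst g - s k) (\<Sum>h\<in>G. w h * snd h k)"
      by (simp add: hom_comp_sum)
    then show ?thesis by (simp add: w)
  qed
  have "r g = single 0 c"
    by (rule poly_mapping_eqI)
      (auto simp: r_def lookup_hom_comp lookup_single when_def c_def monom_deg_eq_0_iff)
  then have unit: "single 0 (1 / c) * r g = 1" using c by (simp add: mult_single)
  have sg: "snd g k = - (\<Sum>h\<in>G - {g}. single 0 (1 / c) * r h * snd h k)" for k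
  proof -
    have "0 = single 0 (1 / c) * (\<Sum>h\<in>G. r h * snd h k)" by (simp add: r0)
    also have "\<dots> = single 0 (1 / c) * r g * snd g k + (\<Sum>h\<in>G - {g}. single 0 (1 / c) * r h * snd h k)"
      using fin g by (simp add: sum.remove[of G g] distrib_left sum_distrib_left mult.assoc)
    finally show ?thesis by (simp add: unit eq_neg_iff_add_eq_0)
  qed
  have "hom_generators s M (G - {g})"
    unfolding hom_generators_def
  proof (intro conjI ballI)
    fix v assume "v \<in> M"
    then obtain a where a: "\<And>k. v k = (\<Sum>h\<in>G. a h * snd h k)"
      using G by (auto simp: hom_generators_def)
    show "\<exists>a. \<forall>k. v k = (\<Sum>h\<in>G - {g}. a h * snd h k)"
    proof (intro exI allI)
      fix k
      have "v k = a g * snd g k + (\<Sum>h\<in>G - {g}. a h * snd h k)"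
        using fin g by (simp add: a sum.remove[of G g])
      also have "\<dots> = (\<Sum>h\<in>G - {g}. (a h - a g * single 0 (1 / c) * r h) * snd h k)"
        by (simp add: sg left_diff_distrib sum_subtractf sum_distrib_left mult.assoc)
      finally show "v k = (\<Sum>h\<in>G - {g}. (a h - a g * single 0 (1 / c) * r h) * snd h k)" .
    qed
  qed (use G in \<open>auto simp: hom_generators_def\<close>)
  then have "card G \<le> card (G - {g})" by (rule min)
  then show False using fin g card_Diff1_less[of G g] by simp
qed

text \<open>The row index of the matrix \<open>d\<close> ranges over all natural numbers.\<close>

definition minimal_cover ::
  "(nat \<Rightarrow> int) \<Rightarrow> (nat \<Rightarrow> ('x :: finite, 'k :: field) mpoly) set \<Rightarrow> int list \<Rightarrow>
   (nat \<Rightarrow> nat \<Rightarrow> ('x, 'k) mpoly) \<Rightarrow> bool" where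
  "minimal_cover s M t d \<longleftrightarrow>
     (\<forall>k. \<forall>l<length t. d k l \<in> graded_part (t ! l - s k)) \<and>
     (\<forall>l<length t. (\<lambda>k. d k l) \<in> M) \<and>
     (\<forall>v. v \<in> M \<longleftrightarrow> (\<exists>w. \<forall>k. v k = (\<Sum>l<length t. d k l * w l))) \<and>
     (\<forall>w. (\<forall>k. (\<Sum>l<length t. d k l * w l) = 0) \<longrightarrow> (\<forall>l<length t. w l \<in> irrelevant_ideal))"

lemma minimal_coverD:
  assumes "minimal_cover s M t d"
  shows "l < length t \<Longrightarrow> d k l \<in> graded_part (t ! l - s k)"
    and "l < length t \<Longrightarrow> (\<lambda>k. d k l) \<in> M"
    and "v \<in> M \<longleftrightarrow> (\<exists>w. \<forall>k. v k = (\<Sum>l<length t. d k l * w l))"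
    and "(\<And>k. (\<Sum>l<length t. d k l * w l) = 0) \<Longrightarrow> l < length t \<Longrightarrow> w l \<in> irrelevant_ideal"
proof -
  note * = assms[unfolded minimal_cover_def]
  show "l < length t \<Longrightarrow> d k l \<in> graded_part (t ! l - s k)"
    using * [THEN conjunct1] by simp
  show "l < length t \<Longrightarrow> (\<lambda>k. d k l) \<in> M"
    by (rule *[THEN conjunct2, THEN conjunct1, rule_format])
  show "v \<in> M \<longleftrightarrow> (\<exists>w. \<forall>k. v k = (\<Sum>l<length t. d k l * w l))"
    by (rule *[THEN conjunct2, THEN conjunct2, THEN conjunct1, THEN spec])
  show "(\<And>k. (\<Sum>l<length t. d k l * w l) = 0) \<Longrightarrow> l < length t \<Longrightarrow> w l \<in> irrelevant_ideal"
    using *[THEN conjunct2, THEN conjunct2, THEN conjunct2, THEN spec[of _ w]] by simp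
qed

lemma ex_minimal_cover:
  fixes M :: "(nat \<Rightarrow> ('x :: finite, 'k :: field) mpoly) set"
  assumes M: "graded_submodule p s M"
  shows "\<exists>t d. minimal_cover s M t d"
proof -
  \<comment> \<open>Least cardinality among homogeneous generating sets is the source of
    minimality.\<close>
  from ex_hom_generators[OF M] obtain G where G: "hom_generators s M G"
    and min: "\<And>G'. hom_generators s M G' \<Longrightarrow> card G \<le> card G'"
    using ex_has_least_nat[of "hom_generators s M" _ card] by blast
  have fin: "finite G" using G by (simp add: hom_generators_def)
  define n where "n = card G"
  obtain h where h: "bij_betw h {..<n} G"
    using ex_bij_betw_nat_finite[OF fin] by (auto simp: n_def atLeast0LessThan)
  have hG: "h l \<in> G" if "l < n" for l using h that by (auto simp: bij_betw_def)
  define t where "t = map (\<lambda>l. fst (h l)) [0..<n]"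
  define d where "d k l = snd (h l) k" for k l
  have len: "length t = n" by (simp add: t_def)
  have sums: "(\<Sum>l<n. d k l * w (h l)) = (\<Sum>g\<in>G. w g * snd g k)" for w k
    by (subst sum.reindex_bij_betw[OF h, symmetric]) (simp add: d_def mult.commute)
  have inv: "inv_into {..<n} h (h l) = l" if "l < n" for l
    using h that by (auto simp: bij_betw_def)
  have sums': "(\<Sum>l<n. d k l * w l) = (\<Sum>g\<in>G. w (inv_into {..<n} h g) * snd g k)" for w k
    by (subst sums[symmetric]) (simp add: inv)
  have sub: "submodule p M" using M by (simp add: graded_submodule_def)
  have "minimal_cover s M t d"
    unfolding minimal_cover_def
  proof (intro conjI allI impI)
    fix k l assume "l < length t"
    then show "d k l \<in> graded_part (t ! l - s k)"
      using G hG[of l] by (auto simp: t_def d_def hom_generators_def)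
  next
    fix l assume "l < length t"
    then show "(\<lambda>k. d k l) \<in> M"
      using G hG[of l] by (auto simp: t_def d_def hom_generators_def)
  next
    fix v
    show "v \<in> M \<longleftrightarrow> (\<exists>w. \<forall>k. v k = (\<Sum>l<length t. d k l * w l))"
    proof
      assume "v \<in> M"
      then obtain a where "\<And>k. v k = (\<Sum>g\<in>G. a g * snd g k)" using G by (auto simp: hom_generators_def)
      then show "\<exists>w. \<forall>k. v k = (\<Sum>l<length t. d k l * w l)"
        by (intro exI[of _ "\<lambda>l. a (h l)"]) (simp add: len sums)
    next
      assume "\<exists>w. \<forall>k. v k = (\<Sum>l<length t. d k l * w l)"
      then obtain w where w: "v = (\<lambda>k. \<Sum>l<n. w l * d k l)" by (auto simp: len mult.commute)
      show "v \<in> M" unfolding w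
      proof (rule submodule_sum[OF sub])
        fix l assume "l \<in> {..<n}"
        then have "(\<lambda>k. d k l) \<in> M" using G hG[of l] by (simp add: d_def hom_generators_def)
        then show "(\<lambda>k. w l * d k l) \<in> M" by (rule submodule_scale[OF sub])
      qed
    qed
  next
    fix w l assume "\<forall>k. (\<Sum>l<length t. d k l * w l) = 0" and l: "l < length t"
    then have "\<And>k. (\<Sum>g\<in>G. w (inv_into {..<n} h g) * snd g k) = 0"
      by (simp only: len sums')
    from minimal_hom_generators_syzygy[OF G min this hG, of l] show "w l \<in> irrelevant_ideal"
      using l by (simp add: len inv)
  qed
  then show ?thesis by blast
qed

lemma graded_submodule_kernel:
  fixes d :: "nat \<Rightarrow> nat \<Rightarrow> ('x :: finite, 'k :: field) mpoly"
  assumes d: "\<And>k l. l < n \<Longrightarrow> k < p \<Longrightarrow> d k l \<in> graded_part (t l - s k)"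
  shows "graded_submodule n t {v. (\<forall>l\<ge>n. v l = 0) \<and> (\<forall>k<p. (\<Sum>l<n. d k l * v l) = 0)}"
  unfolding graded_submodule_def
proof (intro conjI ballI allI)
  have "(\<Sum>l<n. d k l * (c * v l)) = c * (\<Sum>l<n. d k l * v l)" for k c v
    by (simp add: sum_distrib_left mult.left_commute)
  then show "submodule n {v. (\<forall>l\<ge>n. v l = 0) \<and> (\<forall>k<p. (\<Sum>l<n. d k l * v l) = 0)}"
    by (auto simp: submodule_def distrib_left sum.distrib)
next
  fix v \<delta> assume "v \<in> {v. (\<forall>l\<ge>n. v l = 0) \<and> (\<forall>k<p. (\<Sum>l<n. d k l * v l) = 0)}"
  then have v: "\<And>l. l \<ge> n \<Longrightarrow> v l = 0" "\<And>k. k < p \<Longrightarrow> (\<Sum>l<n. d k l * v l) = 0" by auto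
  have "(\<Sum>l<n. d k l * hom_comp (\<delta> - t l) (v l)) = 0" if k: "k < p" for k
  proof -
    have "d k l * hom_comp (\<delta> - t l) (v l) = hom_comp (\<delta> - s k) (d k l * v l)" if "l < n" for l
      using hom_comp_mult_graded[OF d[OF that k], of "\<delta> - s k" "v l"] by (simp add: mult.commute)
    then have "(\<Sum>l<n. d k l * hom_comp (\<delta> - t l) (v l)) = hom_comp (\<delta> - s k) (\<Sum>l<n. d k l * v l)"
      by (simp add: hom_comp_sum)
    then show ?thesis using v(2)[OF k] by simp
  qed
  then show "(\<lambda>l. hom_comp (\<delta> - t l) (v l)) \<in> {v. (\<forall>l\<ge>n. v l = 0) \<and> (\<forall>k<p. (\<Sum>l<n. d k l * v l) = 0)}"
    using v(1) by simp
qed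

section \<open>Building the resolution one differential at a time\<close>

lemma mult_mat_vec_index:
  assumes "A \<in> carrier_mat n m" "v \<in> carrier_vec m" "k < n"
  shows "(A *\<^sub>v v) $ k = (\<Sum>l<m. A $$ (k, l) * v $ l)"
  using assms by (auto simp: scalar_prod_def atLeast0LessThan intro!: sum.cong)

lemma mat_vec_image_iff:
  assumes "A \<in> carrier_mat n m" "v \<in> carrier_vec n"
  shows "v \<in> (\<lambda>w. A *\<^sub>v w) ` carrier_vec m \<longleftrightarrow> (\<exists>w. \<forall>k<n. v $ k = (\<Sum>l<m. A $$ (k, l) * w l))"
proof
  assume "v \<in> (\<lambda>w. A *\<^sub>v w) ` carrier_vec m"
  then obtain w where "w \<in> carrier_vec m" "v = A *\<^sub>v w" by blast
  then show "\<exists>w. \<forall>k<n. v $ k = (\<Sum>l<m. A $$ (k, l) * w l)"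
    using mult_mat_vec_index[OF assms(1)] by (intro exI[of _ "\<lambda>l. w $ l"]) simp
next
  assume "\<exists>w. \<forall>k<n. v $ k = (\<Sum>l<m. A $$ (k, l) * w l)"
  then obtain w where w: "\<And>k. k < n \<Longrightarrow> v $ k = (\<Sum>l<m. A $$ (k, l) * w l)" by blast
  have "v = A *\<^sub>v vec m w"
  proof (rule eq_vecI)
    fix k assume "k < dim_vec (A *\<^sub>v vec m w)"
    then have "k < n" using assms(1) by simp
    then show "v $ k = (A *\<^sub>v vec m w) $ k"
      using mult_mat_vec_index[OF assms(1), of "vec m w" k] w[of k] by simp
  qed (use assms in simp)
  then show "v \<in> (\<lambda>w. A *\<^sub>v w) ` carrier_vec m" by simp
qed

text \<open>One differential, from basis degrees \<open>t\<close> to basis degrees \<open>s\<close>.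
  The condition on syzygies is what passes minimality on: the columns of the next differential are
  syzygies of this one.\<close>

definition minimal_stage ::
  "int list \<times> int list \<times> (nat \<Rightarrow> nat \<Rightarrow> ('x :: finite, 'k :: field) mpoly) \<Rightarrow> bool" where
  "minimal_stage = (\<lambda>(s, t, d).
     (\<forall>k<length s. \<forall>l<length t. d k l \<in> graded_part (t ! l - s ! k) \<and> d k l \<in> irrelevant_ideal) \<and>
     (\<forall>w. (\<forall>k<length s. (\<Sum>l<length t. d k l * w l) = 0) \<longrightarrow> (\<forall>l<length t. w l \<in> irrelevant_ideal)))"

definition exact_stages where
  "exact_stages = (\<lambda>(s, t, d) (s', t', d'). s' = t \<and>
     (\<forall>v. (\<forall>k<length s. (\<Sum>l<length t. d k l * v l) = 0) \<longleftrightarrow>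
       (\<exists>w. \<forall>l<length t. v l = (\<Sum>m<length t'. d' l m * w m))))"

lemma ex_next_stage:
  fixes d :: "nat \<Rightarrow> nat \<Rightarrow> ('x :: finite, 'k :: field) mpoly"
  assumes "minimal_stage (s, t, d)"
  shows "\<exists>y. minimal_stage y \<and> exact_stages (s, t, d) y"
proof -
  define n where "n = length t"
  define K where "K = {v. (\<forall>l\<ge>n. v l = 0) \<and> (\<forall>k<length s. (\<Sum>l<n. d k l * v l) = 0)}"
  have "graded_submodule n (\<lambda>l. t ! l) K"
    unfolding K_def using assms
    by (intro graded_submodule_kernel[where s = "\<lambda>k. s ! k"]) (simp add: minimal_stage_def n_def)
  then obtain t' d' where cover: "minimal_cover (\<lambda>k. t ! k) K t' d'"
    using ex_minimal_cover by blast
  note gr = minimal_coverD(1)[OF cover] and K = minimal_coverD(2)[OF cover]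
    and im = minimal_coverD(3)[OF cover] and min = minimal_coverD(4)[OF cover]
  have zero: "d' k l = 0" if "l < length t'" "k \<ge> n" for k l
    using K[OF that(1)] that(2) by (simp add: K_def)
  have irr: "d' k l \<in> irrelevant_ideal" if "l < length t'" "k < n" for k l
  proof -
    have "\<forall>k<length s. (\<Sum>i<length t. d k i * d' i l) = 0" using K[OF that(1)] by (simp add: K_def n_def)
    then have "\<forall>i<length t. d' i l \<in> irrelevant_ideal"
      using assms unfolding minimal_stage_def prod.case by (elim conjE allE[of _ "\<lambda>i. d' i l"]) simp
    then show ?thesis using that(2) by (simp add: n_def)
  qed
  have "minimal_stage (t, t', d')"
    unfolding minimal_stage_def prod.case
  proof (intro conjI allI impI)
    fix w l assume w: "\<forall>k<length t. (\<Sum>l<length t'. d' k l * w l) = 0" and l: "l < length t'"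
    have "(\<Sum>l<length t'. d' k l * w l) = 0" for k
      by (cases "k < n") (use w zero in \<open>simp_all add: n_def\<close>)
    then show "w l \<in> irrelevant_ideal" using l by (rule min)
  qed (use gr irr in \<open>simp_all add: n_def\<close>)
  moreover have "exact_stages (s, t, d) (t, t', d')"
    unfolding exact_stages_def prod.case
  proof (intro conjI allI refl)
    fix v :: "nat \<Rightarrow> ('x, 'k) mpoly"
    \<comment> \<open>\<open>K\<close> only holds vectors vanishing from \<open>n\<close> on, while
      \<open>v\<close> is arbitrary there.\<close>
    define u where "u l = (if l < n then v l else 0)" for l
    have "(\<forall>k<length s. (\<Sum>l<length t. d k l * v l) = 0) \<longleftrightarrow> u \<in> K"
      by (simp add: K_def u_def n_def)
    also have "\<dots> \<longleftrightarrow> (\<exists>w. \<forall>k. u k = (\<Sum>l<length t'. d' k l * w l))" by (rule im)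
    also have "\<dots> \<longleftrightarrow> (\<exists>w. \<forall>l<length t. v l = (\<Sum>m<length t'. d' l m * w m))"
    proof (intro ex_cong1 iffI allI impI)
      fix w k assume "\<forall>l<length t. v l = (\<Sum>m<length t'. d' l m * w m)"
      then show "u k = (\<Sum>l<length t'. d' k l * w l)"
        by (cases "k < n") (use zero in \<open>simp_all add: u_def n_def\<close>)
    next
      fix w l assume "\<forall>k. u k = (\<Sum>l<length t'. d' k l * w l)" "l < length t"
      then show "v l = (\<Sum>m<length t'. d' l m * w m)" by (metis u_def n_def)
    qed
    finally show "(\<forall>k<length s. (\<Sum>l<length t. d k l * v l) = 0) \<longleftrightarrow>
       (\<exists>w. \<forall>l<length t. v l = (\<Sum>m<length t'. d' l m * w m))" .
  qed
  ultimately show ?thesis by blast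
qed

text \<open>\<open>I\<close> is covered as a submodule of R^1, so that the zeroth free module is R
  on one generator of degree 0. Its containment in the irrelevant ideal makes this first
  differential minimal.\<close>

lemma ex_first_stage:
  fixes I :: "('x :: finite, 'k :: field) mpoly set"
  assumes I: "graded_ideal I" "I \<subseteq> irrelevant_ideal"
  shows "\<exists>t d. minimal_stage ([0], t, d) \<and> (\<forall>f. f \<in> I \<longleftrightarrow> (\<exists>w. f = (\<Sum>l<length t. d 0 l * w l)))"
proof -
  define M where "M = {v :: nat \<Rightarrow> ('x, 'k) mpoly. v 0 \<in> I \<and> (\<forall>k\<ge>1. v k = 0)}"
  have "graded_submodule 1 (\<lambda>_. 0) M"
    using I(1) by (simp add: graded_submodule_def submodule_def M_def graded_ideal_def
        ideal_zero ideal_add ideal_mult)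
  then obtain t d where cover: "minimal_cover (\<lambda>_. 0) M t d"
    using ex_minimal_cover by blast
  note gr = minimal_coverD(1)[OF cover] and M = minimal_coverD(2)[OF cover]
    and im = minimal_coverD(3)[OF cover] and min = minimal_coverD(4)[OF cover]
  have zero: "d k l = 0" if "l < length t" "k \<ge> 1" for k l
    using M[OF that(1)] that(2) by (simp add: M_def)
  have "d 0 l \<in> irrelevant_ideal" if "l < length t" for l
    using M[OF that] I(2) by (auto simp: M_def)
  moreover have "w l \<in> irrelevant_ideal" if "(\<Sum>l<length t. d 0 l * w l) = 0" "l < length t" for w l
  proof (rule min[OF _ that(2)])
    fix k show "(\<Sum>l<length t. d k l * w l) = 0"
      by (cases "k = 0") (use zero that(1) in simp_all)
  qed
  ultimately have stage: "minimal_stage ([0], t, d)" using gr by (simp add: minimal_stage_def)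
  have "f \<in> I \<longleftrightarrow> (\<exists>w. f = (\<Sum>l<length t. d 0 l * w l))" for f
  proof -
    define u where "u k = (if k = 0 then f else 0)" for k :: nat
    have "f \<in> I \<longleftrightarrow> u \<in> M" by (simp add: M_def u_def)
    also have "\<dots> \<longleftrightarrow> (\<exists>w. \<forall>k. u k = (\<Sum>l<length t. d k l * w l))" by (rule im)
    also have "\<dots> \<longleftrightarrow> (\<exists>w. f = (\<Sum>l<length t. d 0 l * w l))"
    proof (intro ex_cong1 iffI allI)
      fix w k assume "f = (\<Sum>l<length t. d 0 l * w l)"
      then show "u k = (\<Sum>l<length t. d k l * w l)"
        by (cases "k = 0") (use zero in \<open>simp_all add: u_def\<close>)
    next
      fix w assume "\<forall>k. u k = (\<Sum>l<length t. d k l * w l)"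
      then show "f = (\<Sum>l<length t. d 0 l * w l)" by (metis u_def)
    qed
    finally show "f \<in> I \<longleftrightarrow> (\<exists>w. f = (\<Sum>l<length t. d 0 l * w l))" .
  qed
  with stage show ?thesis by blast
qed

theorem ex_minimal_graded_free_resolution:
  fixes I :: "('x :: finite, 'k :: field) mpoly set"
  assumes I: "graded_ideal I" "I \<subseteq> irrelevant_ideal"
  shows "\<exists>s e D. minimal_graded_free_resolution I s e D"
proof -
  obtain t0 :: "int list" and d0 :: "nat \<Rightarrow> nat \<Rightarrow> ('x, 'k) mpoly"
    where t0: "minimal_stage ([0], t0, d0)"
      and I_im: "\<And>f. f \<in> I \<longleftrightarrow> (\<exists>w. f = (\<Sum>l<length t0. d0 0 l * w l))"
    using ex_first_stage[OF I] by blast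
  \<comment> \<open>Dependent choice leaves the first stage open; the clause for
    \<open>i = 0\<close> pins it.\<close>
  have "\<exists>F. \<forall>i. (minimal_stage (F i) \<and> (i = 0 \<longrightarrow> F i = ([0], t0, d0))) \<and> exact_stages (F i) (F (Suc i))"
  proof (rule dependent_nat_choice)
    fix x :: "int list \<times> int list \<times> (nat \<Rightarrow> nat \<Rightarrow> ('x, 'k) mpoly)" and i :: nat
    assume "minimal_stage x \<and> (i = 0 \<longrightarrow> x = ([0], t0, d0))"
    then show "\<exists>y. (minimal_stage y \<and> (Suc i = 0 \<longrightarrow> y = ([0], t0, d0))) \<and> exact_stages x y"
      using ex_next_stage by (cases x) auto
  qed (use t0 in auto)
  then obtain F where F: "\<And>i. minimal_stage (F i)" "F 0 = ([0], t0, d0)"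
    "\<And>i. exact_stages (F i) (F (Suc i))" by blast
  define s where "s i = fst (F i)" for i
  define d where "d i = snd (snd (F i))" for i
  have Feq: "F i = (s i, s (Suc i), d i)" for i
    using F(3)[of i] by (auto simp: exact_stages_def s_def d_def split: prod.splits)
  have s0: "s 0 = [0]" "s (Suc 0) = t0" "d 0 = d0" using F(2) Feq[of 0] by auto
  have entries: "d i k l \<in> graded_part (s (Suc i) ! l - s i ! k)" "d i k l \<in> irrelevant_ideal"
    if "k < length (s i)" "l < length (s (Suc i))" for i k l
    using F(1)[of i] that by (auto simp: Feq minimal_stage_def)
  have exact: "(\<forall>k<length (s i). (\<Sum>l<length (s (Suc i)). d i k l * v l) = 0) \<longleftrightarrow>
      (\<exists>w. \<forall>l<length (s (Suc i)). v l = (\<Sum>m<length (s (Suc (Suc i))). d (Suc i) l m * w m))" for i v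
    using F(3)[of i] by (simp add: Feq exact_stages_def)
  define D where "D i = mat (length (s i)) (length (s (Suc i))) (\<lambda>(k, l). d i k l)" for i
  define e where "e = vec 1 (\<lambda>_. 1 :: ('x, 'k) mpoly)"
  have D: "D i \<in> carrier_mat (length (s i)) (length (s (Suc i)))" for i by (simp add: D_def)
  have ev: "e \<bullet> v = v $ 0" if "v \<in> carrier_vec 1" for v
    using that by (simp add: e_def scalar_prod_def)
  have "minimal_graded_free_resolution I s e D"
    unfolding minimal_graded_free_resolution_def
  proof (intro conjI allI impI)
    show "e \<in> carrier_vec (length (s 0))" by (simp add: e_def s0)
    show "D i \<in> carrier_mat (length (s i)) (length (s (Suc i)))" for i by (rule D)
    show "e $ k \<in> graded_part (s 0 ! k)" if "k < length (s 0)" for k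
      using that by (simp add: e_def s0 graded_part_one)
    show "\<exists>v\<in>carrier_vec (length (s 0)). f - e \<bullet> v \<in> I" for f
      using I(1) ev[of "vec 1 (\<lambda>_. f)"]
      by (intro bexI[of _ "vec 1 (\<lambda>_. f)"]) (simp_all add: s0 graded_ideal_def ideal_zero)
    show "D i $$ (k, l) \<in> graded_part (s (Suc i) ! l - s i ! k)"
      "D i $$ (k, l) \<in> ideal_of (range indet)"
      if "k < length (s i)" "l < length (s (Suc i))" for i k l
      using entries[OF that] that by (simp_all add: D_def irrelevant_ideal_def)
    show "{v \<in> carrier_vec (length (s 0)). e \<bullet> v \<in> I} =
        (\<lambda>w. D 0 *\<^sub>v w) ` carrier_vec (length (s 1))"
    proof (rule Set.set_eqI)
      fix v
      show "v \<in> {v \<in> carrier_vec (length (s 0)). e \<bullet> v \<in> I} \<longleftrightarrow>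
          v \<in> (\<lambda>w. D 0 *\<^sub>v w) ` carrier_vec (length (s 1))"
      proof (cases "v \<in> carrier_vec (length (s 0))")
        case True
        then show ?thesis
          using mat_vec_image_iff[OF D[of 0] True] ev[of v] I_im[of "v $ 0"] by (simp add: s0 D_def)
      next
        case False
        then show ?thesis using mult_mat_vec_carrier[OF D[of 0]] by auto
      qed
    qed
    show "mat_kernel (D i) = (\<lambda>w. D (Suc i) *\<^sub>v w) ` carrier_vec (length (s (Suc (Suc i))))" for i
    proof (rule Set.set_eqI)
      fix v
      show "v \<in> mat_kernel (D i) \<longleftrightarrow>
          v \<in> (\<lambda>w. D (Suc i) *\<^sub>v w) ` carrier_vec (length (s (Suc (Suc i))))"
      proof (cases "v \<in> carrier_vec (length (s (Suc i)))")
        case True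
        have "v \<in> mat_kernel (D i) \<longleftrightarrow> (\<forall>k<length (s i). (D i *\<^sub>v v) $ k = 0)"
          using True D[of i] by (auto simp: mat_kernel[OF D[of i]] vec_eq_iff)
        also have "\<dots> \<longleftrightarrow> (\<forall>k<length (s i). (\<Sum>l<length (s (Suc i)). d i k l * v $ l) = 0)"
          using mult_mat_vec_index[OF D[of i] True] by (simp add: D_def)
        also have "\<dots> \<longleftrightarrow> (\<exists>w. \<forall>l<length (s (Suc i)). v $ l =
            (\<Sum>m<length (s (Suc (Suc i))). d (Suc i) l m * w m))" by (rule exact)
        also have "\<dots> \<longleftrightarrow> v \<in> (\<lambda>w. D (Suc i) *\<^sub>v w) ` carrier_vec (length (s (Suc (Suc i))))"
          using mat_vec_image_iff[OF D[of "Suc i"] True] by (simp add: D_def)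
        finally show ?thesis .
      next
        case False
        then show ?thesis
          using mult_mat_vec_carrier[OF D[of "Suc i"]] mat_kernel_carrier[OF D[of i]] by auto
      qed
    qed
  qed
  then show ?thesis by blast
qed

section \<open>Matrices modulo an ideal\<close>

definition mat_in :: "'a :: comm_ring_1 set \<Rightarrow> 'a mat \<Rightarrow> bool" where
  "mat_in J A \<longleftrightarrow> (\<forall>i<dim_row A. \<forall>j<dim_col A. A $$ (i, j) \<in> J)"

lemma mat_in_add:
  assumes "ideal J" "A \<in> carrier_mat n m" "B \<in> carrier_mat n m" "mat_in J A" "mat_in J B"
  shows "mat_in J (A + B)"
  using assms by (auto simp: mat_in_def ideal_add)

lemma mat_in_mult:
  assumes "ideal J" "A \<in> carrier_mat n m" "B \<in> carrier_mat m q" "mat_in J A"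
  shows "mat_in J (A * B)"
  unfolding mat_in_def
proof (intro allI impI)
  fix i j assume "i < dim_row (A * B)" "j < dim_col (A * B)"
  then show "(A * B) $$ (i, j) \<in> J"
    using assms by (auto simp: scalar_prod_def mat_in_def intro!: ideal_sum ideal_mult')
qed

lemma mat_in_mono: "J \<subseteq> J' \<Longrightarrow> mat_in J A \<Longrightarrow> mat_in J' A"
  by (auto simp: mat_in_def)

lemma mat_diff_add_cancel:
  fixes A :: "'a :: ring mat"
  assumes "A \<in> carrier_mat n m" "B \<in> carrier_mat n m"
  shows "A - B + B = A"
  using assms by (intro eq_matI) auto

lemma mat_add_diff_cancel:
  fixes A :: "'a :: ring mat"
  assumes "A \<in> carrier_mat n m" "B \<in> carrier_mat n m"
  shows "A + B - B = A"
  using assms by (intro eq_matI) auto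

lemma mat_diff_zero:
  fixes A :: "'a :: ring mat"
  assumes "A \<in> carrier_mat n m"
  shows "A - 0\<^sub>m n m = A"
  using assms by (intro eq_matI) auto

lemma mat_smult_diff_telescope:
  fixes A :: "'a :: comm_ring_1 mat"
  assumes "A \<in> carrier_mat n m" "B \<in> carrier_mat n m" "C \<in> carrier_mat n m"
  shows "g \<cdot>\<^sub>m A - B + (B - g \<cdot>\<^sub>m C) = g \<cdot>\<^sub>m (A - C)"
  using assms by (intro eq_matI) (auto simp: right_diff_distrib)

lemma mat_in_smult_diff:
  fixes A :: "'a :: comm_ring_1 mat"
  assumes "A \<in> carrier_mat n m" "B \<in> carrier_mat n m" "mat_in J (g \<cdot>\<^sub>m A - B)"
    and "\<And>x y. g * y - x \<in> J \<Longrightarrow> x \<in> J'"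
  shows "mat_in J' B"
  using assms by (auto simp: mat_in_def)

lemma mat_factor:
  fixes A :: "'a :: comm_ring_1 mat"
  assumes A: "A \<in> carrier_mat n m" and X: "X \<in> carrier_mat n q"
    and cols: "\<And>j. j < q \<Longrightarrow> col X j \<in> (\<lambda>w. A *\<^sub>v w) ` carrier_vec m"
  shows "\<exists>Y\<in>carrier_mat m q. X = A * Y"
proof -
  have "\<forall>j. \<exists>y. j < q \<longrightarrow> y \<in> carrier_vec m \<and> col X j = A *\<^sub>v y"
    using cols by blast
  from choice[OF this] obtain y where y: "\<And>j. j < q \<Longrightarrow> y j \<in> carrier_vec m"
    "\<And>j. j < q \<Longrightarrow> col X j = A *\<^sub>v y j" by blast
  define Y where "Y = mat m q (\<lambda>(i, j). y j $ i)"
  have Y: "Y \<in> carrier_mat m q" by (simp add: Y_def)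
  have colY: "col Y j = y j" if "j < q" for j
    using y(1)[OF that] that by (intro eq_vecI) (auto simp: Y_def)
  have "X = A * Y"
  proof (rule eq_matI)
    fix i j assume "i < dim_row (A * Y)" "j < dim_col (A * Y)"
    then have ij: "i < n" "j < q" using A Y by auto
    have "X $$ (i, j) = col X j $ i" using X ij by simp
    also have "\<dots> = row A i \<bullet> col Y j" using y(2)[OF ij(2)] A ij by (simp add: colY)
    finally show "X $$ (i, j) = (A * Y) $$ (i, j)" using A Y ij by simp
  qed (use A X Y in auto)
  then show ?thesis using Y by blast
qed

section \<open>A lower bound for the regularity\<close>

text \<open>\<open>g\<close> annihilates the module resolved by \<open>D\<close>, so multiplication
  by \<open>g\<close> lifts the zero map and is null-homotopic. The homotopy is built degree by
  degree from exactness.\<close>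

lemma null_homotopy:
  fixes D :: "nat \<Rightarrow> 'a :: comm_ring_1 mat"
  assumes D: "\<And>i. D i \<in> carrier_mat (N i) (N (Suc i))"
    and exact: "\<And>i. mat_kernel (D i) = (\<lambda>w. D (Suc i) *\<^sub>v w) ` carrier_vec (N (Suc (Suc i)))"
    and aug: "\<And>v. v \<in> carrier_vec (N 0) \<Longrightarrow> g \<cdot>\<^sub>v v \<in> (\<lambda>w. D 0 *\<^sub>v w) ` carrier_vec (N 1)"
  shows "\<exists>H. (\<forall>i. H i \<in> carrier_mat (N (Suc i)) (N i)) \<and> D 0 * H 0 = g \<cdot>\<^sub>m 1\<^sub>m (N 0) \<and>
    (\<forall>i. D (Suc i) * H (Suc i) + H i * D i = g \<cdot>\<^sub>m 1\<^sub>m (N (Suc i)))"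
proof -
  have "\<exists>H\<in>carrier_mat (N 1) (N 0). g \<cdot>\<^sub>m 1\<^sub>m (N 0) = D 0 * H"
  proof (rule mat_factor)
    fix j assume "j < N 0"
    moreover from this have "col (g \<cdot>\<^sub>m 1\<^sub>m (N 0)) j = g \<cdot>\<^sub>v unit_vec (N 0) j"
      by (intro eq_vecI) (auto simp: unit_vec_def)
    ultimately show "col (g \<cdot>\<^sub>m 1\<^sub>m (N 0)) j \<in> (\<lambda>w. D 0 *\<^sub>v w) ` carrier_vec (N 1)"
      using aug[of "unit_vec (N 0) j"] by simp
  qed (use D[of 0] in auto)
  then obtain H0 where H0: "H0 \<in> carrier_mat (N 1) (N 0)" "D 0 * H0 = g \<cdot>\<^sub>m 1\<^sub>m (N 0)" by metis
  \<comment> \<open>The invariant \<open>D i * H * D i = g \<cdot>\<^sub>m D i\<close> says that the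
    columns of g - H D_i are cycles, which is what the next step needs in order to factor it through
    D_{i+1}.\<close>
  define P where "P i H \<longleftrightarrow> H \<in> carrier_mat (N (Suc i)) (N i) \<and> D i * H * D i = g \<cdot>\<^sub>m D i \<and>
    (i = 0 \<longrightarrow> H = H0)" for i H
  have "\<exists>H. \<forall>i. P i (H i) \<and> D (Suc i) * H (Suc i) + H i * D i = g \<cdot>\<^sub>m 1\<^sub>m (N (Suc i))"
  proof (rule dependent_nat_choice)
    have "D 0 * H0 * D 0 = g \<cdot>\<^sub>m D 0"
      using D[of 0] by (simp add: H0(2) mult_smult_assoc_mat[of _ "N 0" "N 0"])
    then show "\<exists>H. P 0 H" using H0(1) by (auto simp: P_def)
  next
    fix H i assume "P i H"
    then have H: "H \<in> carrier_mat (N (Suc i)) (N i)" "D i * H * D i = g \<cdot>\<^sub>m D i" by (auto simp: P_def)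
    note Di = D[of i] and DSi = D[of "Suc i"]
    have HD: "H * D i \<in> carrier_mat (N (Suc i)) (N (Suc i))" using H(1) Di by simp
    define X where "X = g \<cdot>\<^sub>m 1\<^sub>m (N (Suc i)) - H * D i"
    have X: "X \<in> carrier_mat (N (Suc i)) (N (Suc i))" unfolding X_def by (rule minus_carrier_mat[OF HD])
    have "D i * X = D i * (g \<cdot>\<^sub>m 1\<^sub>m (N (Suc i))) - D i * (H * D i)"
      unfolding X_def using Di HD by (intro mult_minus_distrib_mat) auto
    also have "D i * (g \<cdot>\<^sub>m 1\<^sub>m (N (Suc i))) = g \<cdot>\<^sub>m D i"
      by (simp add: mult_smult_distrib[OF Di one_carrier_mat] right_mult_one_mat[OF Di])
    also have "D i * (H * D i) = g \<cdot>\<^sub>m D i"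
      using H Di by (simp add: assoc_mult_mat[of _ "N i" "N (Suc i)" _ "N i"])
    also have "g \<cdot>\<^sub>m D i - g \<cdot>\<^sub>m D i = 0\<^sub>m (N i) (N (Suc i))" using Di by auto
    finally have DX: "D i * X = 0\<^sub>m (N i) (N (Suc i))" .
    have "\<exists>Y\<in>carrier_mat (N (Suc (Suc i))) (N (Suc i)). X = D (Suc i) * Y"
    proof (rule mat_factor[OF DSi X])
      fix j assume j: "j < N (Suc i)"
      have "D i *\<^sub>v col X j = col (D i * X) j" by (rule col_mult2[OF Di X j, symmetric])
      also have "\<dots> = 0\<^sub>v (N i)" using j by (simp add: DX)
      finally have "col X j \<in> mat_kernel (D i)" by (rule mat_kernelI[OF Di col_carrier_vec[OF j X]])
      then show "col X j \<in> (\<lambda>w. D (Suc i) *\<^sub>v w) ` carrier_vec (N (Suc (Suc i)))" by (simp add: exact)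
    qed
    then obtain Y where Y: "Y \<in> carrier_mat (N (Suc (Suc i))) (N (Suc i))" "X = D (Suc i) * Y" by blast
    have "D (Suc i) * Y + H * D i = g \<cdot>\<^sub>m 1\<^sub>m (N (Suc i))"
      unfolding Y(2)[symmetric] X_def using HD by (intro mat_diff_add_cancel) auto
    moreover have "D (Suc i) * Y * D (Suc i) = g \<cdot>\<^sub>m D (Suc i)"
    proof -
      have DD: "D i * D (Suc i) = 0\<^sub>m (N i) (N (Suc (Suc i)))"
      proof (rule eq_matI)
        fix a b assume "a < dim_row (0\<^sub>m (N i) (N (Suc (Suc i))))" "b < dim_col (0\<^sub>m (N i) (N (Suc (Suc i))))"
        then have ab: "a < N i" "b < N (Suc (Suc i))" by auto
        have "col (D (Suc i)) b = D (Suc i) *\<^sub>v unit_vec (N (Suc (Suc i))) b"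
          using DSi ab by (intro eq_vecI) (auto simp: scalar_prod_right_unit)
        then have "col (D (Suc i)) b \<in> mat_kernel (D i)" by (simp add: exact)
        then have "D i *\<^sub>v col (D (Suc i)) b = 0\<^sub>v (N i)" by (rule mat_kernelD(2)[OF Di])
        then have "col (D i * D (Suc i)) b = 0\<^sub>v (N i)" by (simp only: col_mult2[OF Di DSi ab(2)])
        then have "col (D i * D (Suc i)) b $ a = 0" using ab by simp
        then show "(D i * D (Suc i)) $$ (a, b) = 0\<^sub>m (N i) (N (Suc (Suc i))) $$ (a, b)"
          using ab Di DSi by simp
      qed (use Di DSi in auto)
      have "D (Suc i) * Y * D (Suc i) = (g \<cdot>\<^sub>m 1\<^sub>m (N (Suc i))) * D (Suc i) - H * D i * D (Suc i)"
        unfolding Y(2)[symmetric] X_def using HD DSi by (intro minus_mult_distrib_mat) auto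
      also have "H * D i * D (Suc i) = 0\<^sub>m (N (Suc i)) (N (Suc (Suc i)))"
        using H(1) Di DSi by (simp add: assoc_mult_mat[of _ "N (Suc i)" "N i" _ "N (Suc i)"] DD)
      also have "(g \<cdot>\<^sub>m 1\<^sub>m (N (Suc i))) * D (Suc i) = g \<cdot>\<^sub>m D (Suc i)"
        using DSi by (simp add: mult_smult_assoc_mat[of _ "N (Suc i)" "N (Suc i)"])
      also have "\<dots> - 0\<^sub>m (N (Suc i)) (N (Suc (Suc i))) = \<dots>" using DSi by auto
      finally show ?thesis .
    qed
    ultimately show "\<exists>H'. P (Suc i) H' \<and> D (Suc i) * H' + H * D i = g \<cdot>\<^sub>m 1\<^sub>m (N (Suc i))"
      using Y(1) by (auto simp: P_def)
  qed
  then obtain H where H: "\<And>i. P i (H i)"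
    "\<And>i. D (Suc i) * H (Suc i) + H i * D i = g \<cdot>\<^sub>m 1\<^sub>m (N (Suc i))" by blast
  have "H 0 = H0" using H(1)[of 0] by (simp add: P_def)
  then show ?thesis using H H0(2) by (intro exI[of _ H]) (simp add: P_def)
qed

text \<open>The cochains of a complex \<open>Hom(F, -)\<close> are represented by row vectors.\<close>

fun coboundaries :: "(nat \<Rightarrow> nat) \<Rightarrow> (nat \<Rightarrow> 'a :: comm_ring_1 mat) \<Rightarrow> nat \<Rightarrow> 'a mat set" where
  "coboundaries N D 0 = {0\<^sub>m 1 (N 0)}"
| "coboundaries N D (Suc i) = {v * D i | v. v \<in> carrier_mat 1 (N i)}"

lemma coboundaries_cocycle:
  assumes D: "\<And>i. D i \<in> carrier_mat (N i) (N (Suc i))"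
    and DD: "\<And>i. D i * D (Suc i) = 0\<^sub>m (N i) (N (Suc (Suc i)))"
    and b: "b \<in> coboundaries N D i"
  shows "b \<in> carrier_mat 1 (N i)" "b * D i = 0\<^sub>m 1 (N (Suc i))"
proof -
  have "b \<in> carrier_mat 1 (N i) \<and> b * D i = 0\<^sub>m 1 (N (Suc i))"
  proof (cases i)
    case 0
    then show ?thesis using b D[of 0] by (simp add: left_mult_zero_mat)
  next
    case (Suc j)
    then obtain v where v: "v \<in> carrier_mat 1 (N j)" "b = v * D j" using b by auto
    have "b * D i = v * (D j * D (Suc j))"
      unfolding v(2) Suc by (rule assoc_mult_mat[OF v(1) D D])
    then show ?thesis using v D[of j] by (simp add: DD Suc right_mult_zero_mat)
  qed
  then show "b \<in> carrier_mat 1 (N i)" "b * D i = 0\<^sub>m 1 (N (Suc i))" by auto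
qed

lemma mat_in_adjoin:
  assumes A: "A \<in> carrier_mat n m" and J: "\<And>x. x \<in> J' \<Longrightarrow> \<exists>y. x - g * y \<in> J" and "mat_in J' A"
  shows "\<exists>B\<in>carrier_mat n m. mat_in J (A - g \<cdot>\<^sub>m B)"
proof -
  have "\<forall>ij. \<exists>y. fst ij < n \<and> snd ij < m \<longrightarrow> A $$ ij - g * y \<in> J"
    using assms by (auto simp: mat_in_def)
  from choice[OF this] obtain y where y: "\<And>i j. i < n \<Longrightarrow> j < m \<Longrightarrow> A $$ (i, j) - g * y (i, j) \<in> J"
    by auto
  show ?thesis
    by (rule bexI[of _ "mat n m y"]) (use A y in \<open>auto simp: mat_in_def\<close>)
qed

text \<open>This is \<open>Ext\<^sup>i(R/I, R/J\<^sub>k) = 0\<close> for \<open>i < r - k\<close> when \<open>D\<close> resolves \<open>R/I\<close>. Since \<open>g\<^sub>k\<close> acts as zero on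
  \<open>Ext\<close>, the case \<open>(i + 1, k)\<close> reduces to \<open>(i, k + 1)\<close>.\<close>

lemma ext_vanishing:
  fixes D :: "nat \<Rightarrow> 'a :: comm_ring_1 mat" and J :: "nat \<Rightarrow> 'a set"
  assumes D: "\<And>i. D i \<in> carrier_mat (N i) (N (Suc i))"
    and DD: "\<And>i. D i * D (Suc i) = 0\<^sub>m (N i) (N (Suc (Suc i)))"
    and H: "\<And>k. k < r \<Longrightarrow> \<exists>H. (\<forall>i. H i \<in> carrier_mat (N (Suc i)) (N i)) \<and>
      D 0 * H 0 = g k \<cdot>\<^sub>m 1\<^sub>m (N 0) \<and>
      (\<forall>i. D (Suc i) * H (Suc i) + H i * D i = g k \<cdot>\<^sub>m 1\<^sub>m (N (Suc i)))"
    and J: "\<And>k. k \<le> r \<Longrightarrow> ideal (J k)"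
    and J_Suc: "\<And>k x. k < r \<Longrightarrow> x \<in> J (Suc k) \<longleftrightarrow> (\<exists>y. x - g k * y \<in> J k)"
    and regular: "\<And>k x. k < r \<Longrightarrow> g k * x \<in> J k \<Longrightarrow> x \<in> J k"
    and w: "w \<in> carrier_mat 1 (N i)" "mat_in (J k) (w * D i)" and ik: "i + k < r"
  shows "\<exists>b\<in>coboundaries N D i. mat_in (J k) (w - b)"
  using w ik
proof (induction i arbitrary: w k)
  case 0
  then have k: "k < r" "k \<le> r" by auto
  from H[OF k(1)] obtain H' where "\<forall>i. H' i \<in> carrier_mat (N (Suc i)) (N i)"
    and H0: "D 0 * H' 0 = g k \<cdot>\<^sub>m 1\<^sub>m (N 0)" by blast
  then have H: "H' 0 \<in> carrier_mat (N 1) (N 0)" by simp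
  have wD: "w * D 0 \<in> carrier_mat 1 (N 1)" using mult_carrier_mat[OF 0(1) D[of 0]] by simp
  \<comment> \<open>Degree 0: the product w D_0 H_0 lies in J_k and equals g_k w, so regularity puts
    w itself into J_k.\<close>
  have "w * D 0 * H' 0 = w * (D 0 * H' 0)"
    using 0 H D[of 0] by (intro assoc_mult_mat) auto
  also have "\<dots> = g k \<cdot>\<^sub>m w"
    using 0 by (simp add: H0 mult_smult_distrib[OF _ one_carrier_mat])
  finally have "mat_in (J k) (g k \<cdot>\<^sub>m w)"
    using mat_in_mult[OF J[OF k(2)] wD H 0(2)] by simp
  then have "mat_in (J k) w" using regular[OF k(1)] by (auto simp: mat_in_def)
  moreover have "w - 0\<^sub>m 1 (N 0) = w" using 0(1) by auto
  ultimately show ?case by simp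
next
  case (Suc i)
  then have k: "k < r" "k \<le> r" "Suc k \<le> r" by auto
  from H[OF k(1)] obtain H where H: "\<And>i. H i \<in> carrier_mat (N (Suc i)) (N i)"
    "\<And>i. D (Suc i) * H (Suc i) + H i * D i = g k \<cdot>\<^sub>m 1\<^sub>m (N (Suc i))" by blast
  note w = Suc.prems(1) and Jk = J[OF k(2)]
  note carr = w D[of i] D[of "Suc i"] H(1)[of i] H(1)[of "Suc i"]
  \<comment> \<open>The homotopy gives g_k w = (w D_{i+1}) H_{i+1} + h D_i, whose first summand lies
    in J_k. Hence h D_i lies in J_k + (g_k) = J_{k+1}: \<open>h\<close> is a cocycle one degree
    lower, with coefficients modulo J_{k+1}.\<close>
  define h where "h = w * H i"
  have h: "h \<in> carrier_mat 1 (N i)" using carr by (simp add: h_def)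
  note hD = mult_carrier_mat[OF h D[of i]]
  have "g k \<cdot>\<^sub>m w = w * (D (Suc i) * H (Suc i) + H i * D i)"
    using w by (simp add: H(2) mult_smult_distrib[OF _ one_carrier_mat])
  also have "\<dots> = w * (D (Suc i) * H (Suc i)) + w * (H i * D i)"
    by (rule mult_add_distrib_mat[OF w]) (use carr in auto)
  also have "w * (D (Suc i) * H (Suc i)) = w * D (Suc i) * H (Suc i)"
    using assoc_mult_mat[OF w D H(1)] by simp
  also have "w * (H i * D i) = h * D i"
    unfolding h_def using assoc_mult_mat[OF w H(1) D] by simp
  finally have gw: "g k \<cdot>\<^sub>m w = w * D (Suc i) * H (Suc i) + h * D i" .
  have wDH: "w * D (Suc i) * H (Suc i) \<in> carrier_mat 1 (N (Suc i))"
    using carr by (intro mult_carrier_mat) auto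
  have hDJ: "mat_in (J k) (w * D (Suc i) * H (Suc i))"
    by (rule mat_in_mult[OF Jk _ H(1) Suc.prems(2)]) (use carr in \<open>intro mult_carrier_mat\<close>)
  have diff: "mat_in (J k) (g k \<cdot>\<^sub>m w - h * D i)"
  proof -
    have "g k \<cdot>\<^sub>m w - h * D i = w * D (Suc i) * H (Suc i)"
      unfolding gw by (rule mat_add_diff_cancel[OF wDH hD])
    then show ?thesis using hDJ by simp
  qed
  have "mat_in (J (Suc k)) (h * D i)"
  proof (rule mat_in_smult_diff[OF w hD diff])
    fix x y assume "g k * y - x \<in> J k"
    then have "- (g k * y - x) \<in> J k" by (rule ideal_neg[OF Jk])
    then show "x \<in> J (Suc k)" unfolding J_Suc[OF k(1)] by (intro exI[of _ y]) simp
  qed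
  from Suc.IH[OF h this] obtain b where b: "b \<in> coboundaries N D i" "mat_in (J (Suc k)) (h - b)"
    using Suc.prems(3) by auto
  note bc = coboundaries_cocycle[OF D DD b(1)]
  have hb: "h - b \<in> carrier_mat 1 (N i)" using bc(1) by (rule minus_carrier_mat)
  \<comment> \<open>Modulo J_k, h = b + g_k h'. Since b D_i = 0, this turns g_k w = h D_i into g_k
    (w - h' D_i) = 0, and g_k cancels: w is the coboundary of h'.\<close>
  obtain h' where h': "h' \<in> carrier_mat 1 (N i)" "mat_in (J k) (h - b - g k \<cdot>\<^sub>m h')"
    using mat_in_adjoin[OF hb _ b(2)] J_Suc[OF k(1)] by blast
  have gh': "g k \<cdot>\<^sub>m h' \<in> carrier_mat 1 (N i)" using h'(1) by simp
  have h'D: "h' * D i \<in> carrier_mat 1 (N (Suc i))" by (rule mult_carrier_mat[OF h'(1) D])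
  have "(h - b - g k \<cdot>\<^sub>m h') * D i = h * D i - g k \<cdot>\<^sub>m (h' * D i)"
  proof -
    have "(h - b - g k \<cdot>\<^sub>m h') * D i = (h - b) * D i - (g k \<cdot>\<^sub>m h') * D i"
      by (rule minus_mult_distrib_mat[OF hb gh' D])
    also have "(h - b) * D i = h * D i - b * D i"
      by (rule minus_mult_distrib_mat[OF h bc(1) D])
    also have "\<dots> = h * D i" unfolding bc(2) by (rule mat_diff_zero[OF hD])
    also have "(g k \<cdot>\<^sub>m h') * D i = g k \<cdot>\<^sub>m (h' * D i)" by (rule mult_smult_assoc_mat[OF h'(1) D])
    finally show ?thesis .
  qed
  moreover have "mat_in (J k) ((h - b - g k \<cdot>\<^sub>m h') * D i)"
    by (rule mat_in_mult[OF Jk _ D h'(2)]) (rule minus_carrier_mat[OF gh'])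
  ultimately have "mat_in (J k) (h * D i - g k \<cdot>\<^sub>m (h' * D i))" by simp
  then have "mat_in (J k) (g k \<cdot>\<^sub>m w - h * D i + (h * D i - g k \<cdot>\<^sub>m (h' * D i)))"
    by (intro mat_in_add[OF Jk, of _ 1 "N (Suc i)"] minus_carrier_mat hD smult_carrier_mat h'D diff)
  also have "g k \<cdot>\<^sub>m w - h * D i + (h * D i - g k \<cdot>\<^sub>m (h' * D i)) = g k \<cdot>\<^sub>m (w - h' * D i)"
    by (rule mat_smult_diff_telescope[OF w hD h'D])
  finally have "mat_in (J k) (w - h' * D i)"
    using regular[OF k(1)] by (auto simp: mat_in_def)
  then show ?case using h'(1) by auto
qed

lemma col_eq_mult_unit_vec:
  assumes "A \<in> carrier_mat n m" "j < m"
  shows "col A j = (A :: 'a :: comm_ring_1 mat) *\<^sub>v unit_vec m j"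
  using assms by (intro eq_vecI) (auto simp: scalar_prod_right_unit)

lemma mat_in_smultD:
  assumes "mat_in J (g \<cdot>\<^sub>m A)" "\<And>x. g * x \<in> J \<Longrightarrow> x \<in> J'"
  shows "mat_in J' A"
  using assms by (auto simp: mat_in_def)

lemma mat_smult_telescope:
  fixes A :: "'a :: comm_ring_1 mat"
  assumes "A \<in> carrier_mat n m" "B \<in> carrier_mat n m" "C \<in> carrier_mat n m"
  shows "A - g \<cdot>\<^sub>m B + g \<cdot>\<^sub>m (B - C) = A - g \<cdot>\<^sub>m C"
  using assms by (intro eq_matI) (auto simp: right_diff_distrib)

lemma mat_zero_diff_smult:
  fixes A :: "'a :: comm_ring_1 mat"
  assumes "A \<in> carrier_mat n m"
  shows "0\<^sub>m n m - g \<cdot>\<^sub>m A = (- g) \<cdot>\<^sub>m A"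
  using assms by (intro eq_matI) auto

lemma mat_in_smult:
  assumes "ideal J" "mat_in J A"
  shows "mat_in J (g \<cdot>\<^sub>m A)"
  using assms by (auto simp: mat_in_def ideal_mult)

text \<open>The cocycles \<open>w\<close> of degree \<open>-2i\<close> below trace the class of the canonical surjection \<open>R/I \<rightarrow> R/J\<^sub>r\<close>
  through the isomorphisms \<open>Hom(R/I, R/J\<^sub>r) = Ext\<^sup>i(R/I, R/J\<^bsub>r-i\<^esub>)(-2i)\<close>.\<close>

theorem resolution_degree_bound:
  fixes I :: "('x :: finite, 'k :: field) mpoly set"
  assumes res: "minimal_graded_free_resolution I s e D" and I: "ideal I"
    and J: "\<And>k. k \<le> r \<Longrightarrow> graded_ideal (J k)"
    and g: "\<And>k. k < r \<Longrightarrow> g k \<in> I" "\<And>k. k < r \<Longrightarrow> g k \<in> graded_part 2"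
    and J_Suc: "\<And>k x. k < r \<Longrightarrow> x \<in> J (Suc k) \<longleftrightarrow> (\<exists>y. x - g k * y \<in> J k)"
    and regular: "\<And>k x. k < r \<Longrightarrow> g k * x \<in> J k \<Longrightarrow> x \<in> J k"
    and Jr: "I \<subseteq> J r" "1 \<notin> J r"
  shows "\<exists>l<length (s r). s r ! l \<ge> 2 * int r"
proof -
  define N where "N i = length (s i)" for i
  note * = res[unfolded minimal_graded_free_resolution_def, folded N_def]
  note e = *[THEN conjunct1] and D = *[THEN conjunct2, THEN conjunct1, rule_format] and e_deg = *[THEN conjunct2, THEN conjunct2, THEN conjunct1, rule_format] and e_surj = *[THEN conjunct2, THEN conjunct2, THEN conjunct2, THEN conjunct1, rule_format]
    and D_deg = *[THEN conjunct2, THEN conjunct2, THEN conjunct2, THEN conjunct2, THEN conjunct1, rule_format] and exact0 = *[THEN conjunct2, THEN conjunct2, THEN conjunct2, THEN conjunct2, THEN conjunct2, THEN conjunct1] and exact = *[THEN conjunct2, THEN conjunct2, THEN conjunct2, THEN conjunct2, THEN conjunct2, THEN conjunct2, THEN conjunct1, rule_format]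
  have DD: "D i * D (Suc i) = 0\<^sub>m (N i) (N (Suc (Suc i)))" for i
  proof (rule mat_col_eqI)
    fix j assume "j < dim_col (0\<^sub>m (N i) (N (Suc (Suc i))))"
    then have j: "j < N (Suc (Suc i))" by simp
    have "col (D (Suc i)) j \<in> mat_kernel (D i)"
      by (simp add: exact col_eq_mult_unit_vec[OF D j])
    then have "D i *\<^sub>v col (D (Suc i)) j = 0\<^sub>v (N i)" by (rule mat_kernelD(2)[OF D])
    then show "col (D i * D (Suc i)) j = col (0\<^sub>m (N i) (N (Suc (Suc i)))) j"
      using j by (simp only: col_mult2[OF D D j] col_zero)
  qed (use D[of i] D[of "Suc i"] in auto)
  have homotopy: "\<exists>H. (\<forall>i. H i \<in> carrier_mat (N (Suc i)) (N i)) \<and> D 0 * H 0 = g k \<cdot>\<^sub>m 1\<^sub>m (N 0) \<and>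
      (\<forall>i. D (Suc i) * H (Suc i) + H i * D i = g k \<cdot>\<^sub>m 1\<^sub>m (N (Suc i)))" if "k < r" for k
  proof (rule null_homotopy[of D N "g k", OF D exact])
    fix v :: "('x, 'k) mpoly vec" assume v: "v \<in> carrier_vec (N 0)"
    have "e \<bullet> (g k \<cdot>\<^sub>v v) = (e \<bullet> v) * g k" using e v by (simp add: mult.commute)
    then have "e \<bullet> (g k \<cdot>\<^sub>v v) \<in> I" using ideal_mult[OF I g(1)[OF that]] by simp
    then show "g k \<cdot>\<^sub>v v \<in> (\<lambda>w. D 0 *\<^sub>v w) ` carrier_vec (N 1)"
      unfolding exact0[symmetric] using v by simp
  qed
  have Ji: "ideal (J k)" if "k \<le> r" for k using J[OF that] by (simp add: graded_ideal_def)
  have ext: "\<exists>b\<in>coboundaries N D i. mat_in (J k) (w - b)"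
    if "w \<in> carrier_mat 1 (N i)" "mat_in (J k) (w * D i)" "i + k < r" for i k w
    by (rule ext_vanishing[of D N r g J, OF D DD homotopy Ji J_Suc regular that])
  \<comment> \<open>A nonzero class of degree -2i in Ext^i(R/I, R/J_{r-i}): on a generator of degree
    d the cocycle takes a value of degree d - 2i.\<close>
  define Q where "Q i \<longleftrightarrow> (\<exists>w\<in>carrier_mat 1 (N i).
      (\<forall>l<N i. w $$ (0, l) \<in> graded_part (s i ! l - 2 * int i)) \<and> mat_in (J (r - i)) (w * D i) \<and>
      \<not> (\<exists>b\<in>coboundaries N D i. mat_in (J (r - i)) (w - b)))" for i
  have "Q i" if "i \<le> r" for i
    using that
  proof (induction i)
    case 0
    define w where "w = mat 1 (N 0) (\<lambda>(_, l). e $ l)"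
    have w: "w \<in> carrier_mat 1 (N 0)" by (simp add: w_def)
    have row: "row w 0 = e" using e by (intro eq_vecI) (auto simp: w_def)
    have "mat_in (J r) (w * D 0)"
      unfolding mat_in_def
    proof (intro allI impI)
      fix i j assume "i < dim_row (w * D 0)" "j < dim_col (w * D 0)"
      then have ij: "i = 0" "j < N 1" using w D[of 0] by auto
      then have "col (D 0) j \<in> {v \<in> carrier_vec (N 0). e \<bullet> v \<in> I}"
        using D[of 0] unfolding exact0 by (simp add: col_eq_mult_unit_vec[of _ "N 0" "N 1"])
      then have "row w 0 \<bullet> col (D 0) j \<in> I" by (simp add: row)
      then show "(w * D 0) $$ (i, j) \<in> J r" using ij w D[of 0] Jr(1) by auto
    qed
    \<comment> \<open>In degree 0 the only coboundary is 0. Were all entries of the augmentation in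
      J_r, its surjectivity modulo I would put 1 into J_r.\<close>
    moreover have "\<not> mat_in (J r) (w - 0\<^sub>m 1 (N 0))"
    proof
      assume "mat_in (J r) (w - 0\<^sub>m 1 (N 0))"
      then have "mat_in (J r) w" by (simp only: mat_diff_zero[OF w])
      then have eJ: "e $ l \<in> J r" if "l < N 0" for l using that by (auto simp: mat_in_def w_def)
      obtain v where v: "v \<in> carrier_vec (N 0)" "1 - e \<bullet> v \<in> I" using e_surj by blast
      have "e \<bullet> v \<in> J r" unfolding scalar_prod_def
        using v(1) eJ by (intro ideal_sum ideal_mult' Ji) auto
      then have "(1 - e \<bullet> v) + e \<bullet> v \<in> J r" using v(2) Jr(1) by (intro ideal_add Ji) auto
      then show False using Jr(2) by simp
    qed
    ultimately show ?case unfolding Q_def using w e_deg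
      by (intro bexI[of _ w]) (auto simp: w_def)
  next
    case (Suc i)
    then have "Q i" and i: "i < r" by auto
    define k where "k = r - Suc i"
    have k: "r - i = Suc k" "k < r" "k \<le> r" "i + k < r" using i by (auto simp: k_def)
    from \<open>Q i\<close> obtain w where w: "w \<in> carrier_mat 1 (N i)" "mat_in (J (Suc k)) (w * D i)"
      and w_deg: "\<And>l. l < N i \<Longrightarrow> w $$ (0, l) \<in> graded_part (s i ! l - 2 * int i)"
      and w_cob: "\<not> (\<exists>b\<in>coboundaries N D i. mat_in (J (Suc k)) (w - b))"
      unfolding Q_def k(1) by blast
    \<comment> \<open>Connecting homomorphism: X = w D_i lies in J_k + (g_k), so X = g_k w' modulo
      J_k, and w' represents the image class one homological degree higher.\<close>
    define X where "X = w * D i"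
    have X: "X \<in> carrier_mat 1 (N (Suc i))" unfolding X_def by (rule mult_carrier_mat[OF w(1) D])
    have X_deg: "X $$ (0, l) \<in> graded_part (s (Suc i) ! l - 2 * int i)" if l: "l < N (Suc i)" for l
    proof -
      have "X $$ (0, l) = (\<Sum>m\<in>{0..<N i}. w $$ (0, m) * D i $$ (m, l))"
        using w(1) D[of i] l by (auto simp: X_def scalar_prod_def intro!: sum.cong)
      also have "\<dots> \<in> graded_part (s (Suc i) ! l - 2 * int i)"
      proof (rule graded_part_sum)
        fix m assume "m \<in> {0..<N i}"
        then have "m < N i" by simp
        from graded_part_mult[OF w_deg[OF this] D_deg[OF this l]]
        show "w $$ (0, m) * D i $$ (m, l) \<in> graded_part (s (Suc i) ! l - 2 * int i)" by simp
      qed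
      finally show ?thesis .
    qed
    have "\<exists>B\<in>carrier_mat 1 (N (Suc i)). mat_in (J k) (X - g k \<cdot>\<^sub>m B)"
      by (rule mat_in_adjoin[OF X _ w(2)[folded X_def]]) (simp add: J_Suc[OF k(2)])
    then obtain B where B: "B \<in> carrier_mat 1 (N (Suc i))" "mat_in (J k) (X - g k \<cdot>\<^sub>m B)" by blast
    \<comment> \<open>The quotient \<open>B\<close> need not be homogeneous. As \<open>X\<close> is
      homogeneous and J_k graded, its component of the right degree satisfies the same
      congruence.\<close>
    define w' where "w' = mat 1 (N (Suc i)) (\<lambda>(_, l). hom_comp (s (Suc i) ! l - 2 * int (Suc i)) (B $$ (0, l)))"
    have w': "w' \<in> carrier_mat 1 (N (Suc i))" by (simp add: w'_def)
    have diff: "mat_in (J k) (X - g k \<cdot>\<^sub>m w')"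
      unfolding mat_in_def
    proof (intro allI impI)
      fix a l assume "a < dim_row (X - g k \<cdot>\<^sub>m w')" "l < dim_col (X - g k \<cdot>\<^sub>m w')"
      then have al: "a = 0" "l < N (Suc i)" using w' by auto
      let ?\<delta> = "s (Suc i) ! l - 2 * int i"
      have "X $$ (0, l) - g k * B $$ (0, l) \<in> J k"
        using B al X by (auto simp: mat_in_def)
      then have "hom_comp ?\<delta> (X $$ (0, l) - g k * B $$ (0, l)) \<in> J k"
        using J[OF k(3)] by (simp add: graded_ideal_def)
      also have "hom_comp ?\<delta> (X $$ (0, l) - g k * B $$ (0, l)) =
          X $$ (0, l) - hom_comp (?\<delta> - 2) (B $$ (0, l)) * g k"
        using hom_comp_same[OF X_deg[OF al(2)]] hom_comp_mult_graded[OF g(2)[OF k(2)], of ?\<delta> "B $$ (0, l)"]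
        by (simp add: hom_comp_diff mult.commute)
      also have "\<dots> = (X - g k \<cdot>\<^sub>m w') $$ (a, l)"
        using X w' al by (simp add: w'_def mult.commute algebra_simps)
      finally show "(X - g k \<cdot>\<^sub>m w') $$ (a, l) \<in> J k" .
    qed
    have gw': "g k \<cdot>\<^sub>m w' \<in> carrier_mat 1 (N (Suc i))" using w' by simp
    have w'D: "w' * D (Suc i) \<in> carrier_mat 1 (N (Suc (Suc i)))" by (rule mult_carrier_mat[OF w' D])
    have "mat_in (J k) (w' * D (Suc i))"
    proof (rule mat_in_smultD)
      have "X * D (Suc i) = 0\<^sub>m 1 (N (Suc (Suc i)))"
        unfolding X_def assoc_mult_mat[OF w(1) D D] DD by (rule right_mult_zero_mat[OF w(1)])
      then have "(X - g k \<cdot>\<^sub>m w') * D (Suc i) = 0\<^sub>m 1 (N (Suc (Suc i))) - g k \<cdot>\<^sub>m (w' * D (Suc i))"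
        unfolding minus_mult_distrib_mat[OF X gw' D] mult_smult_assoc_mat[OF w' D] by simp
      also have "\<dots> = (- g k) \<cdot>\<^sub>m (w' * D (Suc i))"
        by (rule mat_zero_diff_smult[OF w'D])
      finally show "mat_in (J k) ((- g k) \<cdot>\<^sub>m (w' * D (Suc i)))"
        using mat_in_mult[OF Ji[OF k(3)] minus_carrier_mat[OF gw'] D diff] by simp
      fix x assume "- g k * x \<in> J k"
      then have "- (- g k * x) \<in> J k" by (rule ideal_neg[OF Ji[OF k(3)]])
      then show "x \<in> J k" using regular[OF k(2)] by simp
    qed
    \<comment> \<open>Injectivity of the connecting map: if w' = h D_i modulo J_k, then w - g_k h is
      a cocycle modulo J_k, hence a coboundary by the vanishing of Ext^i(R/I, R/J_k), and w would be
      a coboundary modulo J_{k+1}.\<close>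
    moreover have "\<not> (\<exists>b\<in>coboundaries N D (Suc i). mat_in (J k) (w' - b))"
    proof
      assume "\<exists>b\<in>coboundaries N D (Suc i). mat_in (J k) (w' - b)"
      then obtain h where h: "h \<in> carrier_mat 1 (N i)" "mat_in (J k) (w' - h * D i)" by auto
      have gh: "g k \<cdot>\<^sub>m h \<in> carrier_mat 1 (N i)" using h(1) by simp
      have hD: "h * D i \<in> carrier_mat 1 (N (Suc i))" by (rule mult_carrier_mat[OF h(1) D])
      have "mat_in (J k) (X - g k \<cdot>\<^sub>m w' + g k \<cdot>\<^sub>m (w' - h * D i))"
        by (rule mat_in_add[OF Ji[OF k(3)], where n = 1 and m = "N (Suc i)"])
          (intro diff mat_in_smult[OF Ji[OF k(3)] h(2)] minus_carrier_mat smult_carrier_mat gw' hD)+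
      also have "X - g k \<cdot>\<^sub>m w' + g k \<cdot>\<^sub>m (w' - h * D i) = X - g k \<cdot>\<^sub>m (h * D i)"
        by (rule mat_smult_telescope[OF X w' hD])
      also have "\<dots> = (w - g k \<cdot>\<^sub>m h) * D i"
        unfolding minus_mult_distrib_mat[OF w(1) gh D] mult_smult_assoc_mat[OF h(1) D] X_def ..
      finally obtain b where b: "b \<in> coboundaries N D i" "mat_in (J k) (w - g k \<cdot>\<^sub>m h - b)"
        using ext[OF minus_carrier_mat[OF gh] _ k(4)] by blast
      have bc: "b \<in> carrier_mat 1 (N i)" by (rule coboundaries_cocycle(1)[OF D DD b(1)])
      have "mat_in (J (Suc k)) (w - b)"
        unfolding mat_in_def
      proof (intro allI impI)
        fix a l assume "a < dim_row (w - b)" "l < dim_col (w - b)"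
        then have al: "a < 1" "l < N i" using bc by auto
        then have "w $$ (a, l) - b $$ (a, l) - g k * h $$ (a, l) \<in> J k"
          using b(2) w(1) h(1) bc by (auto simp: mat_in_def algebra_simps)
        then show "(w - b) $$ (a, l) \<in> J (Suc k)"
          unfolding J_Suc[OF k(2)] using al bc w(1) by auto
      qed
      then show False using w_cob b(1) by blast
    qed
    ultimately show ?case
      unfolding Q_def k_def[symmetric] using w'
      by (intro bexI[of _ w']) (auto simp: w'_def hom_comp_graded)
  qed
  from this[of r] obtain w where w: "w \<in> carrier_mat 1 (N r)"
    and w_deg: "\<And>l. l < N r \<Longrightarrow> w $$ (0, l) \<in> graded_part (s r ! l - 2 * int r)"
    and w_cob: "\<not> (\<exists>b\<in>coboundaries N D r. mat_in (J 0) (w - b))"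
    unfolding Q_def by auto
  have "0\<^sub>m 1 (N r) \<in> coboundaries N D r"
  proof (cases r)
    case (Suc i)
    then have "0\<^sub>m 1 (N r) = 0\<^sub>m 1 (N i) * D i" using left_mult_zero_mat[OF D[of i], of 1] by simp
    then show ?thesis using Suc by auto
  qed simp
  then have "\<not> mat_in (J 0) w" using w_cob mat_diff_zero[OF w] by metis
  then obtain l where l: "l < N r" "w $$ (0, l) \<notin> J 0"
    using w by (auto simp: mat_in_def)
  then have "w $$ (0, l) \<noteq> 0" using ideal_zero[OF Ji[of 0]] by auto
  \<comment> \<open>A nonzero homogeneous entry contains a monomial, whose degree s r ! l - 2r
    cannot be negative.\<close>
  then obtain m where "lookup (w $$ (0, l)) m \<noteq> 0" by (metis lookup_zero poly_mapping_eqI)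
  then have "int (monom_deg m) = s r ! l - 2 * int r"
    using graded_partD[OF w_deg[OF l(1)]] by blast
  then show ?thesis using l(1) unfolding N_def by (intro exI[of _ l]) auto
qed

section \<open>Evaluation homomorphisms\<close>

text \<open>Natural numbers serve as indices because their linear order induces one on monomials;
  comparing extreme terms then excludes zero divisors. Primality of kernels rests on this.\<close>

type_synonym 'k target = "((nat \<Rightarrow>\<^sub>0 nat) \<Rightarrow>\<^sub>0 'k)"

definition monom_eval :: "('x :: finite \<Rightarrow> 'k :: field target) \<Rightarrow> ('x \<Rightarrow>\<^sub>0 nat) \<Rightarrow> 'k target" where
  "monom_eval val m = (\<Prod>x\<in>UNIV. val x ^ lookup m x)"

definition poly_eval :: "('x :: finite \<Rightarrow> 'k :: field target) \<Rightarrow> ('x, 'k) mpoly \<Rightarrow> 'k target" where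
  "poly_eval val f = (\<Sum>m\<in>keys f. single 0 (lookup f m) * monom_eval val m)"

lemma poly_eval_superset:
  assumes "finite S" "keys f \<subseteq> S"
  shows "poly_eval val f = (\<Sum>m\<in>S. single 0 (lookup f m) * monom_eval val m)"
  unfolding poly_eval_def using assms
  by (intro sum.mono_neutral_left) (auto simp: in_keys_iff)

lemma poly_eval_0 [simp]: "poly_eval val 0 = 0"
  by (simp add: poly_eval_def)

lemma poly_eval_add: "poly_eval val (f + g) = poly_eval val f + poly_eval val g"
proof -
  let ?S = "keys f \<union> keys g"
  have "keys (f + g) \<subseteq> ?S" by (rule Poly_Mapping.keys_add)
  then show ?thesis
    by (simp add: poly_eval_superset[of ?S] lookup_add single_add distrib_right sum.distrib)
qed

lemma poly_eval_single: "poly_eval val (single m c) = single 0 c * monom_eval val m"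
  by (subst poly_eval_superset[of "{m}"]) auto

lemma poly_eval_mult: "poly_eval val (f * g) = poly_eval val f * poly_eval val g"
proof (induction f rule: poly_mapping_induct_monomials)
  case (single m c)
  have mm: "monom_eval val (m + m') = monom_eval val m * monom_eval val m'" for m'
    by (simp add: monom_eval_def lookup_add power_add prod.distrib)
  show ?case
  proof (induction g rule: poly_mapping_induct_monomials)
    case (single m' c')
    have "single (0 :: nat \<Rightarrow>\<^sub>0 nat) (c * c') = single 0 c * single 0 c'" by (simp add: mult_single)
    then have "single 0 (c * c') * (monom_eval val m * monom_eval val m') =
        (single 0 c * monom_eval val m) * (single 0 c' * monom_eval val m')"
      by (simp only: mult_ac)
    then show ?case by (simp only: mult_single poly_eval_single mm)
  qed (simp_all add: distrib_left poly_eval_add)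
qed (simp_all add: distrib_right poly_eval_add)

lemma poly_eval_1: "poly_eval val 1 = 1"
  using poly_eval_single[of val 0 1] by (simp add: monom_eval_def)

lemma poly_eval_diff: "poly_eval val (f - g) = poly_eval val f - poly_eval val g"
  using poly_eval_add[of val "f - g" g] by (simp add: algebra_simps)

lemma poly_eval_indet: "poly_eval val (indet x) = val x"
proof -
  have "(\<Prod>y\<in>UNIV. val y ^ lookup (single x 1) y) = (\<Prod>y\<in>UNIV. if y = x then val y else 1)"
    by (intro prod.cong) (auto simp: lookup_single when_def)
  then show ?thesis by (simp add: indet_def poly_eval_single monom_eval_def)
qed

lemma poly_eval_prod: "poly_eval val (prod f S) = (\<Prod>i\<in>S. poly_eval val (f i))"
  by (induction S rule: infinite_finite_induct) (simp_all add: poly_eval_1 poly_eval_mult)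

lemma is_prime_ideal_poly_eval_kernel: "is_prime_ideal {f. poly_eval val f = 0}"
  unfolding is_prime_ideal_def
proof (intro conjI allI impI)
  show "ideal {f. poly_eval val f = 0}"
    by (rule self_module.subspaceI) (simp_all add: poly_eval_add poly_eval_mult)
  have "1 \<notin> {f. poly_eval val f = 0}" by (simp add: poly_eval_1)
  then show "{f. poly_eval val f = 0} \<noteq> UNIV" by blast
qed (simp add: poly_eval_mult)

text \<open>Write T for division by z. Applying T to the hypothesis gives \<alpha> y = \<gamma> (T
  y) modulo J, and the relation persists for T y, T(T y), and so on. Some power of T kills y; going
  back, T y in J gives \<alpha> y in J, hence y in J.\<close>

lemma regular_linear_form:
  fixes \<alpha> \<gamma> y :: "('x, 'k :: comm_ring_1) mpoly"
  assumes J: "ideal J" and T: "\<And>f. f \<in> J \<Longrightarrow> div_indet z f \<in> J"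
    and \<alpha>: "free_of z \<alpha>" "\<And>f. \<alpha> * f \<in> J \<Longrightarrow> f \<in> J" and \<gamma>: "free_of z \<gamma>"
    and y: "(\<alpha> * indet z - \<gamma>) * y \<in> J"
  shows "y \<in> J"
proof -
  have T\<alpha>: "div_indet z (\<alpha> * f) = \<alpha> * div_indet z f" for f using \<alpha>(1) by (simp only: free_of_def)
  have T\<gamma>: "div_indet z (\<gamma> * f) = \<gamma> * div_indet z f" for f using \<gamma> by (simp only: free_of_def)
  have *: "x \<in> J" if "(div_indet z ^^ m) x = 0" "\<alpha> * x - \<gamma> * div_indet z x \<in> J" for m x
    using that
  proof (induction m arbitrary: x)
    case 0
    then have "x = 0" by simp
    then show ?case using ideal_zero[OF J] by simp
  next
    case (Suc m)
    define x' where "x' = div_indet z x"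
    have "(div_indet z ^^ m) x' = 0"
      using Suc.prems(1) unfolding x'_def funpow_Suc_right comp_apply .
    moreover have "\<alpha> * x' - \<gamma> * div_indet z x' \<in> J"
      using T[OF Suc.prems(2)] unfolding div_indet_diff T\<alpha> T\<gamma> x'_def .
    ultimately have "x' \<in> J" by (rule Suc.IH)
    then have "(\<alpha> * x - \<gamma> * x') + \<gamma> * x' \<in> J"
      using Suc.prems(2)[folded x'_def] by (intro ideal_add[OF J] ideal_mult[OF J])
    then have "\<alpha> * x \<in> J" by simp
    then show ?case by (rule \<alpha>(2))
  qed
  have "(\<alpha> * indet z - \<gamma>) * y = indet z * (\<alpha> * y) - \<gamma> * y" by (simp add: algebra_simps)
  then have "div_indet z ((\<alpha> * indet z - \<gamma>) * y) = \<alpha> * y - \<gamma> * div_indet z y"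
    by (simp only: div_indet_diff div_indet_indet_mult T\<gamma>)
  then have lin: "\<alpha> * y - \<gamma> * div_indet z y \<in> J" using T[OF y] by (simp only:)
  obtain N where "\<forall>m\<ge>N. (div_indet z ^^ m) y = 0" using div_indet_nilpotent[of z y] ..
  then have "(div_indet z ^^ N) y = 0" by simp
  then show ?thesis using lin by (rule *)
qed

section \<open>A path of twisted edges with a cone point\<close>

text \<open>The vertices are \<open>0, \<dots>, n - 1\<close>, and \<open>p i\<close>, \<open>q i\<close> name the two variables of the vertex \<open>i\<close>.\<close>

locale vertex_variables =
  fixes n :: nat and p q :: "nat \<Rightarrow> 'x :: finite" and scalars :: "'k :: field itself"
  assumes inj_p: "inj_on p {..<n}" and inj_q: "inj_on q {..<n}"
    and disjoint: "\<And>i j. i < n \<Longrightarrow> j < n \<Longrightarrow> p i \<noteq> q j"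
    and cover: "UNIV = p ` {..<n} \<union> q ` {..<n}"
begin

abbreviation A :: "nat \<Rightarrow> ('x, 'k) mpoly" where "A i \<equiv> indet (p i)"
abbreviation B :: "nat \<Rightarrow> ('x, 'k) mpoly" where "B i \<equiv> indet (q i)"

definition minor :: "nat \<Rightarrow> nat \<Rightarrow> ('x, 'k) mpoly" where
  "minor i j = A i * B j - B i * A j"

lemma p_neq: "i < n \<Longrightarrow> j < n \<Longrightarrow> i \<noteq> j \<Longrightarrow> p i \<noteq> p j"
  using inj_p by (auto simp: inj_on_def)

lemma q_neq: "i < n \<Longrightarrow> j < n \<Longrightarrow> i \<noteq> j \<Longrightarrow> q i \<noteq> q j"
  using inj_q by (auto simp: inj_on_def)

lemma graded_minor: "minor i j \<in> graded_part 2"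
  unfolding minor_def
  using graded_part_mult[OF graded_part_indet graded_part_indet] by (intro graded_part_diff) auto

text \<open>The index counts minors. The generators involve only vertices up to k + 1, so both
  variables of the vertex k + 2 are free modulo this ideal.\<close>

definition path_ideal :: "nat \<Rightarrow> ('x, 'k) mpoly set" where
  "path_ideal k = ideal_of ({A 0, B 0} \<union> (\<lambda>i. minor (Suc i) (Suc (Suc i))) ` {..<k})"

lemma graded_path_ideal: "graded_ideal (path_ideal k)"
  unfolding path_ideal_def
proof (rule graded_ideal_of)
  fix h assume "h \<in> {A 0, B 0} \<union> (\<lambda>i. minor (Suc i) (Suc (Suc i))) ` {..<k}"
  then consider "h = A 0" | "h = B 0" | i where "h = minor (Suc i) (Suc (Suc i))" by auto
  then show "\<exists>d. h \<in> graded_part d"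
  proof cases
    case 1
    then show ?thesis using graded_part_indet[of "p 0"] by blast
  next
    case 2
    then show ?thesis using graded_part_indet[of "q 0"] by blast
  next
    case 3
    then show ?thesis using graded_minor[of "Suc i" "Suc (Suc i)"] by blast
  qed
qed

lemma ideal_path_ideal: "ideal (path_ideal k)"
  using graded_path_ideal[of k] by (simp add: graded_ideal_def)

lemma path_ideal_Suc:
  "x \<in> path_ideal (Suc k) \<longleftrightarrow> (\<exists>y. x - minor (Suc k) (Suc (Suc k)) * y \<in> path_ideal k)"
proof -
  have "{A 0, B 0} \<union> (\<lambda>i. minor (Suc i) (Suc (Suc i))) ` {..<Suc k} =
      insert (minor (Suc k) (Suc (Suc k))) ({A 0, B 0} \<union> (\<lambda>i. minor (Suc i) (Suc (Suc i))) ` {..<k} :: ('x, 'k) mpoly set)"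
    by (auto simp: lessThan_Suc)
  then show ?thesis
    unfolding path_ideal_def by (simp only: self_module.span_insert mem_Collect_eq mult.commute)
qed

lemma path_ideal_div_indet:
  assumes "Suc k < j" "j < n" "x = p j \<or> x = q j" "f \<in> path_ideal k"
  shows "div_indet x f \<in> path_ideal k"
proof -
  have free: "free_of x (A i)" "free_of x (B i)" if "i < j" for i
    using that assms(2,3) p_neq[of i j] q_neq[of i j] disjoint[of i j] disjoint[of j i]
    by (auto intro!: free_of_indet)
  show ?thesis
    using assms(4) unfolding path_ideal_def
  proof (rule div_indet_ideal_of[rotated])
    fix h assume "h \<in> {A 0, B 0} \<union> (\<lambda>i. minor (Suc i) (Suc (Suc i))) ` {..<k}"
    then consider "h = A 0" | "h = B 0" | i where "i < k" "h = minor (Suc i) (Suc (Suc i))" by auto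
    then show "free_of x h"
      using assms(1) free by cases (auto simp: minor_def intro!: free_of_diff free_of_mult)
  qed
qed

text \<open>Needed because \<open>A (Suc k)\<close> is the coefficient of the new variable in the
  next minor. If a y = m w modulo J_k for that minor m, the terms without a show that w is divisible
  by a modulo J_k; then a cancels, and y is a multiple of m modulo J_k.\<close>

lemma regular_A:
  assumes "Suc k < n" "A (Suc k) * y \<in> path_ideal k"
  shows "y \<in> path_ideal k"
  using assms
proof (induction k arbitrary: y)
  case 0
  have "free_of (p 1) h" if "h \<in> {A 0, B 0}" for h
    using that 0(1) p_neq[of 1 0] disjoint[of 1 0] by (auto intro!: free_of_indet)
  then have "div_indet (p 1) (A 1 * y) \<in> path_ideal 0"
    using 0(2) unfolding path_ideal_def by (intro div_indet_ideal_of) auto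
  then show ?case by simp
next
  case (Suc k)
  let ?J = "path_ideal k" and ?a = "A (Suc (Suc k))" and ?b = "B (Suc (Suc k))"
  let ?\<alpha> = "A (Suc k)" and ?\<beta> = "B (Suc k)" and ?T = "div_indet (p (Suc (Suc k)))"
  note J = ideal_path_ideal[of k]
  have T: "?T f \<in> ?J" if "f \<in> ?J" for f
    using that Suc.prems(1) by (intro path_ideal_div_indet[of _ "Suc (Suc k)"]) auto
  have T': "div_indet (q (Suc (Suc k))) f \<in> ?J" if "f \<in> ?J" for f
    using that Suc.prems(1) by (intro path_ideal_div_indet[of _ "Suc (Suc k)"]) auto
  obtain w where "?a * y - (?\<alpha> * ?b - ?\<beta> * ?a) * w \<in> ?J"
    using Suc.prems(2) unfolding path_ideal_Suc minor_def by blast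
  moreover define c where "c = ?a * y - ?\<alpha> * ?b * w + ?a * (?\<beta> * w)"
  moreover have "?a * y - (?\<alpha> * ?b - ?\<beta> * ?a) * w = c" by (simp add: c_def algebra_simps)
  ultimately have c: "c \<in> ?J" by simp
  have "free_of (p (Suc (Suc k))) (?\<alpha> * ?b)"
    using Suc.prems(1) p_neq[of "Suc (Suc k)" "Suc k"] disjoint[of "Suc (Suc k)" "Suc (Suc k)"]
    by (intro free_of_mult free_of_indet) auto
  then have Tab: "?T (?\<alpha> * ?b * w) = ?\<alpha> * ?b * ?T w" by (simp only: free_of_def)
  \<comment> \<open>The part of \<open>w\<close> not divisible by a = A_{k+2}. Eliminating
    \<open>y\<close> between \<open>c\<close> and its quotient \<open>d\<close> leaves \<alpha> b E,
    from which the induction hypothesis removes \<alpha> and division by the new variable b removes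
    b.\<close>
  define E where "E = w - ?a * ?T w"
  define d where "d = ?T c"
  have d: "d = y - ?\<alpha> * ?b * ?T w + ?\<beta> * w"
    unfolding d_def c_def by (simp only: div_indet_add div_indet_diff div_indet_indet_mult Tab)
  have "c - ?a * d = - (?\<alpha> * (?b * E))" unfolding d c_def E_def by (simp add: algebra_simps)
  moreover have "c - ?a * d \<in> ?J" unfolding d_def using c T[OF c] by (intro ideal_diff ideal_mult J)
  ultimately have "- (?\<alpha> * (?b * E)) \<in> ?J" by (simp only:)
  then have "?\<alpha> * (?b * E) \<in> ?J" by (drule_tac ideal_neg[OF J]) (simp only: minus_minus)
  then have "?b * E \<in> ?J" by (rule Suc.IH[OF Suc_lessD[OF Suc.prems(1)]])
  from T'[OF this] have E: "E \<in> ?J" by simp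
  have "?a * (y - (?\<alpha> * ?b - ?\<beta> * ?a) * ?T w) = c + (?\<alpha> * ?b - ?\<beta> * ?a) * E"
    by (simp add: c_def E_def algebra_simps)
  also have "\<dots> \<in> ?J" using c E by (intro ideal_add ideal_mult J)
  finally have "y - (?\<alpha> * ?b - ?\<beta> * ?a) * ?T w \<in> ?J" by (drule_tac T) (simp only: div_indet_indet_mult)
  then show ?case unfolding path_ideal_Suc minor_def by blast
qed

text \<open>The minor is linear in the new variable \<open>B (Suc (Suc k))\<close>, with leading
  coefficient \<open>A (Suc k)\<close> regular modulo the path ideal.\<close>

lemma regular_minor:
  assumes k: "Suc (Suc k) < n" and y: "minor (Suc k) (Suc (Suc k)) * y \<in> path_ideal k"
  shows "y \<in> path_ideal k"
proof (rule regular_linear_form[OF ideal_path_ideal])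
  show "(A (Suc k) * B (Suc (Suc k)) - B (Suc k) * A (Suc (Suc k))) * y \<in> path_ideal k"
    using y by (simp only: minor_def)
  show "div_indet (q (Suc (Suc k))) f \<in> path_ideal k" if "f \<in> path_ideal k" for f
    using that k by (intro path_ideal_div_indet[of _ "Suc (Suc k)"]) auto
  show "free_of (q (Suc (Suc k))) (A (Suc k))"
    by (rule free_of_indet) (use k disjoint[of "Suc k" "Suc (Suc k)"] in auto)
  show "free_of (q (Suc (Suc k))) (B (Suc k) * A (Suc (Suc k)))"
    using k q_neq[of "Suc (Suc k)" "Suc k"] disjoint[of "Suc (Suc k)" "Suc (Suc k)"]
    by (intro free_of_mult free_of_indet) auto
  show "f \<in> path_ideal k" if "A (Suc k) * f \<in> path_ideal k" for f
    by (rule regular_A[OF Suc_lessD[OF k] that])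
qed

lemma path_ideal_subset_irrelevant: "path_ideal k \<subseteq> irrelevant_ideal"
  unfolding path_ideal_def
proof (rule self_module.span_minimal)
  show ideal: "ideal (irrelevant_ideal :: ('x, 'k) mpoly set)" by (simp add: irrelevant_ideal_def)
  have "indet x \<in> (irrelevant_ideal :: ('x, 'k) mpoly set)" for x
    unfolding irrelevant_ideal_def by (intro self_module.span_base) simp
  then show "{A 0, B 0} \<union> (\<lambda>i. minor (Suc i) (Suc (Suc i))) ` {..<k} \<subseteq> irrelevant_ideal"
    using ideal by (auto simp: minor_def intro!: ideal_diff ideal_mult')
qed

lemma one_notin_irrelevant: "1 \<notin> (irrelevant_ideal :: ('x, 'k) mpoly set)"
  by (simp add: irrelevant_ideal_iff)

section \<open>The ideal of the cycle with its chord, and its regularity\<close>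

definition chord_binomial :: "nat \<Rightarrow> ('x, 'k) mpoly" where
  "chord_binomial k = A 0 * A k - B 0 * B k"

definition cycle_ideal :: "nat \<Rightarrow> ('x, 'k) mpoly set" where
  "cycle_ideal k =
     ideal_of ((\<lambda>i. minor i (Suc i)) ` {..<n - 1} \<union> {minor (n - 1) 0, chord_binomial k})"

lemma ideal_cycle_ideal: "ideal (cycle_ideal k)"
  by (simp add: cycle_ideal_def)

lemma minor_in_cycle_ideal: "i < n - 1 \<Longrightarrow> minor i (Suc i) \<in> cycle_ideal k"
  unfolding cycle_ideal_def by (intro self_module.span_base) blast

lemma chord_in_cycle_ideal: "chord_binomial k \<in> cycle_ideal k"
  unfolding cycle_ideal_def by (intro self_module.span_base) blast

lemma graded_cycle_ideal: "graded_ideal (cycle_ideal k)"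
  unfolding cycle_ideal_def
proof (rule graded_ideal_of)
  have chord: "chord_binomial k \<in> graded_part 2"
    unfolding chord_binomial_def
    using graded_part_mult[OF graded_part_indet graded_part_indet] by (intro graded_part_diff) auto
  fix h assume "h \<in> (\<lambda>i. minor i (Suc i)) ` {..<n - 1} \<union> {minor (n - 1) 0, chord_binomial k}"
  then have "h \<in> graded_part 2" using graded_minor chord by auto
  then show "\<exists>d. h \<in> graded_part d" by (rule exI)
qed

text \<open>Each term of a generator at the vertex 0, the chord included, contains A_0 or B_0. The
  remaining edges form the path 1, ..., n - 1 with its n - 2 minors.\<close>

lemma cycle_ideal_subset_path_ideal:
  assumes "3 \<le> n"
  shows "cycle_ideal k \<subseteq> path_ideal (n - 2)"
  unfolding cycle_ideal_def
proof (rule self_module.span_minimal[OF _ ideal_path_ideal], rule subsetI)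
  let ?J = "path_ideal (n - 2)"
  note J = ideal_path_ideal[of "n - 2"]
  have A0: "A 0 * f \<in> ?J" and B0: "B 0 * f \<in> ?J" for f
    unfolding path_ideal_def by (rule ideal_mult'; auto intro: self_module.span_base)+
  fix h assume "h \<in> (\<lambda>i. minor i (Suc i)) ` {..<n - 1} \<union> {minor (n - 1) 0, chord_binomial k}"
  then consider i where "i < n - 1" "h = minor i (Suc i)" | "h = minor (n - 1) 0" | "h = chord_binomial k"
    by auto
  then show "h \<in> ?J"
  proof cases
    case (1 i)
    show ?thesis
    proof (cases i)
      case 0
      show ?thesis unfolding 1 0 minor_def by (rule ideal_diff[OF J A0 B0])
    next
      case (Suc i')
      then have "i' < n - 2" using 1 by simp
      then show ?thesis unfolding 1 Suc path_ideal_def by (intro self_module.span_base) blast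
    qed
  next
    case 2
    have "h = B 0 * A (n - 1) - A 0 * B (n - 1)" by (simp add: 2 minor_def mult.commute)
    then show ?thesis by (simp only: ideal_diff[OF J B0 A0])
  next
    case 3
    show ?thesis unfolding 3 chord_binomial_def by (rule ideal_diff[OF J A0 B0])
  qed
qed

theorem reg_cycle_ideal_ge:
  assumes n: "3 \<le> n"
  shows "ereal (real (n - 2)) \<le> reg_quotient (cycle_ideal k)"
proof -
  let ?I = "cycle_ideal k"
  define s where "s = (SOME s. \<exists>e D. minimal_graded_free_resolution ?I s e D)"
  have "?I \<subseteq> irrelevant_ideal"
    using cycle_ideal_subset_path_ideal[OF n] path_ideal_subset_irrelevant by (rule subset_trans)
  from ex_minimal_graded_free_resolution[OF graded_cycle_ideal this]
  have "\<exists>e D. minimal_graded_free_resolution ?I s e D" unfolding s_def by (rule someI_ex)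
  then obtain e D where res: "minimal_graded_free_resolution ?I s e D" by blast
  let ?r = "n - 2"
  have "\<exists>l<length (s ?r). s ?r ! l \<ge> 2 * int ?r"
  proof (rule resolution_degree_bound[OF res ideal_cycle_ideal graded_path_ideal])
    fix i assume i: "i < ?r"
    then have i': "Suc i < n - 1" "Suc (Suc i) < n" by auto
    show "minor (Suc i) (Suc (Suc i)) \<in> ?I" by (rule minor_in_cycle_ideal[OF i'(1)])
    show "minor (Suc i) (Suc (Suc i)) \<in> graded_part 2" by (rule graded_minor)
    show "x \<in> path_ideal (Suc i) \<longleftrightarrow> (\<exists>y. x - minor (Suc i) (Suc (Suc i)) * y \<in> path_ideal i)" for x
      by (rule path_ideal_Suc)
    show "x \<in> path_ideal i" if "minor (Suc i) (Suc (Suc i)) * x \<in> path_ideal i" for x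
      by (rule regular_minor[OF i'(2) that])
  next
    show "?I \<subseteq> path_ideal ?r" by (rule cycle_ideal_subset_path_ideal[OF n])
    show "1 \<notin> path_ideal ?r" using path_ideal_subset_irrelevant one_notin_irrelevant by blast
  qed
  then obtain l where l: "l < length (s ?r)" "s ?r ! l \<ge> 2 * int ?r" by blast
  have "graded_betti ?I ?r (s ?r ! l) \<noteq> 0"
    unfolding graded_betti_def s_def[symmetric] using nth_mem[OF l(1)] by (simp add: count_list_0_iff)
  then have "ereal (real_of_int (s ?r ! l - int ?r)) \<le> reg_quotient ?I"
    unfolding reg_quotient_def by (intro Sup_upper) blast
  moreover have "ereal (real ?r) \<le> ereal (real_of_int (s ?r ! l - int ?r))" using l(2) by simp
  ultimately show ?thesis by (rule order_trans[rotated])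
qed

section \<open>The prime ideal of the rank one locus\<close>

lemma sum_variables: "(\<Sum>x\<in>UNIV. h x) = (\<Sum>i<n. h (p i)) + (\<Sum>i<n. h (q i))"
  for h :: "'x \<Rightarrow> 'c :: comm_monoid_add"
proof -
  have "p ` {..<n} \<inter> q ` {..<n} = {}" using disjoint by blast
  then have "sum h (p ` {..<n} \<union> q ` {..<n}) = sum h (p ` {..<n}) + sum h (q ` {..<n})"
    by (intro sum.union_disjoint) auto
  then show ?thesis
    by (simp only: cover[symmetric] sum.reindex[OF inj_p] sum.reindex[OF inj_q] o_def)
qed

definition vertex :: "'x \<Rightarrow> nat" where
  "vertex x = (THE i. i < n \<and> (x = p i \<or> x = q i))"

lemma vertex_p: "i < n \<Longrightarrow> vertex (p i) = i"
  unfolding vertex_def using p_neq disjoint by (intro the_equality) blast+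

lemma vertex_q: "i < n \<Longrightarrow> vertex (q i) = i"
  unfolding vertex_def using q_neq disjoint by (intro the_equality) (blast, metis)

lemma p_eq_iff: "i < n \<Longrightarrow> j < n \<Longrightarrow> p i = p j \<longleftrightarrow> i = j"
  using p_neq by blast

lemma q_eq_iff: "i < n \<Longrightarrow> j < n \<Longrightarrow> q i = q j \<longleftrightarrow> i = j"
  using q_neq by blast

lemma p_neq_q: "i < n \<Longrightarrow> j < n \<Longrightarrow> p i = q j \<longleftrightarrow> False"
  using disjoint by blast

lemma q_neq_p: "i < n \<Longrightarrow> j < n \<Longrightarrow> q i = p j \<longleftrightarrow> False"
  using disjoint by (simp add: eq_commute)

lemma q_notin: "i < n \<Longrightarrow> q i \<notin> p ` {..<n}"
  using disjoint by force

text \<open>The generic point \<open>A\<^sub>i = \<lambda>\<^sub>i \<sigma>\<close>, \<open>B\<^sub>i = \<lambda>\<^sub>i\<close> for \<open>i > 0\<close>, \<open>A\<^sub>0 = B\<^sub>0 = 0\<close>, where \<open>\<sigma>\<close> is the variable with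
  index 0 and \<open>\<lambda>\<^sub>i\<close> the one with index \<open>i + 1\<close>.\<close>

definition weight :: "'x \<Rightarrow> nat \<Rightarrow>\<^sub>0 nat" where
  "weight x = single (Suc (vertex x)) 1 + (if x \<in> p ` {..<n} then single 0 1 else 0)"

definition generic_point :: "'x \<Rightarrow> 'k target" where
  "generic_point x = (if vertex x = 0 then 0 else single (weight x) 1)"

text \<open>The exponent of the image of the monomial \<open>m\<close>: the nonzero coordinates of
  the generic point are monomials, so evaluation maps surviving monomials to monomials.\<close>

definition total_weight :: "('x \<Rightarrow>\<^sub>0 nat) \<Rightarrow> nat \<Rightarrow>\<^sub>0 nat" where
  "total_weight m = (\<Sum>x\<in>UNIV. \<Sum>i<lookup m x. weight x)"

lemma lookup_total_weight: "lookup (total_weight m) y = (\<Sum>x\<in>UNIV. lookup m x * lookup (weight x) y)"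
  unfolding total_weight_def lookup_sum by simp

lemma total_weight_add: "total_weight (m + m') = total_weight m + total_weight m'"
  by (rule poly_mapping_eqI) (simp add: lookup_total_weight lookup_add distrib_right sum.distrib)

lemma total_weight_single: "total_weight (single x 1) = weight x"
proof (rule poly_mapping_eqI)
  fix y
  have "(\<Sum>z\<in>UNIV. lookup (single x 1) z * lookup (weight z) y) = (\<Sum>z\<in>UNIV. if z = x then lookup (weight z) y else 0)"
    by (intro sum.cong) (auto simp: lookup_single when_def)
  then show "lookup (total_weight (single x 1)) y = lookup (weight x) y"
    by (simp add: lookup_total_weight)
qed

text \<open>The weight thus records the degree at every vertex and, in its entry at index 0, the
  total number of A-variables.\<close>

lemma lookup_total_weight_Suc:
  assumes "i < n"
  shows "lookup (total_weight m) (Suc i) = lookup m (p i) + lookup m (q i)"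
proof -
  have "lookup (weight (p j)) (Suc i) = (if j = i then 1 else 0)"
    "lookup (weight (q j)) (Suc i) = (if j = i then 1 else 0)" if "j < n" for j
    using that by (auto simp: weight_def lookup_add lookup_single vertex_p vertex_q)
  then have "(\<Sum>j<n. lookup m (p j) * lookup (weight (p j)) (Suc i)) = (\<Sum>j<n. if j = i then lookup m (p j) else 0)"
    "(\<Sum>j<n. lookup m (q j) * lookup (weight (q j)) (Suc i)) = (\<Sum>j<n. if j = i then lookup m (q j) else 0)"
    by (intro sum.cong; auto)+
  then show ?thesis using assms by (simp add: lookup_total_weight sum_variables)
qed

lemma lookup_total_weight_0: "lookup (total_weight m) 0 = (\<Sum>i<n. lookup m (p i))"
proof -
  have "lookup (weight (p j)) 0 = 1" "lookup (weight (q j)) 0 = 0" if "j < n" for j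
    using that q_notin[OF that] by (auto simp: weight_def lookup_add lookup_single)
  then show ?thesis by (simp add: lookup_total_weight sum_variables)
qed

definition base_free :: "('x \<Rightarrow>\<^sub>0 nat) \<Rightarrow> bool" where
  "base_free m \<longleftrightarrow> lookup m (p 0) = 0 \<and> lookup m (q 0) = 0"

lemma single_power: "single v (1 :: 'k) ^ e = single (\<Sum>i<e. v) 1" for v :: "nat \<Rightarrow>\<^sub>0 nat"
  by (induction e) (simp_all add: mult_single add.commute del: sum_constant)

lemma prod_single: "finite S \<Longrightarrow> (\<Prod>x\<in>S. single (v x) (1 :: 'k)) = single (sum v S) 1"
  for v :: "'x \<Rightarrow> nat \<Rightarrow>\<^sub>0 nat"
  by (induction S rule: finite_induct) (simp_all add: mult_single)

lemma monom_eval_generic_point: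
  assumes "0 < n"
  shows "monom_eval generic_point m = (if base_free m then single (total_weight m) 1 else 0)"
proof (cases "base_free m")
  case True
  have "generic_point x ^ lookup m x = single (\<Sum>i<lookup m x. weight x) 1" for x
  proof (cases "vertex x = 0")
    case True
    have "x \<in> p ` {..<n} \<union> q ` {..<n}" using cover by blast
    then have "x = p 0 \<or> x = q 0" using True by (auto simp: vertex_p vertex_q)
    then have "lookup m x = 0" using \<open>base_free m\<close> by (auto simp: base_free_def)
    then show ?thesis by simp
  qed (simp add: generic_point_def single_power)
  then show ?thesis using True by (simp add: monom_eval_def prod_single total_weight_def)
next
  case False
  then obtain x where "lookup m x \<noteq> 0" "vertex x = 0"
    using vertex_p[OF assms] vertex_q[OF assms] by (auto simp: base_free_def)
  then have "generic_point x ^ lookup m x = 0" by (simp add: generic_point_def)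
  then have "(\<Prod>x\<in>UNIV. generic_point x ^ lookup m x) = 0" by (intro prod_zero) auto
  then show ?thesis using False by (simp add: monom_eval_def)
qed

text \<open>Monomials with the same image differ only in how the A-variables are distributed. If
  vertex i has too many and j too few, replacing A_i B_j by B_i A_j changes the monomial by a
  multiple of a minor and brings it closer to the target.\<close>

lemma monomial_swap:
  assumes Q: "ideal Q" and minors: "\<And>i j. 0 < i \<Longrightarrow> i < n \<Longrightarrow> 0 < j \<Longrightarrow> j < n \<Longrightarrow> minor i j \<in> Q"
    and "base_free m" "base_free m'" "total_weight m = total_weight m'"
  shows "single m 1 - single m' (1 :: 'k) \<in> Q"
  using assms(3-)
\<comment> \<open>The measure is the total surplus of A-variables: truncated subtraction ignores
  vertices with a deficit.\<close>
proof (induction "\<Sum>i<n. lookup m (p i) - lookup m' (p i)" arbitrary: m rule: less_induct)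
  case less
  have deg: "lookup m (p i) + lookup m (q i) = lookup m' (p i) + lookup m' (q i)" if "i < n" for i
    using less.prems(3) lookup_total_weight_Suc[OF that] by metis
  have sums: "(\<Sum>i<n. lookup m (p i)) = (\<Sum>i<n. lookup m' (p i))"
    using less.prems(3) lookup_total_weight_0 by metis
  show ?case
  proof (cases "\<forall>i<n. lookup m (p i) \<le> lookup m' (p i)")
    case True
    have eq: "lookup m (p i) = lookup m' (p i)" if "i < n" for i
    proof (rule ccontr)
      assume "lookup m (p i) \<noteq> lookup m' (p i)"
      then have "(\<Sum>i<n. lookup m (p i)) < (\<Sum>i<n. lookup m' (p i))"
        using True that by (intro sum_strict_mono_ex1 bexI[of _ i]) (auto simp: le_neq_implies_less)
      then show False using sums by simp
    qed
    have "m = m'"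
    proof (rule poly_mapping_eqI)
      fix x
      have "x \<in> p ` {..<n} \<union> q ` {..<n}" using cover by blast
      then show "lookup m x = lookup m' x" using eq deg by auto
    qed
    then show ?thesis by (simp add: ideal_zero[OF Q])
  next
    case False
    then obtain i where i: "i < n" "lookup m' (p i) < lookup m (p i)" by (auto simp: not_le)
    have "\<exists>j<n. lookup m (p j) < lookup m' (p j)"
    proof (rule ccontr)
      assume "\<not> ?thesis"
      then have "lookup m' (p j) \<le> lookup m (p j)" if "j < n" for j using that leI by blast
      then have "(\<Sum>i<n. lookup m' (p i)) < (\<Sum>i<n. lookup m (p i))"
        using i by (intro sum_strict_mono_ex1 bexI[of _ i]) simp_all
      then show False using sums by simp
    qed
    then obtain j where j: "j < n" "lookup m (p j) < lookup m' (p j)" by blast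
    \<comment> \<open>Neither monomial contains a variable of the vertex 0, so it has neither
      surplus nor deficit; only minors away from 0 are used.\<close>
    have pos: "0 < i" "0 < j" using i j less.prems(1,2) by (auto simp: base_free_def intro: gr0I)
    have ij: "i \<noteq> j" using i j by auto
    obtain m1 where m1: "m = single (p i) 1 + m1" using indet_factor[of m "p i"] i(2) by auto
    \<comment> \<open>Both monomials have the same degree at \<open>j\<close>, so a deficit of A_j
      forces a factor B_j.\<close>
    have "0 < lookup m1 (q j)"
      using deg[OF j(1)] j(2) disjoint[OF i(1) j(1)] by (auto simp: m1 lookup_add lookup_single)
    then obtain M where m1M: "m1 = single (q j) 1 + M" using indet_factor[of m1 "q j"] by auto
    have m: "m = single (p i) 1 + (single (q j) 1 + M)" by (simp only: m1 m1M)
    define m2 where "m2 = single (q i) 1 + (single (p j) 1 + M)"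
    have neq: "p i \<noteq> p j" "p j \<noteq> p i" "q i \<noteq> q j" "q j \<noteq> q i"
      using p_neq[OF i(1) j(1) ij] q_neq[OF i(1) j(1) ij] by auto
    have lk: "lookup m2 (p l) = lookup M (p l) + (if l = j then 1 else 0)"
      "lookup m2 (q l) = lookup M (q l) + (if l = i then 1 else 0)"
      "lookup m (p l) = lookup M (p l) + (if l = i then 1 else 0)"
      "lookup m (q l) = lookup M (q l) + (if l = j then 1 else 0)" if "l < n" for l
      using that i(1) j(1)
      by (simp_all add: m m2_def lookup_add lookup_single when_def p_eq_iff q_eq_iff p_neq_q q_neq_p eq_commute)
    have bf2: "base_free m2"
      using less.prems(1) lk[of 0] pos i(1) by (auto simp: base_free_def split: if_splits)
    have "weight (q i) + weight (p j) = weight (p i) + weight (q j)"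
      using i(1) j(1) q_notin by (simp add: weight_def vertex_p vertex_q add_ac)
    then have "total_weight m2 = total_weight m"
      by (simp only: m m2_def total_weight_add total_weight_single add.assoc[symmetric])
    then have tw2: "total_weight m2 = total_weight m'" using less.prems(3) by simp
    have "(\<Sum>l<n. lookup m2 (p l) - lookup m' (p l)) < (\<Sum>l<n. lookup m (p l) - lookup m' (p l))"
    proof (rule sum_strict_mono_ex1)
      show "\<forall>l\<in>{..<n}. lookup m2 (p l) - lookup m' (p l) \<le> lookup m (p l) - lookup m' (p l)"
        using lk j(2) ij by auto
      show "\<exists>l\<in>{..<n}. lookup m2 (p l) - lookup m' (p l) < lookup m (p l) - lookup m' (p l)"
        using lk(1,3)[OF i(1)] i ij by (intro bexI[of _ i]) auto
    qed simp
    from less.hyps[OF this bf2 less.prems(2) tw2] have "single m2 1 - single m' (1 :: 'k) \<in> Q" .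
    moreover have "single m 1 - single m2 (1 :: 'k) \<in> Q"
    proof -
      have "single m 1 - single m2 1 = single M 1 * minor i j"
        by (simp add: m m2_def minor_def indet_def mult_single right_diff_distrib add_ac)
      then show ?thesis using minors[OF pos(1) i(1) pos(2) j(1)] by (simp add: ideal_mult[OF Q])
    qed
    ultimately show ?thesis using ideal_diff_trans[OF Q] by blast
  qed
qed

text \<open>Modulo \<open>Q\<close>, monomials containing a variable of 0 vanish, and any others
  with equal image agree. Keeping one representative per image leaves coefficient sums that are the
  coefficients of the evaluation, hence 0. \<open>Q\<close> is arbitrary so that a colon ideal can
  be inserted directly.\<close>

theorem generic_point_kernel_subset:
  assumes n: "0 < n" and Q: "ideal Q" and base: "A 0 \<in> Q" "B 0 \<in> Q"
    and minors: "\<And>i j. 0 < i \<Longrightarrow> i < n \<Longrightarrow> 0 < j \<Longrightarrow> j < n \<Longrightarrow> minor i j \<in> Q"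
    and f: "poly_eval generic_point f = 0"
  shows "f \<in> Q"
proof -
  define U where "U = {m \<in> keys f. base_free m}"
  have finU: "finite U" by (simp add: U_def)
  define R where "R \<gamma> = (SOME m. m \<in> U \<and> total_weight m = \<gamma>)" for \<gamma>
  have R: "R (total_weight m) \<in> U" "total_weight (R (total_weight m)) = total_weight m" if "m \<in> U" for m
  proof -
    have "R (total_weight m) \<in> U \<and> total_weight (R (total_weight m)) = total_weight m"
      unfolding R_def by (rule someI[of _ m]) (simp add: that)
    then show "R (total_weight m) \<in> U" "total_weight (R (total_weight m)) = total_weight m" by simp_all
  qed
  have scale: "single m c - single m' c = single 0 c * (single m 1 - single m' (1 :: 'k))"
    for m m' :: "'x \<Rightarrow>\<^sub>0 nat" and c
    by (simp add: mult_single right_diff_distrib)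
  have "single m (lookup f m) \<in> Q" if "m \<in> keys f - U" for m
  proof -
    have "lookup m (p 0) > 0 \<or> lookup m (q 0) > 0" using that by (auto simp: U_def base_free_def)
    moreover define x where "x = (if lookup m (p 0) > 0 then p 0 else q 0)"
    ultimately have x: "x = p 0 \<or> x = q 0" "lookup m x > 0" by auto
    from x(2) obtain m' where m': "m = single x 1 + m'" by (rule indet_factor)
    have "single m (lookup f m) = single m' (lookup f m) * indet x"
      by (simp add: m' indet_def mult_single add.commute)
    moreover have "indet x \<in> Q" using x(1) base by auto
    ultimately show ?thesis by (simp add: ideal_mult[OF Q])
  qed
  then have rest: "(\<Sum>m\<in>keys f - U. single m (lookup f m)) \<in> Q" by (intro ideal_sum[OF Q])
  have swapped: "(\<Sum>m\<in>U. single m (lookup f m) - single (R (total_weight m)) (lookup f m)) \<in> Q"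
  proof (rule ideal_sum[OF Q])
    fix m assume m: "m \<in> U"
    have "single m 1 - single (R (total_weight m)) (1 :: 'k) \<in> Q"
      using m R[OF m] by (intro monomial_swap[OF Q minors]) (auto simp: U_def)
    then show "single m (lookup f m) - single (R (total_weight m)) (lookup f m) \<in> Q"
      unfolding scale[of m "lookup f m"]
      by (rule ideal_mult[OF Q])
  qed
  have "(\<Sum>m\<in>U. single (R (total_weight m)) (lookup f m)) = 0"
  proof -
    have "(\<Sum>m\<in>U. single (R (total_weight m)) (lookup f m)) =
        (\<Sum>\<gamma>\<in>total_weight ` U. \<Sum>m | m \<in> U \<and> total_weight m = \<gamma>. single (R (total_weight m)) (lookup f m))"
      by (rule sum.image_gen[OF finU])
    also have "\<dots> = (\<Sum>\<gamma>\<in>total_weight ` U. 0)"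
    proof (rule sum.cong[OF refl])
      fix \<gamma> assume "\<gamma> \<in> total_weight ` U"
      have single_sum: "(\<Sum>m\<in>S. single (R \<gamma>) (c m)) = single (R \<gamma>) (\<Sum>m\<in>S. c m)" for S and c :: "_ \<Rightarrow> 'k"
        by (induction S rule: infinite_finite_induct) (simp_all add: single_add)
      have "0 = lookup (poly_eval generic_point f) \<gamma>" by (simp add: f)
      also have "\<dots> = (\<Sum>m\<in>keys f. if m \<in> U \<and> total_weight m = \<gamma> then lookup f m else 0)"
        unfolding poly_eval_def monom_eval_generic_point[OF n] lookup_sum
        by (intro sum.cong) (auto simp: U_def mult_single lookup_single when_def)
      also have "\<dots> = (\<Sum>m | m \<in> U \<and> total_weight m = \<gamma>. lookup f m)"
        by (subst sum.inter_filter[symmetric]) (auto simp: U_def intro: sum.cong)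
      finally have "(\<Sum>m | m \<in> U \<and> total_weight m = \<gamma>. lookup f m) = 0" by simp
      moreover have "(\<Sum>m | m \<in> U \<and> total_weight m = \<gamma>. single (R (total_weight m)) (lookup f m)) =
          (\<Sum>m | m \<in> U \<and> total_weight m = \<gamma>. single (R \<gamma>) (lookup f m))"
        by (intro sum.cong) auto
      ultimately show "(\<Sum>m | m \<in> U \<and> total_weight m = \<gamma>. single (R (total_weight m)) (lookup f m)) = 0"
        by (simp add: single_sum)
    qed
    finally show ?thesis by simp
  qed
  moreover have "f = (\<Sum>m\<in>keys f - U. single m (lookup f m)) + (\<Sum>m\<in>U. single m (lookup f m))"
    using sum.subset_diff[of U "keys f" "\<lambda>m. single m (lookup f m)"] by (simp add: U_def sum_monomials)
  ultimately have "f = (\<Sum>m\<in>keys f - U. single m (lookup f m)) +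
      (\<Sum>m\<in>U. single m (lookup f m) - single (R (total_weight m)) (lookup f m))"
    by (simp only: sum_subtractf diff_zero)
  then show ?thesis using ideal_add[OF Q rest swapped] by (simp only:)
qed

section \<open>The colon ideal of the witness\<close>

lemma interior_times_minor:
  assumes c: "\<And>l. c l = A l \<or> c l = B l" and "i < j" "j < n"
  shows "(\<Prod>l\<in>{i<..<j}. c l) * minor i j \<in> cycle_ideal k"
proof -
  have "(\<Prod>l\<in>{i<..<Suc (i + d)}. c l) * minor i (Suc (i + d)) \<in> cycle_ideal k" if "Suc (i + d) < n" for d
    using that
  proof (induction d)
    case 0
    have "{i<..<Suc (i + 0)} = {}" by auto
    moreover have "minor i (Suc i) \<in> cycle_ideal k" using 0 by (intro minor_in_cycle_ideal) simp
    ultimately show ?case by simp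
  next
    case (Suc d)
    define j where "j = Suc (i + d)"
    define P where "P = (\<Prod>l\<in>{i<..<j}. c l)"
    have jn: "j < n - 1" using Suc.prems by (simp add: j_def)
    have "{i<..<Suc j} = insert j {i<..<j}" by (auto simp: j_def)
    then have prod: "(\<Prod>l\<in>{i<..<Suc j}. c l) = c j * P" by (simp add: P_def)
    have IH: "P * minor i j \<in> cycle_ideal k"
      using Suc.IH Suc.prems by (simp add: P_def j_def)
    have step: "minor j (Suc j) \<in> cycle_ideal k" using jn by (rule minor_in_cycle_ideal)
    \<comment> \<open>Write [a, b] for \<open>minor a b\<close>. The relation A_j [i, j+1] = A_i
      [j, j+1] + A_{j+1} [i, j], and likewise with B, lets either variable of \<open>j\<close>
      reduce a long minor to an edge and a shorter minor.\<close>
    from c[of j] have "c j * P * minor i (Suc j) \<in> cycle_ideal k"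
    proof
      assume cj: "c j = A j"
      have "A j * P * minor i (Suc j) = (P * A i) * minor j (Suc j) + A (Suc j) * (P * minor i j)"
        by (simp add: minor_def algebra_simps)
      also have "\<dots> \<in> cycle_ideal k"
        by (rule ideal_add[OF ideal_cycle_ideal ideal_mult[OF ideal_cycle_ideal step] ideal_mult[OF ideal_cycle_ideal IH]])
      finally show ?thesis by (simp only: cj)
    next
      assume cj: "c j = B j"
      have "B j * P * minor i (Suc j) = (P * B i) * minor j (Suc j) + B (Suc j) * (P * minor i j)"
        by (simp add: minor_def algebra_simps)
      also have "\<dots> \<in> cycle_ideal k"
        by (rule ideal_add[OF ideal_cycle_ideal ideal_mult[OF ideal_cycle_ideal step] ideal_mult[OF ideal_cycle_ideal IH]])
      finally show ?thesis by (simp only: cj)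
    qed
    then show ?case by (simp add: prod j_def[symmetric])
  qed
  from this[of "j - Suc i"] show ?thesis using assms(2,3) by simp
qed

lemma product_times_minor:
  assumes c: "\<And>l. c l = A l \<or> c l = B l" and ij: "0 < i" "i < j" "j < n"
  shows "(\<Prod>l\<in>{1..n - 2}. c l) * minor i j \<in> cycle_ideal k"
proof -
  have "{i<..<j} \<subseteq> {1..n - 2}" using ij by auto
  then have "(\<Prod>l\<in>{1..n - 2}. c l) = (\<Prod>l\<in>{1..n - 2} - {i<..<j}. c l) * (\<Prod>l\<in>{i<..<j}. c l)"
    by (intro prod.subset_diff) auto
  then have "(\<Prod>l\<in>{1..n - 2}. c l) * minor i j =
      (\<Prod>l\<in>{1..n - 2} - {i<..<j}. c l) * ((\<Prod>l\<in>{i<..<j}. c l) * minor i j)"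
    by (simp only: mult.assoc)
  then show ?thesis
    using ideal_mult[OF ideal_cycle_ideal interior_times_minor[OF c ij(2,3)]] by (simp only:)
qed

text \<open>Modulo the path, a form in the variables of the vertices \<open>1, \<dots>, n - 2\<close> is annihilated by all
  minors once each of these vertices occurs. The first factor is annihilated by the variables of
  the vertex \<open>0\<close>: around the odd cycle through \<open>0, 1, \<dots>, k\<close> one gets \<open>A\<^sub>0A\<^sub>1A\<^sub>k = A\<^sub>1B\<^sub>0B\<^sub>k = B\<^sub>1A\<^sub>0B\<^sub>k\<close>.\<close>

definition witness :: "nat \<Rightarrow> ('x, 'k) mpoly" where
  "witness k = (A 1 * A k - B 1 * B k) * (\<Prod>l\<in>{2..n - 2} - {k}. A l)"

text \<open>Both products choose one variable at each of the vertices 1, ..., n - 2, so each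
  separately multiplies all minors away from 0 into the ideal.\<close>

lemma witness_alt:
  assumes "2 \<le> k" "k \<le> n - 2"
  shows "witness k = (\<Prod>l\<in>{1..n - 2}. A l) - (\<Prod>l\<in>{1..n - 2}. if l = 1 \<or> l = k then B l else A l)"
proof -
  have set: "{1..n - 2} = insert 1 (insert k ({2..n - 2} - {k}))" using assms by auto
  have prod: "(\<Prod>l\<in>{1..n - 2}. c l) = c 1 * (c k * (\<Prod>l\<in>{2..n - 2} - {k}. c l))" for c :: "nat \<Rightarrow> ('x, 'k) mpoly"
  proof -
    have "prod c (insert 1 (insert k ({2..n - 2} - {k}))) = c 1 * prod c (insert k ({2..n - 2} - {k}))"
      by (rule prod.insert) (use assms in auto)
    also have "prod c (insert k ({2..n - 2} - {k})) = c k * prod c ({2..n - 2} - {k})"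
      by (rule prod.insert) auto
    finally show ?thesis unfolding set .
  qed
  have "(\<Prod>l\<in>{2..n - 2} - {k}. if l = 1 \<or> l = k then B l else A l) = (\<Prod>l\<in>{2..n - 2} - {k}. A l)"
    by (intro prod.cong) auto
  then show ?thesis unfolding prod witness_def by (simp add: left_diff_distrib mult.assoc)
qed

lemma minor_witness:
  assumes k: "2 \<le> k" "k \<le> n - 2" and ij: "0 < i" "i < n" "0 < j" "j < n"
  shows "minor i j * witness k \<in> cycle_ideal k"
proof -
  note I = ideal_cycle_ideal[of k]
  have less: "minor i j * witness k \<in> cycle_ideal k" if "0 < i" "i < j" "j < n" for i j
  proof -
    have "(\<Prod>l\<in>{1..n - 2}. A l) * minor i j -
        (\<Prod>l\<in>{1..n - 2}. if l = 1 \<or> l = k then B l else A l) * minor i j \<in> cycle_ideal k"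
      by (rule ideal_diff[OF I product_times_minor product_times_minor]) (use that in auto)
    then show ?thesis by (simp only: witness_alt[OF k] mult.commute[of "minor i j"] left_diff_distrib)
  qed
  consider "i < j" | "i = j" | "j < i" by linarith
  then show ?thesis
  proof cases
    case 1
    then show ?thesis using ij by (intro less) auto
  next
    case 2
    then show ?thesis by (simp add: minor_def mult.commute ideal_zero[OF I])
  next
    case 3
    have "minor i j * witness k = - (minor j i * witness k)" by (simp add: minor_def algebra_simps)
    also have "\<dots> \<in> cycle_ideal k" by (rule ideal_neg[OF I less]) (use 3 ij in auto)
    finally show ?thesis .
  qed
qed

text \<open>Only the edge from 0 to 1 and the chord are combined, so as to cancel the mixed term;
  the product over the other vertices is carried along.\<close>

lemma base_witness:
  assumes "2 \<le> n"
  shows "A 0 * witness k \<in> cycle_ideal k" "B 0 * witness k \<in> cycle_ideal k"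
proof -
  let ?P = "\<Prod>l\<in>{2..n - 2} - {k}. A l"
  note I = ideal_cycle_ideal[of k]
  have m: "minor 0 1 \<in> cycle_ideal k" using assms minor_in_cycle_ideal[of 0 k] by simp
  note ch = chord_in_cycle_ideal[of k]
  have "A 0 * witness k = (?P * A 1) * chord_binomial k - (?P * B k) * minor 0 1"
    by (simp add: witness_def chord_binomial_def minor_def algebra_simps)
  also have "\<dots> \<in> cycle_ideal k"
    by (rule ideal_diff[OF I ideal_mult[OF I ch] ideal_mult[OF I m]])
  finally show "A 0 * witness k \<in> cycle_ideal k" .
  have "B 0 * witness k = (?P * B 1) * chord_binomial k - (?P * A k) * minor 0 1"
    by (simp add: witness_def chord_binomial_def minor_def algebra_simps)
  also have "\<dots> \<in> cycle_ideal k"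
    by (rule ideal_diff[OF I ideal_mult[OF I ch] ideal_mult[OF I m]])
  finally show "B 0 * witness k \<in> cycle_ideal k" .
qed

lemma graded_witness:
  assumes "2 \<le> k" "k \<le> n - 2"
  shows "witness k \<in> graded_part (int (n - 2))"
proof -
  have "card ({2..n - 2} - {k}) = n - 4" using assms by simp
  moreover have "(\<Prod>l\<in>{2..n - 2} - {k}. A l) \<in> graded_part (int (card ({2..n - 2} - {k})))"
    by (rule graded_part_prod) (simp_all add: graded_part_indet)
  moreover have "A 1 * A k - B 1 * B k \<in> graded_part 2"
    using graded_part_mult[OF graded_part_indet graded_part_indet] by (intro graded_part_diff) auto
  ultimately have "witness k \<in> graded_part (2 + int (n - 4))"
    unfolding witness_def by (intro graded_part_mult) simp_all
  \<comment> \<open>The bounds on \<open>k\<close> force n >= 4, so the truncated subtraction is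
    exact.\<close>
  moreover have "2 + int (n - 4) = int (n - 2)" using assms by simp
  ultimately show ?thesis by simp
qed

lemma generic_point_A: "0 < i \<Longrightarrow> i < n \<Longrightarrow> generic_point (p i) = single (single (Suc i) 1 + single 0 1) 1"
  by (simp add: generic_point_def weight_def vertex_p)

lemma generic_point_B: "0 < i \<Longrightarrow> i < n \<Longrightarrow> generic_point (q i) = single (single (Suc i) 1) 1"
  using q_notin by (simp add: generic_point_def weight_def vertex_q)

lemma eval_witness:
  assumes k: "2 \<le> k" "k \<le> n - 2"
  shows "poly_eval generic_point (witness k) \<noteq> 0"
proof -
  \<comment> \<open>The images of A_1 A_k and B_1 B_k. They differ in the exponent of the common
    parameter with index 0, so their difference cannot vanish.\<close>
  let ?a = "single (Suc 1) 1 + single 0 1 + (single (Suc k) 1 + single 0 1) :: nat \<Rightarrow>\<^sub>0 nat"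
  let ?b = "single (Suc 1) 1 + single (Suc k) 1 :: nat \<Rightarrow>\<^sub>0 nat"
  have k': "0 < k" "k < n" "1 < n" using k by auto
  have "lookup ?a 0 \<noteq> lookup ?b 0" by (simp add: lookup_add lookup_single)
  then have ab: "?a \<noteq> ?b" by (rule contrapos_nn) (rule arg_cong)
  have "poly_eval generic_point (A 1 * A k - B 1 * B k) = single ?a 1 - single ?b 1"
    using k' generic_point_A[of 1] generic_point_A[of k] generic_point_B[of 1] generic_point_B[of k]
    by (simp add: poly_eval_diff poly_eval_mult poly_eval_indet mult_single)
  moreover have "lookup (single ?a (1 :: 'k) - single ?b 1) ?a = 1"
    by (simp only: lookup_minus lookup_single_eq lookup_single_not_eq[OF ab[symmetric]] diff_zero)
  ultimately have "lookup (poly_eval generic_point (A 1 * A k - B 1 * B k)) ?a = 1" by (simp only:)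
  then have 1: "poly_eval generic_point (A 1 * A k - B 1 * B k) \<noteq> 0"
    by (rule contrapos_pn) (simp only: lookup_zero zero_neq_one not_False_eq_True)
  have "generic_point (p l) \<noteq> 0" if "l \<in> {2..n - 2} - {k}" for l
  proof -
    have "0 < l" "l < n" using that k' by auto
    then have "lookup (generic_point (p l)) (single (Suc l) 1 + single 0 1) = 1"
      by (simp only: generic_point_A lookup_single_eq)
    then show ?thesis by (rule contrapos_pn) (simp only: lookup_zero zero_neq_one not_False_eq_True)
  qed
  then have "poly_eval generic_point (\<Prod>l\<in>{2..n - 2} - {k}. A l) \<noteq> 0"
    by (simp add: poly_eval_prod poly_eval_indet)
  with 1 show ?thesis by (simp add: witness_def poly_eval_mult)
qed

lemma eval_cycle_ideal:
  assumes "2 \<le> n" "f \<in> cycle_ideal k"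
  shows "poly_eval generic_point f = 0"
proof -
  let ?K = "{f. poly_eval generic_point f = 0}"
  have K: "ideal ?K" using is_prime_ideal_poly_eval_kernel unfolding is_prime_ideal_def by (rule conjunct1)
  have 0: "generic_point (p 0) = 0" "generic_point (q 0) = 0"
    using assms(1) by (simp_all add: generic_point_def vertex_p vertex_q)
  have minor: "minor i (Suc i) \<in> ?K" if i: "i < n - 1" for i
  proof (cases "i = 0")
    case True
    then show ?thesis using 0 by (simp add: minor_def poly_eval_diff poly_eval_mult poly_eval_indet)
  next
    case False
    then have "generic_point (p i) * generic_point (q (Suc i)) = generic_point (q i) * generic_point (p (Suc i))"
      using i generic_point_A[of i] generic_point_B[of i] generic_point_A[of "Suc i"] generic_point_B[of "Suc i"]
      by (simp add: mult_single add_ac)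
    then show ?thesis by (simp add: minor_def poly_eval_diff poly_eval_mult poly_eval_indet)
  qed
  have "minor (n - 1) 0 \<in> ?K" "chord_binomial k \<in> ?K"
    using 0 by (simp_all add: minor_def chord_binomial_def poly_eval_diff poly_eval_mult poly_eval_indet)
  then have "(\<lambda>i. minor i (Suc i)) ` {..<n - 1} \<union> {minor (n - 1) 0, chord_binomial k} \<subseteq> ?K"
    using minor by blast
  then have "cycle_ideal k \<subseteq> ?K" unfolding cycle_ideal_def by (rule self_module.span_minimal[OF _ K])
  then show ?thesis using assms(2) by blast
qed

text \<open>If f times the witness lies in the ideal, it vanishes at the generic point, where the
  witness does not; hence f does. Conversely the colon ideal contains A_0, B_0 and all minors away
  from 0, hence the whole kernel. The same equation shows that the kernel is an associated
  prime.\<close>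

theorem v_number_cycle_ideal_le:
  assumes k: "2 \<le> k" "k \<le> n - 2"
  shows "v_number (cycle_ideal k) \<le> ereal (real (n - 2))"
proof -
  let ?K = "{f. poly_eval generic_point f = 0}"
  have n: "0 < n" "2 \<le> n" using k by auto
  have colon: "colon (cycle_ideal k) (witness k) = ?K"
  proof (intro Set.equalityI subsetI)
    fix f assume "f \<in> colon (cycle_ideal k) (witness k)"
    then have "poly_eval generic_point (f * witness k) = 0"
      by (rule_tac eval_cycle_ideal[OF n(2), of _ k]) (simp add: colon_def)
    then show "f \<in> ?K" using eval_witness[OF k] by (simp add: poly_eval_mult)
  next
    fix f assume "f \<in> ?K"
    then have "poly_eval generic_point f = 0" by simp
    from generic_point_kernel_subset[OF n(1) ideal_colon[OF ideal_cycle_ideal] _ _ _ this]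
    show "f \<in> colon (cycle_ideal k) (witness k)"
      using base_witness[OF n(2)] minor_witness[OF k] by (simp add: colon_def)
  qed
  have "?K \<in> Ass (cycle_ideal k)"
    unfolding Ass_def
    by (rule CollectI, rule conjI[OF is_prime_ideal_poly_eval_kernel], rule exI, rule colon[symmetric])
  then have "ereal (real (n - 2)) \<in> {ereal (real d) | d :: nat.
     \<exists>f\<in>graded_part (int d). \<exists>P\<in>Ass (cycle_ideal k). colon (cycle_ideal k) f = P}"
    by (intro CollectI exI[of _ "n - 2"] conjI refl bexI[OF _ graded_witness[OF k]] bexI[of _ ?K] colon)
  then show ?thesis unfolding v_number_def by (rule Inf_lower)
qed

end

section \<open>Even cycles with a chord\<close>

text \<open>Rotating the labels maps the cyclic edges to themselves, so one end of the chord may be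
  taken as vertex 0.\<close>

lemma cycle_graph_from_vertex:
  fixes C :: "'v :: finite set set"
  assumes "is_cycle_graph n C"
  shows "\<exists>w. bij_betw w {..<n} UNIV \<and> w 0 = u \<and> C = {{w i, w ((i + 1) mod n)} | i. i < n}"
proof -
  from assms obtain c where n: "3 \<le> n" and c: "bij_betw c {..<n} (UNIV :: 'v set)"
    and C: "C = {{c i, c ((i + 1) mod n)} | i. i < n}"
    unfolding is_cycle_graph_def by auto
  obtain i0 where i0: "i0 < n" "c i0 = u" using c unfolding bij_betw_def by (metis UNIV_I imageE lessThan_iff)
  define r where "r i = (i + i0) mod n" for i
  have r_less: "r i < n" for i using n by (simp add: r_def)
  have r_surj: "\<exists>i<n. r i = j" if "j < n" for j
  proof (intro exI conjI)
    \<comment> \<open>The preimage is j - i0 modulo n, with n - i0 added instead to stay within the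
      natural numbers.\<close>
    show "(j + (n - i0)) mod n < n" using n by simp
    have "r ((j + (n - i0)) mod n) = (j + (n - i0) + i0) mod n" by (simp only: r_def mod_add_left_eq)
    also have "\<dots> = j" using that i0(1) by simp
    finally show "r ((j + (n - i0)) mod n) = j" .
  qed
  have r_image: "r ` {..<n} = {..<n}" using r_less r_surj by force
  then have "inj_on r {..<n}" by (intro eq_card_imp_inj_on) simp_all
  then have r: "bij_betw r {..<n} {..<n}" using r_image by (simp add: bij_betw_def)
  have step: "r ((i + 1) mod n) = (r i + 1) mod n" for i
    by (simp add: r_def mod_simps add.commute add.left_commute)
  have "C = {{c (r i), c (r ((i + 1) mod n))} | i. i < n}"
  proof (intro Set.equalityI subsetI)
    fix e assume "e \<in> C"
    then obtain j where j: "j < n" "e = {c j, c ((j + 1) mod n)}" unfolding C by blast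
    obtain i where "i < n" "r i = j" using r_surj[OF j(1)] by blast
    then show "e \<in> {{c (r i), c (r ((i + 1) mod n))} | i. i < n}" using j(2) step[of i] by auto
  next
    fix e assume "e \<in> {{c (r i), c (r ((i + 1) mod n))} | i. i < n}"
    then obtain i where "e = {c (r i), c ((r i + 1) mod n)}" using step by auto
    then show "e \<in> C" unfolding C using r_less[of i] by blast
  qed
  moreover have "bij_betw (c \<circ> r) {..<n} UNIV" by (rule bij_betw_trans[OF r c])
  moreover have "c (r 0) = u" using i0 by (simp add: r_def)
  ultimately show ?thesis by (intro exI[of _ "c \<circ> r"]) simp
qed

text \<open>Colour by parity of the label: the closing edge is properly coloured because
  \<open>n\<close> is even, the chord because \<open>k\<close> is odd.\<close>

lemma bipartite_odd_chord:
  fixes w :: "nat \<Rightarrow> 'v :: finite"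
  assumes w: "bij_betw w {..<n} UNIV" and n: "even n" and k: "odd k" "k < n"
    and E: "\<And>e. e \<in> E \<Longrightarrow> e = {w 0, w k} \<or> (\<exists>i<n. e = {w i, w ((i + 1) mod n)})"
  shows "is_bipartite E"
  unfolding is_bipartite_def
proof (intro exI conjI ballI)
  let ?even = "w ` {i. i < n \<and> even i}" and ?odd = "w ` {i. i < n \<and> odd i}"
  show "?even \<union> ?odd = UNIV" using w by (auto simp: bij_betw_def)
  show "?even \<inter> ?odd = {}" using w by (auto simp: bij_betw_def inj_on_def)
  fix e assume "e \<in> E"
  from E[OF this] show "\<exists>a\<in>?even. \<exists>b\<in>?odd. e = {a, b}"
  proof (elim disjE exE conjE)
    assume "e = {w 0, w k}"
    then show ?thesis using k by (intro bexI[of _ "w 0"] bexI[of _ "w k"]) auto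
  next
    fix i assume i: "i < n" "e = {w i, w ((i + 1) mod n)}"
    have parity: "even ((i + 1) mod n) \<longleftrightarrow> odd i" using n by (simp add: dvd_mod_iff)
    have less: "(i + 1) mod n < n" using i(1) by simp
    show ?thesis
    proof (cases "even i")
      case True
      then show ?thesis using i parity less by (intro bexI[of _ "w i"] bexI[of _ "w ((i + 1) mod n)"]) auto
    next
      case False
      then show ?thesis using i parity less by (intro bexI[of _ "w ((i + 1) mod n)"] bexI[of _ "w i"]) auto
    qed
  qed
qed

definition edge_binomial :: "'v \<Rightarrow> 'v \<Rightarrow> ('v + 'v, 'k :: field) mpoly" where
  "edge_binomial i j = indet (Inl i) * indet (Inl j) - indet (Inr i) * indet (Inr j)"

lemma edge_binomial_commute: "edge_binomial i j = edge_binomial j i"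
  by (simp add: edge_binomial_def mult.commute)

text \<open>Every cycle edge joins labels of opposite parity, the closing one because
  \<open>n\<close> is even, so swapping at odd labels turns it into a minor up to sign. Both ends of
  the chord are even, so its binomial keeps its shape.\<close>

theorem parity_ideal_of_chorded_even_cycle:
  fixes w :: "nat \<Rightarrow> 'v :: finite" and E :: "'v set set"
  assumes w: "bij_betw w {..<n} UNIV" and n: "even n" "2 \<le> n" and k: "even k" "k < n"
    and E: "E = insert {w 0, w k} {{w i, w ((i + 1) mod n)} | i. i < n}"
    and p: "p = (\<lambda>i. if even i then Inl (w i) else Inr (w i))"
    and q: "q = (\<lambda>i. if even i then Inr (w i) else Inl (w i))"
  shows "vertex_variables n p q"
    and "(parity_binomial_edge_ideal E :: ('v + 'v, 'k :: field) mpoly set) = vertex_variables.cycle_ideal n p q k"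
proof -
  have inj: "w i = w j \<longleftrightarrow> i = j" if "i < n" "j < n" for i j
    using w that by (auto simp: bij_betw_def inj_on_def)
  show V: "vertex_variables n p q"
  proof
    show "inj_on p {..<n}" "inj_on q {..<n}" using inj by (auto simp: inj_on_def p q split: if_splits)
    show "p i \<noteq> q j" if "i < n" "j < n" for i j using inj[OF that] by (auto simp: p q)
    show "UNIV = p ` {..<n} \<union> q ` {..<n}"
    proof (intro Set.equalityI subsetI)
      fix x :: "'v + 'v"
      obtain v where v: "x = Inl v \<or> x = Inr v" by (cases x) auto
      obtain i where "i < n" "v = w i" using w unfolding bij_betw_def by (metis UNIV_I imageE lessThan_iff)
      then have "x = p i \<or> x = q i" using v by (auto simp: p q)
      then show "x \<in> p ` {..<n} \<union> q ` {..<n}" using \<open>i < n\<close> by blast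
    qed simp
  qed
  interpret vertex_variables n p q "TYPE('k)" by (rule V)
  have minor_eq: "minor i j = (if even i then edge_binomial (w i) (w j) else - edge_binomial (w i) (w j))"
    if "even j \<longleftrightarrow> odd i" for i j
    unfolding minor_def edge_binomial_def using that by (auto simp: p q)
  have chord_eq: "chord_binomial k = edge_binomial (w 0) (w k)"
    unfolding chord_binomial_def edge_binomial_def using k by (simp add: p q)
  have last_eq: "minor (n - 1) 0 = - edge_binomial (w (n - 1)) (w 0)"
    using minor_eq[of 0 "n - 1"] n by simp
  let ?I = "parity_binomial_edge_ideal E :: ('v + 'v, 'k) mpoly set"
  have ideal_I: "ideal ?I" by (simp add: parity_binomial_edge_ideal_def)
  have edge_in_I: "edge_binomial i j \<in> ?I" if "{i, j} \<in> E" for i j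
    unfolding parity_binomial_edge_ideal_def edge_binomial_def
    using that by (intro self_module.span_base) blast
  show "?I = cycle_ideal k"
  proof (rule Set.equalityI)
    have edge: "edge_binomial (w i) (w ((i + 1) mod n)) \<in> cycle_ideal k" if i: "i < n" for i
    proof (cases "i = n - 1")
      case True
      have "minor (n - 1) 0 \<in> cycle_ideal k" unfolding cycle_ideal_def by (intro self_module.span_base) blast
      then have "- minor (n - 1) 0 \<in> cycle_ideal k" by (rule ideal_neg[OF ideal_cycle_ideal])
      then have "edge_binomial (w (n - 1)) (w 0) \<in> cycle_ideal k" by (simp only: last_eq minus_minus)
      moreover have "(i + 1) mod n = 0" using True n by simp
      ultimately show ?thesis using True by (simp only:)
    next
      case False
      then have "minor i (Suc i) \<in> cycle_ideal k" using i by (intro minor_in_cycle_ideal) simp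
      moreover from this have "- minor i (Suc i) \<in> cycle_ideal k" by (rule ideal_neg[OF ideal_cycle_ideal])
      moreover have "(i + 1) mod n = Suc i" using False i by simp
      ultimately show ?thesis using minor_eq[of "Suc i" i] by (simp split: if_splits)
    qed
    have "edge_binomial a b \<in> cycle_ideal k" if ab: "{a, b} \<in> E" for a b
    proof -
      from ab consider "{a, b} = {w 0, w k}" | i where "i < n" "{a, b} = {w i, w ((i + 1) mod n)}"
        unfolding E by blast
      then show ?thesis
      proof cases
        case 1
        then have "edge_binomial a b = (edge_binomial (w 0) (w k) :: ('v + 'v, 'k) mpoly)"
          using edge_binomial_commute[of a b] by (auto simp: doubleton_eq_iff)
        then show ?thesis using chord_in_cycle_ideal[of k] by (simp only: chord_eq)
      next
        case (2 i)
        then have "edge_binomial a b = (edge_binomial (w i) (w ((i + 1) mod n)) :: ('v + 'v, 'k) mpoly)"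
          using edge_binomial_commute[of a b] by (auto simp: doubleton_eq_iff)
        then show ?thesis using edge[OF 2(1)] by (simp only:)
      qed
    qed
    then show "?I \<subseteq> cycle_ideal k"
      unfolding parity_binomial_edge_ideal_def edge_binomial_def
      by (intro self_module.span_minimal[OF _ ideal_cycle_ideal]) blast
  next
    show "cycle_ideal k \<subseteq> ?I"
      unfolding cycle_ideal_def
    proof (rule self_module.span_minimal[OF _ ideal_I], rule subsetI)
      fix h assume "h \<in> (\<lambda>i. minor i (Suc i)) ` {..<n - 1} \<union> {minor (n - 1) 0, chord_binomial k}"
      then consider i where "i < n - 1" "h = minor i (Suc i)" | "h = minor (n - 1) 0" | "h = chord_binomial k"
        by auto
      then show "h \<in> ?I"
      proof cases
        case (1 i)
        then have "(i + 1) mod n = Suc i" by simp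
        then have "{w i, w (Suc i)} \<in> E" unfolding E using 1 by (intro insertI2 CollectI exI[of _ i]) simp
        from edge_in_I[OF this] show ?thesis
          using ideal_neg[OF ideal_I] by (simp add: 1 minor_eq)
      next
        case 2
        have "n - 1 + 1 = n" using n by simp
        then have "{w (n - 1), w 0} \<in> E"
          unfolding E using n by (intro insertI2 CollectI exI[of _ "n - 1"]) simp
        from ideal_neg[OF ideal_I edge_in_I[OF this]] show ?thesis by (simp only: 2 last_eq)
      next
        case 3
        have "{w 0, w k} \<in> E" unfolding E by (rule insertI1)
        from edge_in_I[OF this] show ?thesis by (simp only: 3 chord_eq)
      qed
    qed
  qed
qed

theorem proposition8p8:
  fixes n :: nat
    and C E :: "'v :: finite set set"
    and chord :: "'v set"
  assumes "CHAR('k :: alg_closed_field) \<noteq> 2"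
    and "even n"
    and "is_cycle_graph n C"
    and "is_chord C chord"
    and "E = insert chord C"
    and "\<not> is_bipartite E"
  shows "v_number (parity_binomial_edge_ideal E :: ('v + 'v, 'k) mpoly set)
         \<le> reg_quotient (parity_binomial_edge_ideal E :: ('v + 'v, 'k) mpoly set)"
proof -
  have n: "3 \<le> n" using assms(3) by (simp add: is_cycle_graph_def)
  from assms(4) obtain u v where uv: "u \<noteq> v" "chord = {u, v}" "chord \<notin> C"
    unfolding is_chord_def by blast
  obtain w where w: "bij_betw w {..<n} UNIV" "w 0 = u"
    and C: "C = {{w i, w ((i + 1) mod n)} | i. i < n}"
    using cycle_graph_from_vertex[OF assms(3)] by blast
  obtain k where k: "k < n" "w k = v"
    using w(1) unfolding bij_betw_def by (metis UNIV_I imageE lessThan_iff)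
  have "k \<noteq> 0" using uv(1) w(2) k(2) by (intro notI) simp
  moreover have "k \<noteq> 1"
  proof
    assume "k = 1"
    then have "chord \<in> C" unfolding C using uv(2) w(2) k n by (intro CollectI exI[of _ 0]) simp
    then show False using uv(3) by blast
  qed
  moreover have "k \<noteq> n - 1"
  proof
    assume "k = n - 1"
    moreover have "(n - 1 + 1) mod n = 0" using n by simp
    ultimately have "chord \<in> C"
      unfolding C using uv(2) w(2) k n by (intro CollectI exI[of _ "n - 1"]) (simp add: insert_commute)
    then show False using uv(3) by blast
  qed
  \<comment> \<open>Non-adjacency excludes both neighbours 1 and n - 1 of the vertex 0.\<close>
  ultimately have k2: "2 \<le> k" "k \<le> n - 2" using k(1) by auto
  have E: "E = insert {w 0, w k} {{w i, w ((i + 1) mod n)} | i. i < n}"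
    using assms(5) uv(2) w(2) k(2) by (simp only: C)
  have "even k"
  proof (rule ccontr)
    assume odd: "odd k"
    have "is_bipartite E" by (rule bipartite_odd_chord[OF w(1) assms(2) odd k(1)]) (auto simp: E)
    then show False using assms(6) by blast
  qed
  define p where "p = (\<lambda>i. if even i then Inl (w i) else Inr (w i))"
  define q where "q = (\<lambda>i. if even i then Inr (w i) else Inl (w i))"
  have n2: "2 \<le> n" using n by simp
  note parity = parity_ideal_of_chorded_even_cycle[OF w(1) assms(2) n2 \<open>even k\<close> k(1) E p_def q_def]
  interpret vertex_variables n p q "TYPE('k)" by (rule parity(1))
  have "v_number (cycle_ideal k) \<le> ereal (real (n - 2))" by (rule v_number_cycle_ideal_le[OF k2])
  also have "\<dots> \<le> reg_quotient (cycle_ideal k)" by (rule reg_cycle_ideal_ge[OF n])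
  finally show ?thesis by (simp only: parity(2))
qed

end
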